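(* Let $C$ be a hyperelliptic curve of genus $g$ over a finite field $\mathbb{F}_q$ of characteristic not $2$, given by an affine model $y^2 = f(x)$ with $\deg f = 2g+1$, having a single point at infinity $P_\infty$, and let $J$ be its Jacobian. Let $m$ be a positive integer such that $\mathbb{F}_q$ contains a primitive $m$th root of unity. Let $D \in J(\mathbb{F}_q)[m]$ and $E \in J(\mathbb{F}_q)$ have representatives $D = P_1 + \dots + P_g - gP_\infty$ and $E = Q_1 + \dots + Q_g - gP_\infty$ (with $Q_j$ affine points of $C$), where $P_i \neq Q_j$ and $P_i \neq Q_j'$ for all $i,j$. Let $h_{m,D}$ be a rational function on $C$ with divisor $mP_1 + \dots + mP_g - gmP_\infty$, and define \[v_m(D,E) := \left(h_{m,D}(Q_1 - Q_1' + Q_2 - Q_2' + \dots + Q_g - Q_g')\right)^{(q-1)/m}.\] Then $v_m(D,E) = \pm\, \phi_m(D,E)^2$.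
   Context: For a point $P=(x,y)$ on $C$, $P'$ denotes $(x,-y)$. Representatives are taken semi-reduced: $A - gP_\infty$ with $A$ effective of degree $g$, and if $P$ occurs in $A$ then $P'$ does not occur elsewhere in $A$. For a function $h$ and a divisor $\sum n_i(R_i)$ disjoint from the zeros and poles of $h$, $h(\sum n_i(R_i)) = \prod h(R_i)^{n_i}$. The Tate pairing $\phi_m : J(\mathbb{F}_q)[m]\times J(\mathbb{F}_q)/mJ(\mathbb{F}_q) \to \mathbb{F}_q^*/(\mathbb{F}_q^* )^m$ is defined by $\phi_m(D,E) = h_{m,D}(E)^{(q-1)/m}$, where $h_{m,D}$ has divisor $mD$ and $h_{m,D}$ is evaluated at a divisor in the class of $E$ whose support avoids the zeros and poles of $h_{m,D}$; it is well defined, bilinear and non-degenerate, with values in the group of $m$th roots of unity. *)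

theory Defs
  imports
    "HOL-Algebra.Algebraic_Closure_Type"
    "HOL-Algebra.Free_Abelian_Groups"
    "HOL-Computational_Algebra.Computational_Algebra"
    "HOL-Library.Cardinality"
begin

section \<open>The curve and its geometric points\<close>

text \<open>
  The base field is the finite type \<open>'k\<close>, of cardinality $q$, and \<open>'k alg_closure\<close> is its
  algebraic closure. As usual, "points of the curve" are geometric points.
\<close>

datatype 'a point = Infinity | Affine 'a 'a

definition ac_poly :: "'k::field poly \<Rightarrow> 'k alg_closure poly" where
  "ac_poly f = map_poly to_ac f"

text \<open>
  The last condition is the Jacobian criterion for the affine curve $y^2 = f(x)$; together with
  the odd degree of $f$ it makes the genus equal to $g$.
\<close>

definition hyperelliptic_curve :: "nat \<Rightarrow> 'k::{field,finite} poly \<Rightarrow> bool" where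
  "hyperelliptic_curve g f \<longleftrightarrow>
     CHAR('k) \<noteq> 2 \<and> g \<ge> 1 \<and> Polynomial.degree f = 2 * g + 1 \<and>
     (\<forall>x y. y ^ 2 = poly (ac_poly f) x \<longrightarrow>
        \<not> (2 * y = 0 \<and> poly (pderiv (ac_poly f)) x = 0))"

definition curve_points :: "'k::field poly \<Rightarrow> 'k alg_closure point set" where
  "curve_points f = insert Infinity {Affine x y | x y. y ^ 2 = poly (ac_poly f) x}"

fun opposite :: "'a::uminus point \<Rightarrow> 'a point" where
  "opposite Infinity = Infinity"
| "opposite (Affine x y) = Affine x (- y)"

fun frobenius :: "'k::{field,finite} alg_closure point \<Rightarrow> 'k alg_closure point" where
  "frobenius Infinity = Infinity"
| "frobenius (Affine x y) = Affine (x ^ CARD('k)) (y ^ CARD('k))"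


section \<open>Rational functions\<close>

text \<open>
  Let $K$ be \<open>'k alg_closure\<close>. The function field $K(x)(\sqrt f)$ is realised as a subfield of
  the algebraic closure of $K(x)$, by fixing a square root of $f$ there. The root
  chosen plays the role of the coordinate function $y$; the other choice gives an isomorphic
  function field with its coordinates.
\<close>

type_synonym 'k fun_field = "'k alg_closure poly fract alg_closure"

definition const_fun :: "'k::field alg_closure \<Rightarrow> 'k fun_field" where
  "const_fun c = to_ac (to_fract [:c:])"

definition x_fun :: "'k::field fun_field" where
  "x_fun = to_ac (to_fract [:0, 1:])"

definition y_fun :: "'k::field poly \<Rightarrow> 'k fun_field" where
  "y_fun f = (SOME y. y ^ 2 = to_ac (to_fract (ac_poly f)))"

definition function_field :: "'k::field poly \<Rightarrow> 'k fun_field set" where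
  "function_field f = {to_ac a + to_ac b * y_fun f | a b. True}"

text \<open>
  Near an affine point the coordinates are $s = x$, $t = y$. Near the point at infinity they are
  $s = 1/x$, $t = y/x^{g+1}$, which satisfy $t^2 = s^{2g+2} f(1/s)$; this second affine model is
  smooth at its point $(0,0)$, which is $P_\infty$.
\<close>

fun chart :: "nat \<Rightarrow> 'k::field poly \<Rightarrow> 'k alg_closure point \<Rightarrow> 'k fun_field \<times> 'k fun_field" where
  "chart g f Infinity = (1 / x_fun, y_fun f / x_fun ^ (g + 1))"
| "chart g f (Affine x y) = (x_fun, y_fun f)"

fun chart_coords :: "'a::zero point \<Rightarrow> 'a \<times> 'a" where
  "chart_coords Infinity = (0, 0)"
| "chart_coords (Affine x y) = (x, y)"

text \<open>
  Both coordinate rings are of the form $K[s] \oplus K[s]\,t$. The function $h$ is regular at $P$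
  with value $v$ iff it is a quotient of two elements of the coordinate ring whose denominator
  does not vanish at $P$, and $v$ is the quotient of their values.
\<close>

definition coord_fun ::
  "'k::field fun_field \<times> 'k fun_field \<Rightarrow> 'k alg_closure poly \<Rightarrow> 'k alg_closure poly \<Rightarrow> 'k fun_field"
  where "coord_fun = (\<lambda>(s, t) a b.
     poly (map_poly const_fun a) s + poly (map_poly const_fun b) s * t)"

definition coord_val ::
  "'k::field alg_closure \<times> 'k alg_closure \<Rightarrow> 'k alg_closure poly \<Rightarrow> 'k alg_closure poly \<Rightarrow> 'k alg_closure"
  where "coord_val = (\<lambda>(s, t) a b. poly a s + poly b s * t)"

definition has_value ::
  "nat \<Rightarrow> 'k::field poly \<Rightarrow> 'k alg_closure point \<Rightarrow> 'k fun_field \<Rightarrow> 'k alg_closure \<Rightarrow> bool" where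
  "has_value g f P h v \<longleftrightarrow>
     (\<exists>a b c d. coord_val (chart_coords P) c d \<noteq> 0 \<and>
        h = coord_fun (chart g f P) a b / coord_fun (chart g f P) c d \<and>
        v = coord_val (chart_coords P) a b / coord_val (chart_coords P) c d)"

definition fun_val ::
  "nat \<Rightarrow> 'k::field poly \<Rightarrow> 'k fun_field \<Rightarrow> 'k alg_closure point \<Rightarrow> 'k alg_closure" where
  "fun_val g f h P = (THE v. has_value g f P h v)"

definition local_ring :: "nat \<Rightarrow> 'k::field poly \<Rightarrow> 'k alg_closure point \<Rightarrow> 'k fun_field set" where
  "local_ring g f P = {h. \<exists>v. has_value g f P h v}"

definition max_ideal :: "nat \<Rightarrow> 'k::field poly \<Rightarrow> 'k alg_closure point \<Rightarrow> 'k fun_field set" where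
  "max_ideal g f P = {h. has_value g f P h 0}"

definition uniformizer ::
  "nat \<Rightarrow> 'k::field poly \<Rightarrow> 'k alg_closure point \<Rightarrow> 'k fun_field \<Rightarrow> bool" where
  "uniformizer g f P t \<longleftrightarrow> max_ideal g f P = (\<lambda>u. t * u) ` local_ring g f P"

definition ord_at :: "nat \<Rightarrow> 'k::field poly \<Rightarrow> 'k alg_closure point \<Rightarrow> 'k fun_field \<Rightarrow> int" where
  "ord_at g f P h =
     (THE n. \<exists>t u. uniformizer g f P t \<and> u \<in> local_ring g f P - max_ideal g f P \<and>
        h = t powi n * u)"


section \<open>Divisors and the Jacobian\<close>

text \<open>Divisors are the elements of the free abelian group on \<^term>\<open>curve_points f\<close>.\<close>

type_synonym 'k divisor = "'k alg_closure point \<Rightarrow>\<^sub>0 int"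

definition divisor_degree :: "'k::field divisor \<Rightarrow> int" where
  "divisor_degree d = (\<Sum>P\<in>Poly_Mapping.keys d. Poly_Mapping.lookup d P)"

definition divisors0 :: "'k::field poly \<Rightarrow> 'k divisor monoid" where
  "divisors0 f = (free_Abelian_group (curve_points f))
     \<lparr>carrier := {d \<in> carrier (free_Abelian_group (curve_points f)). divisor_degree d = 0}\<rparr>"

definition has_divisor :: "nat \<Rightarrow> 'k::field poly \<Rightarrow> 'k fun_field \<Rightarrow> 'k divisor \<Rightarrow> bool" where
  "has_divisor g f h d \<longleftrightarrow>
     h \<in> function_field f \<and> h \<noteq> 0 \<and> d \<in> carrier (free_Abelian_group (curve_points f)) \<and>
     (\<forall>P\<in>curve_points f. ord_at g f P h = Poly_Mapping.lookup d P)"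

definition principal_divisors :: "nat \<Rightarrow> 'k::field poly \<Rightarrow> 'k divisor set" where
  "principal_divisors g f = {d. \<exists>h. has_divisor g f h d}"

definition jacobian :: "nat \<Rightarrow> 'k::field poly \<Rightarrow> 'k divisor set monoid" where
  "jacobian g f = divisors0 f Mod principal_divisors g f"

definition frobenius_divisor :: "'k::{field,finite} divisor \<Rightarrow> 'k divisor" where
  "frobenius_divisor = frag_extend (\<lambda>P. frag_of (frobenius P))"

text \<open>
  The absolute Galois group of the base field is topologically generated by the $q$-power
  Frobenius, so rationality means invariance under it.
\<close>

definition rational_jacobian :: "nat \<Rightarrow> 'k::{field,finite} poly \<Rightarrow> 'k divisor set set" where
  "rational_jacobian g f = {D \<in> carrier (jacobian g f). frobenius_divisor ` D = D}"

definition rational_torsion :: "nat \<Rightarrow> 'k::{field,finite} poly \<Rightarrow> nat \<Rightarrow> 'k divisor set set" where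
  "rational_torsion g f m =
     {D \<in> rational_jacobian g f. D [^]\<^bsub>jacobian g f\<^esub> m = \<one>\<^bsub>jacobian g f\<^esub>}"

definition eval_divisor ::
  "nat \<Rightarrow> 'k::field poly \<Rightarrow> 'k fun_field \<Rightarrow> 'k divisor \<Rightarrow> 'k alg_closure" where
  "eval_divisor g f h e =
     (\<Prod>R\<in>Poly_Mapping.keys e. fun_val g f h R powi Poly_Mapping.lookup e R)"

text \<open>
  In a representative $P_1 + \dots + P_g - g P_\infty$ some of the $P_i$ may be $P_\infty$, and
  then the condition on opposite points concerns the affine $P_i$ only.
\<close>

definition semi_reduced :: "nat \<Rightarrow> (nat \<Rightarrow> 'a::uminus point) \<Rightarrow> bool" where
  "semi_reduced g P \<longleftrightarrow>
     (\<forall>i\<in>{1..g}. \<forall>j\<in>{1..g}. i \<noteq> j \<longrightarrow> P i \<noteq> Infinity \<longrightarrow> P j \<noteq> opposite (P i))"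

definition rep_divisor :: "nat \<Rightarrow> (nat \<Rightarrow> 'k::field alg_closure point) \<Rightarrow> 'k divisor" where
  "rep_divisor g P = (\<Sum>i=1..g. frag_of (P i)) - frag_cmul (int g) (frag_of Infinity)"


section \<open>The Tate pairing\<close>

definition primitive_root_of_unity :: "nat \<Rightarrow> 'a::monoid_mult \<Rightarrow> bool" where
  "primitive_root_of_unity m z \<longleftrightarrow> z ^ m = 1 \<and> (\<forall>k. 0 < k \<and> k < m \<longrightarrow> z ^ k \<noteq> 1)"

text \<open>
  Classes in $J(\mathbb{F}_q)$ are represented by divisors defined over $\mathbb{F}_q$; for
  arbitrary geometric representatives the value would not be well defined. It depends neither on
  the representatives $d$, $e$ nor on the function $h$, and changes by nothing when $E$ is moved
  within its coset of $m J(\mathbb{F}_q)$. It is an element of $\mathbb{F}_q$, regarded here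
  inside the algebraic closure.
\<close>

definition tate_pairing ::
  "nat \<Rightarrow> 'k::{field,finite} poly \<Rightarrow> nat \<Rightarrow> 'k divisor set \<Rightarrow> 'k divisor set \<Rightarrow> 'k alg_closure" where
  "tate_pairing g f m D E =
     (THE z. \<exists>d\<in>D. \<exists>e\<in>E. \<exists>h.
        frobenius_divisor d = d \<and> frobenius_divisor e = e \<and>
        has_divisor g f h (frag_cmul (int m) d) \<and>
        Poly_Mapping.keys e \<inter> Poly_Mapping.keys (frag_cmul (int m) d) = {} \<and>
        z = eval_divisor g f h e ^ ((CARD('k) - 1) div m))"

definition v_pairing ::
  "nat \<Rightarrow> 'k::{field,finite} poly \<Rightarrow> nat \<Rightarrow> 'k fun_field \<Rightarrow> (nat \<Rightarrow> 'k alg_closure point) \<Rightarrow> 'k alg_closure"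
  where
  "v_pairing g f m h Q =
     eval_divisor g f h (\<Sum>j=1..g. frag_of (Q j) - frag_of (opposite (Q j))) ^ ((CARD('k) - 1) div m)"

end

theory Submission
  imports Defs
begin

text \<open>
  The class of $2E$ contains $\sum_j (Q_j - Q_j')$, because $Q_j + Q_j' - 2P_\infty$ is the divisor of
  a vertical line. This divisor is rational and disjoint from the support of $D$, so $v_m(D,E)$ is
  the value of the pairing at $(D, 2E)$ (in particular the sign is always $+$).

  The pairing is independent of the representatives by Weil reciprocity. In order to avoid moving
  divisors, a function is evaluated at a divisor through its leading coefficients with respect to
  fixed uniformizers, which commute with Frobenius; reciprocity is then the product formula for the
  tame symbols. For the symbols of $x - c$ this formula follows by taking norms down to $K(x)$, and
  the Steinberg relation reduces all symbols to these. A class in $J(\mathbb{F}_q)$ has a rational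
  reduced representative since reduced representatives are unique, and a rational function with a
  prescribed order at $P_\infty$ makes the supports disjoint.
\<close>

section \<open>Discrete valuations given by a value relation\<close>

text \<open>The exponent (q-1)/m is what makes the pairing insensitive to principal divisors. If
  \<open>h\<close> has divisor m d and \<open>w\<close> has a rational divisor, reciprocity turns
  \<open>h\<close> at the divisor of \<open>w\<close> into the m-th power of \<open>w\<close> at d,
  up to sign. The exponent completes this to the (q-1)-th power of a nonzero element of the base
  field, which is 1. The sign disappears in the same way, because the orders of \<open>h\<close> are
  multiples of m and -1 lies in the base field; this is why no sign is left in the result. The
  obstacle is that evaluation needs disjoint supports. The given representative of E contains
  P_infinity, as in general does that of D, while the sum of the Q_j - Q_j' avoids it; the functions
  that link such divisors have zeros and poles at points of D. Leading coefficients remain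
  multiplicative there, but they depend on the uniformizers. Hence the uniformizers are coordinate
  functions, which the Frobenius map and y -> -y permute up to sign.\<close>

locale place =
  fixes F :: "'b::field set" and hv :: "'b \<Rightarrow> 'a::field \<Rightarrow> bool" and t :: 'b
  assumes hv_unique: "hv h v \<Longrightarrow> hv h w \<Longrightarrow> v = w"
    and hv_1: "hv 1 1"
    and hv_uminus: "hv h v \<Longrightarrow> hv (- h) (- v)"
    and hv_add: "hv h v \<Longrightarrow> hv k w \<Longrightarrow> hv (h + k) (v + w)"
    and hv_mult: "hv h v \<Longrightarrow> hv k w \<Longrightarrow> hv (h * k) (v * w)"
    and hv_inverse: "hv h v \<Longrightarrow> v \<noteq> 0 \<Longrightarrow> hv (inverse h) (inverse v)"
    and hv_t: "hv t 0" and t_nz: "t \<noteq> 0"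
    and hv_F: "hv h v \<Longrightarrow> h \<in> F"
    and dec_ex: "h \<in> F \<Longrightarrow> h \<noteq> 0 \<Longrightarrow> \<exists>n u v. h = t powi n * u \<and> hv u v \<and> v \<noteq> 0"

text \<open>Order and leading coefficient are kept in one relation, so that uniqueness, products and
  inverses are proved once for both; \<open>pord\<close> and \<open>plc\<close> are its two
  projections.\<close>

definition dec :: "('b::field \<Rightarrow> 'a::field \<Rightarrow> bool) \<Rightarrow> 'b \<Rightarrow> 'b \<Rightarrow> int \<Rightarrow> 'a \<Rightarrow> bool" where
  "dec hv t h n v \<longleftrightarrow> (\<exists>u. h = t powi n * u \<and> hv u v \<and> v \<noteq> 0)"

definition pord :: "('b::field \<Rightarrow> 'a::field \<Rightarrow> bool) \<Rightarrow> 'b \<Rightarrow> 'b \<Rightarrow> int" where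
  "pord hv t h = (THE n. \<exists>v. dec hv t h n v)"

definition plc :: "('b::field \<Rightarrow> 'a::field \<Rightarrow> bool) \<Rightarrow> 'b \<Rightarrow> 'b \<Rightarrow> 'a" where
  "plc hv t h = (THE v. \<exists>n. dec hv t h n v)"

context place
begin

lemma hv_0: "hv 0 0"
  using hv_add[OF hv_1 hv_uminus[OF hv_1]] by simp

lemma hv_power: "hv h v \<Longrightarrow> hv (h ^ n) (v ^ n)"
  by (induction n) (auto intro: hv_1 hv_mult)

lemma hv_t_power: "n > 0 \<Longrightarrow> hv (t ^ n) 0"
  using hv_power[OF hv_t, of n] by (simp add: power_0_left)

lemma hv_unit_nz: "hv h v \<Longrightarrow> v \<noteq> 0 \<Longrightarrow> h \<noteq> 0"
  using hv_0 hv_unique by metis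

text \<open>If n exceeded n', the unit u' would be a positive power of \<open>t\<close> times u, and
  its value would be 0.\<close>

lemma dec_unique_aux:
  assumes "t powi n * u = t powi n' * u'" "hv u v" "v \<noteq> 0" "hv u' v'" "v' \<noteq> 0"
  shows "n \<le> n'"
proof (rule ccontr)
  assume "\<not> n \<le> n'"
  then have m: "nat (n - n') > 0" "n - n' = int (nat (n - n'))" by auto
  have "u' = t powi (n - n') * u"
    using assms(1) t_nz by (simp add: power_int_diff field_simps)
  also have "\<dots> = t ^ nat (n - n') * u"
    by (subst m(2), subst power_int_of_nat) simp
  finally have "u' = t ^ nat (n - n') * u" .
  then have "hv u' (0 * v)"
    using hv_mult[OF hv_t_power[OF m(1)] assms(2)] by simp
  then show False
    using assms(5) hv_unique[OF assms(4)] by (metis mult_zero_left)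
qed

lemma dec_unique:
  assumes "dec hv t h n v" "dec hv t h n' v'"
  shows "n = n' \<and> v = v'"
proof -
  obtain u where u: "h = t powi n * u" "hv u v" "v \<noteq> 0" using assms(1) by (auto simp: dec_def)
  obtain u' where u': "h = t powi n' * u'" "hv u' v'" "v' \<noteq> 0" using assms(2) by (auto simp: dec_def)
  have n: "n = n'"
    using dec_unique_aux[of n u n' u' v v'] dec_unique_aux[of n' u' n u v' v] u u' by force
  then have "u = u'"
    using u u' t_nz by auto
  then show ?thesis using n u u' hv_unique by auto
qed

lemma dec_eq: "dec hv t h n v \<Longrightarrow> pord hv t h = n" "dec hv t h n v \<Longrightarrow> plc hv t h = v"
  unfolding pord_def plc_def by (blast intro: the_equality dest: dec_unique)+

lemma dec_ord: 
  assumes "h \<in> F" "h \<noteq> 0" shows "dec hv t h (pord hv t h) (plc hv t h)"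
proof -
  obtain n v where "dec hv t h n v" using dec_ex[OF assms] by (auto simp: dec_def)
  then show ?thesis using dec_eq by metis
qed

lemma dec_nz: "dec hv t h n v \<Longrightarrow> v \<noteq> 0 \<and> h \<noteq> 0"
  unfolding dec_def using hv_unit_nz t_nz by auto

lemma lc_nz: "h \<in> F \<Longrightarrow> h \<noteq> 0 \<Longrightarrow> plc hv t h \<noteq> 0"
  using dec_ord dec_nz by blast

lemma dec_mult:
  assumes "dec hv t h n v" "dec hv t k m w"
  shows "dec hv t (h * k) (n + m) (v * w)"
proof -
  obtain u where u: "h = t powi n * u" "hv u v" "v \<noteq> 0" using assms(1) by (auto simp: dec_def)
  obtain u' where u': "k = t powi m * u'" "hv u' w" "w \<noteq> 0" using assms(2) by (auto simp: dec_def)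
  have "h * k = t powi (n + m) * (u * u')"
    using u u' t_nz by (simp add: power_int_add)
  then show ?thesis unfolding dec_def using hv_mult[OF u(2) u'(2)] u(3) u'(3)
    by (intro exI[of _ "u * u'"]) simp
qed

lemma dec_inverse:
  assumes "dec hv t h n v"
  shows "dec hv t (inverse h) (- n) (inverse v)"
proof -
  obtain u where u: "h = t powi n * u" "hv u v" "v \<noteq> 0" using assms(1) by (auto simp: dec_def)
  have "inverse h = t powi (- n) * inverse u"
    using u t_nz by (simp add: power_int_minus)
  then show ?thesis unfolding dec_def using hv_inverse[OF u(2,3)] u(3)
    by (intro exI[of _ "inverse u"]) simp
qed

lemma dec_1: "dec hv t 1 0 1"
  unfolding dec_def using hv_1 by auto

lemma dec_t: "dec hv t t 1 1"
  unfolding dec_def using hv_1 by auto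

lemma dec_power: "dec hv t h n v \<Longrightarrow> dec hv t (h ^ k) (int k * n) (v ^ k)"
proof (induction k)
  case (Suc k)
  then show ?case using dec_mult[of h n v "h ^ k" "int k * n" "v ^ k"] by (simp add: algebra_simps)
qed (simp add: dec_1)

lemma dec_unit: "hv h v \<Longrightarrow> v \<noteq> 0 \<Longrightarrow> dec hv t h 0 v"
  unfolding dec_def by auto

lemma dec_hv: 
  assumes "dec hv t h n v" "n \<ge> 0" 
  shows "hv h (if n = 0 then v else 0)"
proof -
  obtain u where u: "h = t powi n * u" "hv u v" using assms(1) by (auto simp: dec_def)
  show ?thesis
  proof (cases "n = 0")
    case False
    then have "hv (t ^ nat n * u) (0 * v)" using assms(2) u by (intro hv_mult hv_t_power) auto
    then show ?thesis using False assms(2) u by (simp add: power_int_nonneg_exp)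
  qed (use u in simp)
qed

lemma hv_0_ord_pos:
  assumes "hv h 0" "h \<noteq> 0"
  shows "pord hv t h > 0"
proof (rule ccontr)
  assume n: "\<not> pord hv t h > 0"
  let ?n = "pord hv t h"
  obtain u v where u: "h = t powi ?n * u" "hv u v" "v \<noteq> 0"
    using dec_ord[OF hv_F[OF assms(1)] assms(2)] by (auto simp: dec_def)
  then have "u = t powi (- ?n) * h"
    using t_nz by (simp add: power_int_minus field_simps)
  also have "\<dots> = t ^ nat (- ?n) * h" using n by (simp add: power_int_nonneg_exp)
  finally have "hv u 0" 
    using hv_mult[OF hv_power[OF hv_t, of "nat (- ?n)"] assms(1)] by simp
  then show False using u hv_unique by blast
qed

lemma hv_iff:
  assumes "h \<in> F" "h \<noteq> 0"
  shows "hv h v \<longleftrightarrow> pord hv t h \<ge> 0 \<and> v = (if pord hv t h = 0 then plc hv t h else 0)"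
proof
  assume v: "hv h v"
  show "pord hv t h \<ge> 0 \<and> v = (if pord hv t h = 0 then plc hv t h else 0)"
  proof (cases "v = 0")
    case True
    then show ?thesis using hv_0_ord_pos[of h] assms v by auto
  next
    case False
    then show ?thesis using dec_unit[OF v] dec_eq by auto
  qed
next
  assume "pord hv t h \<ge> 0 \<and> v = (if pord hv t h = 0 then plc hv t h else 0)"
  then show "hv h v" using dec_hv[OF dec_ord[OF assms]] by auto
qed

lemma ord_mult: "h \<in> F \<Longrightarrow> h \<noteq> 0 \<Longrightarrow> k \<in> F \<Longrightarrow> k \<noteq> 0 \<Longrightarrow> pord hv t (h * k) = pord hv t h + pord hv t k"
  and lc_mult: "h \<in> F \<Longrightarrow> h \<noteq> 0 \<Longrightarrow> k \<in> F \<Longrightarrow> k \<noteq> 0 \<Longrightarrow> plc hv t (h * k) = plc hv t h * plc hv t k"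
  using dec_eq[OF dec_mult[OF dec_ord dec_ord]] by auto

text \<open>Writing t = t' u with u in the valuation ring gives 1 = ord t' + ord u, where ord t' > 0
  and ord u >= 0.\<close>

lemma uniformizer_ord:
  assumes "{h. hv h 0} = (\<lambda>u. t' * u) ` {h. \<exists>v. hv h v}"
  shows "t' \<in> F \<and> t' \<noteq> 0 \<and> pord hv t t' = 1"
proof -
  have "t' * 1 \<in> (\<lambda>u. t' * u) ` {h. \<exists>v. hv h v}" using hv_1 by blast
  then have "t' \<in> {h. hv h 0}" unfolding assms by simp
  then have t': "hv t' 0" by simp
  obtain u v where u: "t = t' * u" "hv u v" using hv_t assms by blast
  have nz: "t' \<noteq> 0" "u \<noteq> 0" using u t_nz by auto
  have "pord hv t t = pord hv t t' + pord hv t u"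
    using u nz ord_mult[OF hv_F[OF t'] _ hv_F] by simp
  moreover have "pord hv t t = 1" using dec_eq[OF dec_t] by simp
  moreover have "pord hv t u \<ge> 0" using hv_iff[OF hv_F[OF u(2)] nz(2)] u by blast
  moreover have "pord hv t t' > 0" using hv_0_ord_pos t' nz by blast
  ultimately show ?thesis using nz hv_F[OF t'] by linarith
qed

lemma uniformizer_t: "{h. hv h 0} = (\<lambda>u. t * u) ` {h. \<exists>v. hv h v}"
proof (intro equalityI subsetI)
  fix h assume "h \<in> {h. hv h 0}"
  then have h: "hv h 0" by simp
  show "h \<in> (\<lambda>u. t * u) ` {h. \<exists>v. hv h v}"
  proof (cases "h = 0")
    case True
    then show ?thesis using hv_0 by (intro image_eqI[of _ _ 0]) auto
  next
    case False
    then have d: "dec hv t (inverse t * h) (- 1 + pord hv t h) (inverse 1 * plc hv t h)"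
      using dec_mult[OF dec_inverse[OF dec_t] dec_ord[OF hv_F[OF h]]] by blast
    then have "\<exists>v. hv (inverse t * h) v"
      using dec_hv[OF d] hv_0_ord_pos[OF h False] by auto
    then show ?thesis using t_nz by (intro image_eqI[of _ _ "inverse t * h"]) (auto simp: field_simps)
  qed
next
  fix h assume "h \<in> (\<lambda>u. t * u) ` {h. \<exists>v. hv h v}"
  then show "h \<in> {h. hv h 0}" using hv_mult[OF hv_t] by force
qed

text \<open>The left-hand side is \<open>ord_at\<close> at an abstract place, where the uniformizer
  t' may vary with the decomposition. Every such t' has order 1 with respect to \<open>t\<close>, so
  a unit times the n-th power of t' has order n whichever t' is used.\<close>

lemma ord_characterization:
  assumes h: "h \<in> F" "h \<noteq> 0"
  shows "(THE n. \<exists>t' u. {h. hv h 0} = (\<lambda>u. t' * u) ` {h. \<exists>v. hv h v} \<and>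
            u \<in> {h. \<exists>v. hv h v} - {h. hv h 0} \<and> h = t' powi n * u) = pord hv t h"
proof (rule the_equality)
  obtain u where u: "h = t powi pord hv t h * u" "hv u (plc hv t h)" "plc hv t h \<noteq> 0"
    using dec_ord[OF h] by (auto simp: dec_def)
  moreover have "\<not> hv u 0" using u hv_unique by blast
  ultimately show "\<exists>t' u. {h. hv h 0} = (\<lambda>u. t' * u) ` {h. \<exists>v. hv h v} \<and>
            u \<in> {h. \<exists>v. hv h v} - {h. hv h 0} \<and> h = t' powi (pord hv t h) * u"
    using uniformizer_t by blast
next
  fix n assume "\<exists>t' u. {h. hv h 0} = (\<lambda>u. t' * u) ` {h. \<exists>v. hv h v} \<and>
            u \<in> {h. \<exists>v. hv h v} - {h. hv h 0} \<and> h = t' powi n * u"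
  then obtain t' u v where t': "{h. hv h 0} = (\<lambda>u. t' * u) ` {h. \<exists>v. hv h v}"
    and u: "hv u v" "v \<noteq> 0" "h = t' powi n * u" by auto
  note t' = uniformizer_ord[OF t']
  obtain w where w: "dec hv t t' 1 w" using t' dec_ord[of t'] by auto
  have "\<exists>v. dec hv t (t' powi n) n v"
  proof (cases "n \<ge> 0")
    case True
    then show ?thesis using dec_power[OF w, of "nat n"] by (auto simp: power_int_nonneg_exp)
  next
    case False
    then show ?thesis using dec_power[OF dec_inverse[OF w], of "nat (-n)"] 
      by (auto simp: power_int_def)
  qed
  then show "n = pord hv t h"
    using dec_mult[OF _ dec_unit[OF u(1,2)]] dec_eq(1) u(3) by (metis add.right_neutral)
qed

lemma the_value: 
  assumes "h \<in> F" "h \<noteq> 0" "pord hv t h = 0"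
  shows "(THE v. hv h v) = plc hv t h"
  using hv_iff[OF assms(1,2)] assms(3) by (intro the_equality) auto

end

text \<open>This is the residue of (-1)^(i j) a^j / b^i with i = ord a and j = ord b. The powers of
  the uniformizer cancel in the quotient, so the leading coefficients suffice.\<close>

definition tame :: "('b::field \<Rightarrow> 'a::field \<Rightarrow> bool) \<Rightarrow> 'b \<Rightarrow> 'b \<Rightarrow> 'b \<Rightarrow> 'a" where
  "tame hv t a b = (- 1) powi (pord hv t a * pord hv t b) *
     plc hv t a powi pord hv t b / plc hv t b powi pord hv t a"

context place
begin

lemma tame_mult_left:
  assumes "a \<in> F" "a \<noteq> 0" "a' \<in> F" "a' \<noteq> 0" "b \<in> F" "b \<noteq> 0"
  shows "tame hv t (a * a') b = tame hv t a b * tame hv t a' b"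
  unfolding tame_def using assms lc_nz[of b]
  by (simp add: ord_mult lc_mult power_int_add power_int_mult_distrib algebra_simps)

lemma minus_one_powi_cancel: "(- 1 :: 'a) powi n * (- 1) powi n = 1"
proof -
  have "(- 1 :: 'a) powi n * (- 1) powi n = ((-1) * (-1)) powi n"
    by (simp only: power_int_mult_distrib)
  then show ?thesis by simp
qed

lemma tame_swap:
  assumes "a \<in> F" "a \<noteq> 0" "b \<in> F" "b \<noteq> 0"
  shows "tame hv t a b * tame hv t b a = 1"
  unfolding tame_def using assms lc_nz[of b] lc_nz[of a] minus_one_powi_cancel
  by (simp add: field_simps)

text \<open>An entry of positive order forces the other to have value 1. If a is a unit and b has no
  zero, then b = 1 - a is regular, hence also a unit. If a has a pole of order n, then b = a (1/a -
  1) has the same order and the opposite leading coefficient, and the two signs cancel because n^2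
  and n have the same parity.\<close>

lemma tame_steinberg:
  assumes "a \<in> F" "a \<noteq> 0" "b \<in> F" "b \<noteq> 0" "a + b = 1"
  shows "tame hv t a b = 1"
proof -
  have *: "tame hv t a b = 1" if ab: "a \<in> F" "a \<noteq> 0" "b \<in> F" "b \<noteq> 0" "a + b = 1" "pord hv t a > 0" for a b
  proof -
    have "hv a 0" using hv_iff[of a 0] ab by simp
    then have "hv (1 + - a) (1 + - 0)" by (intro hv_add hv_1 hv_uminus)
    moreover have "1 + - a = b" using ab by (metis add.commute add_diff_cancel_right' diff_conv_add_uminus)
    ultimately have "dec hv t b 0 1" using dec_unit[of b 1] by simp
    then show ?thesis by (simp add: tame_def dec_eq)
  qed
  consider "pord hv t a > 0" | "pord hv t b > 0" | "pord hv t a = 0" "pord hv t b \<le> 0"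
     | "pord hv t a < 0" "pord hv t b \<le> 0" by linarith
  then show ?thesis
  proof cases
    case 1
    then show ?thesis using * assms by blast
  next
    case 2
    then have "tame hv t b a = 1" using *[of b a] assms by (simp add: add.commute)
    then show ?thesis using tame_swap[OF assms(1-4)] by simp
  next
    case 3
    have "hv a (plc hv t a)" using hv_iff[of a] assms 3 by simp
    then have "hv (1 + - a) (1 + - plc hv t a)" by (intro hv_add hv_1 hv_uminus)
    moreover have "1 + - a = b" using assms by (metis add.commute add_diff_cancel_right' diff_conv_add_uminus)
    ultimately have "pord hv t b \<ge> 0" using hv_iff[of b] assms by auto
    then have "pord hv t b = 0" using 3 by simp
    then show ?thesis using 3 by (simp add: tame_def)
  next
    case 4
    let ?n = "pord hv t a" and ?v = "plc hv t a"
    have d: "dec hv t (inverse a) (- ?n) (inverse ?v)" by (intro dec_inverse dec_ord assms)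
    have "hv (inverse a) 0" using dec_hv[OF d] 4 by simp
    then have "hv (inverse a + - 1) (0 + - 1)" by (intro hv_add hv_1 hv_uminus)
    then have "dec hv t (inverse a + - 1) 0 (- 1)" using dec_unit by simp
    then have "dec hv t ((inverse a + - 1) * a) (0 + ?n) (- 1 * ?v)" by (intro dec_mult dec_ord assms)
    moreover have "b = 1 - a" using assms(5) by (simp add: eq_diff_eq add.commute)
    then have "(inverse a + - 1) * a = b" using assms(2) by (simp only:) (simp add: field_simps)
    ultimately have "dec hv t b ?n (- ?v)" by simp
    then have b: "pord hv t b = ?n" "plc hv t b = - ?v" using dec_eq by blast+
    have "(- 1 :: 'a) powi (?n * ?n) = (- 1) powi ?n"
      by (simp add: power_int_minus_left)
    moreover have "(- ?v) powi ?n = (- 1) powi ?n * ?v powi ?n"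
      by (subst power_int_mult_distrib[symmetric]) simp
    ultimately show ?thesis 
      using b lc_nz[of a] assms by (simp add: tame_def)
  qed
qed

lemma tame_self:
  assumes "a \<in> F" "a \<noteq> 0"
  shows "tame hv t a a = (- 1) powi pord hv t a"
  using lc_nz[OF assms] by (simp add: tame_def power_int_minus_left)

end

section \<open>Points on the double covers $t^2 = \varphi(s)$\<close>

lemma const_fun_simps [simp]:
  "const_fun 0 = 0" "const_fun 1 = 1" 
  "const_fun (a + b) = const_fun a + const_fun b"
  "const_fun (a * b) = const_fun a * const_fun b"
  "const_fun (- a) = - const_fun a"
  "const_fun (a - b) = const_fun a - const_fun b"
proof -
  show "const_fun 0 = 0" "const_fun 1 = 1" 
    by (auto simp: const_fun_def one_pCons[symmetric])
  show "const_fun (a + b) = const_fun a + const_fun b"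
    "const_fun (- a) = - const_fun a"
    "const_fun (a - b) = const_fun a - const_fun b" 
    by (simp_all add: const_fun_def flip: to_ac_add to_fract_add to_ac_minus to_fract_uminus to_ac_diff to_fract_diff)
  show "const_fun (a * b) = const_fun a * const_fun b"
    by (simp add: const_fun_def flip: to_ac_mult to_fract_mult)
qed

lemma const_fun_eq_0_iff [simp]: "const_fun c = 0 \<longleftrightarrow> c = 0"
  by (simp add: const_fun_def)

definition pev :: "'k::field fun_field \<Rightarrow> 'k alg_closure poly \<Rightarrow> 'k fun_field" where
  "pev s a = poly (map_poly const_fun a) s"

lemma pev_pCons [simp]: "pev s (pCons c a) = const_fun c + s * pev s a"
  by (simp add: pev_def map_poly_pCons)

lemma pev_0 [simp]: "pev s 0 = 0" 
  by (simp add: pev_def)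

lemma pev_1 [simp]: "pev s 1 = 1" 
  by (simp add: pev_def)

lemma pev_add [simp]: "pev s (a + b) = pev s a + pev s b"
proof (induction a arbitrary: b)
  case (pCons c a)
  then show ?case by (cases b) (simp add: algebra_simps)
qed simp

lemma pev_smult [simp]: "pev s (smult c a) = const_fun c * pev s a"
  by (induction a) (simp_all add: algebra_simps)

lemma pev_mult [simp]: "pev s (a * b) = pev s a * pev s b"
  by (induction a) (simp_all add: algebra_simps)

lemma pev_uminus [simp]: "pev s (- a) = - pev s a"
  by (induction a) (simp_all add: algebra_simps)

lemma pev_diff [simp]: "pev s (a - b) = pev s a - pev s b"
  using pev_add[of s a "- b"] by simp

lemma pev_power [simp]: "pev s (a ^ n) = pev s a ^ n"
  by (induction n) auto

lemma pev_reflect_poly: 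
  assumes "s \<noteq> 0" shows "pev s (reflect_poly a) = s ^ degree a * pev (1 / s) a"
proof -
  have d: "degree (map_poly const_fun a) = degree a" by (rule degree_map_poly) simp
  have m: "map_poly const_fun (reflect_poly a) = reflect_poly (map_poly const_fun a)"
    by (rule poly_eqI) (simp add: coeff_map_poly coeff_reflect_poly d)
  show ?thesis unfolding pev_def m using assms by (simp add: poly_reflect_poly_nz d inverse_eq_divide)
qed

section \<open>Fractions and values on an abstract chart\<close>

definition cov_quot :: "'k::field fun_field \<times> 'k fun_field \<Rightarrow> 'k fun_field set" where
  "cov_quot st = {coord_fun st a b / coord_fun st c d | a b c d. True}"

text \<open>This is \<open>has_value\<close> with the chart and the point abstracted, so that one
  argument serves the affine model and the model at infinity.\<close>

definition cov_val :: "'k::field fun_field \<times> 'k fun_field \<Rightarrow> 'k alg_closure \<times> 'k alg_closure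
    \<Rightarrow> 'k fun_field \<Rightarrow> 'k alg_closure \<Rightarrow> bool" where
  "cov_val st p h v \<longleftrightarrow> (\<exists>a b c d. coord_val p c d \<noteq> 0 \<and>
     h = coord_fun st a b / coord_fun st c d \<and> v = coord_val p a b / coord_val p c d)"

lemma coord_fun_pev: "coord_fun (s, t) a b = pev s a + pev s b * t"
  by (simp add: coord_fun_def pev_def)

lemma coord_val_eq: "coord_val (s0, t0) a b = poly a s0 + poly b s0 * t0"
  by (simp add: coord_val_def)

text \<open>The condition \<open>indep\<close> says that 1 and t form a basis of the coordinate ring
  over K[s]. Hence the pair (a, b) is determined by the function, and evaluation at a point is well
  defined.\<close>

locale dcover =
  fixes s t :: "'k::field fun_field" and \<phi> :: "'k alg_closure poly"
  assumes cov_eq: "t * t = pev s \<phi>"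
    and indep: "pev s a + pev s b * t = 0 \<Longrightarrow> a = 0 \<and> b = 0"
    and two_nz: "(2 :: 'k alg_closure) \<noteq> 0"
begin

lemma pev_eq_0_iff: "pev s a = 0 \<longleftrightarrow> a = 0"
  using indep[of a 0] by auto

lemma cf_mult: "coord_fun (s, t) a b * coord_fun (s, t) c d = coord_fun (s, t) (a * c + b * d * \<phi>) (a * d + b * c)"
proof -
  have "coord_fun (s, t) a b * coord_fun (s, t) c d = 
     pev s a * pev s c + pev s b * pev s d * (t * t) + (pev s a * pev s d + pev s b * pev s c) * t"
    by (simp add: coord_fun_pev algebra_simps)
  then show ?thesis by (simp add: coord_fun_pev cov_eq)
qed

lemma cf_add: "coord_fun (s, t) a b + coord_fun (s, t) c d = coord_fun (s, t) (a + c) (b + d)"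
  by (simp add: coord_fun_pev algebra_simps)

lemma cf_eq_iff: "coord_fun (s, t) a b = coord_fun (s, t) c d \<longleftrightarrow> a = c \<and> b = d"
proof
  assume "coord_fun (s, t) a b = coord_fun (s, t) c d"
  then have "pev s (a - c) + pev s (b - d) * t = 0" by (simp add: coord_fun_pev algebra_simps)
  then show "a = c \<and> b = d" using indep[of "a - c" "b - d"] by simp
qed simp

lemma cf_0: "coord_fun (s, t) 0 0 = 0" and cf_1: "coord_fun (s, t) 1 0 = 1"
  by (auto simp: coord_fun_pev)

lemma cf_eq_0_iff: "coord_fun (s, t) a b = 0 \<longleftrightarrow> a = 0 \<and> b = 0"
  using cf_eq_iff[of a b 0 0] by (simp add: cf_0)

lemma cov_quotE:
  assumes "h \<in> cov_quot (s, t)"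
  obtains a b c d where "h = coord_fun (s, t) a b / coord_fun (s, t) c d" "coord_fun (s, t) c d \<noteq> 0"
proof -
  obtain a b c d where h: "h = coord_fun (s, t) a b / coord_fun (s, t) c d"
    using assms unfolding cov_quot_def by blast
  show ?thesis
  proof (cases "coord_fun (s, t) c d = 0")
    \<comment> \<open>Division by zero yields 0, so a vanishing denominator still describes the
      function 0/1.\<close>
    case True
    then have "h = coord_fun (s, t) 0 0 / coord_fun (s, t) 1 0" using h by (simp add: cf_0)
    then show ?thesis using that[of 0 0 1 0] cf_1 by simp
  qed (use h that in blast)
qed

lemma cov_quotI: "coord_fun (s, t) a b / coord_fun (s, t) c d \<in> cov_quot (s, t)"
  unfolding cov_quot_def by blast

lemma cov_quot_pev: "pev s a + pev s b * t \<in> cov_quot (s, t)"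
  using cov_quotI[of a b 1 0] by (simp add: cf_1 coord_fun_pev)

lemma cov_quot_mult: "h \<in> cov_quot (s, t) \<Longrightarrow> k \<in> cov_quot (s, t) \<Longrightarrow> h * k \<in> cov_quot (s, t)"
  unfolding cov_quot_def by (clarsimp simp: cf_mult) blast

lemma cov_quot_inverse: "h \<in> cov_quot (s, t) \<Longrightarrow> inverse h \<in> cov_quot (s, t)"
  unfolding cov_quot_def by (clarsimp simp: divide_inverse) (metis mult.commute)

lemma cov_quot_add: 
  assumes "h \<in> cov_quot (s, t)" "k \<in> cov_quot (s, t)" shows "h + k \<in> cov_quot (s, t)"
proof -
  obtain a b c d where h: "h = coord_fun (s, t) a b / coord_fun (s, t) c d" "coord_fun (s, t) c d \<noteq> 0"
    using assms(1) cov_quotE by blast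
  obtain a' b' c' d' where k: "k = coord_fun (s, t) a' b' / coord_fun (s, t) c' d'" "coord_fun (s, t) c' d' \<noteq> 0"
    using assms(2) cov_quotE by blast
  show ?thesis unfolding h(1) k(1) using h(2) k(2) 
    by (simp add: add_frac_eq cf_mult cf_add cov_quotI)
qed

end

text \<open>The derivative of t^2 - \<phi>(s) in t is 2 t, which is nonzero at the point if t0 is
  nonzero, by \<open>two_nz\<close>. The Jacobian criterion therefore only restricts points with t0
  = 0.\<close>

locale dpoint = dcover s t \<phi> for s t :: "'k::field fun_field" and \<phi> :: "'k alg_closure poly" +
  fixes s0 t0 :: "'k alg_closure"
  assumes pt_eq: "t0 * t0 = poly \<phi> s0"
    and smooth: "t0 = 0 \<Longrightarrow> poly (pderiv \<phi>) s0 \<noteq> 0"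
begin

abbreviation "hv \<equiv> cov_val (s, t) (s0, t0)"

text \<open>The projection to the s-line is unramified where t0 is nonzero, so s - s0 has order 1
  there; at a branch point s - s0 has order 2 and t has order 1.\<close>

definition unif :: "'k fun_field" where
  "unif = (if t0 = 0 then t else s - const_fun s0)"

lemma cv_mult: "coord_val (s0, t0) a b * coord_val (s0, t0) c d = 
  coord_val (s0, t0) (a * c + b * d * \<phi>) (a * d + b * c)"
proof -
  have "coord_val (s0, t0) a b * coord_val (s0, t0) c d = 
     poly a s0 * poly c s0 + poly b s0 * poly d s0 * (t0 * t0) + (poly a s0 * poly d s0 + poly b s0 * poly c s0) * t0"
    by (simp add: coord_val_eq algebra_simps)
  then show ?thesis by (simp add: coord_val_eq pt_eq)
qed

lemma cv_add: "coord_val (s0, t0) a b + coord_val (s0, t0) c d = coord_val (s0, t0) (a + c) (b + d)"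
  by (simp add: coord_val_eq algebra_simps)

lemma cv_nz: "coord_val (s0, t0) c d \<noteq> 0 \<Longrightarrow> coord_fun (s, t) c d \<noteq> 0"
  by (auto simp: cf_eq_0_iff coord_val_eq)

lemma hvE:
  assumes "hv h v"
  obtains a b c d where "coord_val (s0, t0) c d \<noteq> 0" "coord_fun (s, t) c d \<noteq> 0"
     "h = coord_fun (s, t) a b / coord_fun (s, t) c d" "v = coord_val (s0, t0) a b / coord_val (s0, t0) c d"
  using assms cv_nz unfolding cov_val_def by blast

lemma hvI: "coord_val (s0, t0) c d \<noteq> 0 \<Longrightarrow>
  hv (coord_fun (s, t) a b / coord_fun (s, t) c d) (coord_val (s0, t0) a b / coord_val (s0, t0) c d)"
  unfolding cov_val_def by blast

text \<open>Cross-multiplying two fractions for h gives an identity in the coordinate ring. By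
  independence it is an identity between pairs of polynomials, and so it survives evaluation at the
  point.\<close>

lemma hv_unique:
  assumes "hv h v" "hv h w" shows "v = w"
proof -
  obtain a b c d where 1: "coord_val (s0, t0) c d \<noteq> 0" "coord_fun (s, t) c d \<noteq> 0"
     "h = coord_fun (s, t) a b / coord_fun (s, t) c d" "v = coord_val (s0, t0) a b / coord_val (s0, t0) c d"
    using assms(1) by (rule hvE)
  obtain a' b' c' d' where 2: "coord_val (s0, t0) c' d' \<noteq> 0" "coord_fun (s, t) c' d' \<noteq> 0"
     "h = coord_fun (s, t) a' b' / coord_fun (s, t) c' d'" "w = coord_val (s0, t0) a' b' / coord_val (s0, t0) c' d'"
    using assms(2) by (rule hvE)
  have "coord_fun (s, t) a b * coord_fun (s, t) c' d' = coord_fun (s, t) a' b' * coord_fun (s, t) c d"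
    using 1 2 by (simp add: frac_eq_eq)
  then have "coord_val (s0, t0) a b * coord_val (s0, t0) c' d' = coord_val (s0, t0) a' b' * coord_val (s0, t0) c d"
    unfolding cf_mult cf_eq_iff cv_mult by simp
  then show ?thesis using 1 2 by (simp add: frac_eq_eq)
qed

lemma hv_mult:
  assumes "hv h v" "hv k w" shows "hv (h * k) (v * w)"
proof -
  obtain a b c d where 1: "coord_val (s0, t0) c d \<noteq> 0" "coord_fun (s, t) c d \<noteq> 0"
     "h = coord_fun (s, t) a b / coord_fun (s, t) c d" "v = coord_val (s0, t0) a b / coord_val (s0, t0) c d"
    using assms(1) by (rule hvE)
  obtain a' b' c' d' where 2: "coord_val (s0, t0) c' d' \<noteq> 0" "coord_fun (s, t) c' d' \<noteq> 0"
     "k = coord_fun (s, t) a' b' / coord_fun (s, t) c' d'" "w = coord_val (s0, t0) a' b' / coord_val (s0, t0) c' d'"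
    using assms(2) by (rule hvE)
  have "coord_val (s0, t0) c d * coord_val (s0, t0) c' d' \<noteq> 0" using 1 2 by simp
  then show ?thesis unfolding 1(3,4) 2(3,4) times_divide_times_eq cf_mult cv_mult by (rule hvI)
qed

lemma hv_add:
  assumes "hv h v" "hv k w" shows "hv (h + k) (v + w)"
proof -
  obtain a b c d where 1: "coord_val (s0, t0) c d \<noteq> 0" "coord_fun (s, t) c d \<noteq> 0"
     "h = coord_fun (s, t) a b / coord_fun (s, t) c d" "v = coord_val (s0, t0) a b / coord_val (s0, t0) c d"
    using assms(1) by (rule hvE)
  obtain a' b' c' d' where 2: "coord_val (s0, t0) c' d' \<noteq> 0" "coord_fun (s, t) c' d' \<noteq> 0"
     "k = coord_fun (s, t) a' b' / coord_fun (s, t) c' d'" "w = coord_val (s0, t0) a' b' / coord_val (s0, t0) c' d'"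
    using assms(2) by (rule hvE)
  have nz: "coord_val (s0, t0) c d * coord_val (s0, t0) c' d' \<noteq> 0" using 1 2 by simp
  show ?thesis unfolding 1(3,4) 2(3,4) add_frac_eq[OF 1(1) 2(1)] add_frac_eq[OF 1(2) 2(2)]
    using nz unfolding cf_mult cv_mult cf_add cv_add by (rule hvI)
qed

lemma hv_inverse:
  assumes "hv h v" "v \<noteq> 0" shows "hv (inverse h) (inverse v)"
proof -
  obtain a b c d where 1: "coord_val (s0, t0) c d \<noteq> 0" "coord_fun (s, t) c d \<noteq> 0"
     "h = coord_fun (s, t) a b / coord_fun (s, t) c d" "v = coord_val (s0, t0) a b / coord_val (s0, t0) c d"
    using assms(1) by (rule hvE)
  then show ?thesis using hvI[of a b c d] assms(2) by simp
qed

lemma hv_cf: "hv (pev s a + pev s b * t) (poly a s0 + poly b s0 * t0)"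
  using hvI[of 1 0 a b] by (simp add: coord_fun_pev coord_val_eq)

lemma hv_pev: "hv (pev s a) (poly a s0)"
  using hv_cf[of a 0] by simp

lemma hv_1: "hv 1 1" using hv_pev[of 1] by simp

lemma hv_t: "hv t t0" using hv_cf[of 0 1] by simp

lemma hv_uminus: "hv h v \<Longrightarrow> hv (- h) (- v)"
  using hv_mult[OF hv_pev[of "- 1"]] by simp

lemma hv_power: "hv h v \<Longrightarrow> hv (h ^ n) (v ^ n)"
  by (induction n) (auto intro: hv_1 hv_mult)

lemma hv_cov_quot: "hv h v \<Longrightarrow> h \<in> cov_quot (s, t)"
  unfolding cov_val_def cov_quot_def by blast

section \<open>Existence of orders at a smooth point\<close>

abbreviation "decomposable h \<equiv> \<exists>n u v. h = unif powi n * u \<and> hv u v \<and> v \<noteq> 0"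

lemma t_nz: "t \<noteq> 0"
  using indep[of 0 1] by auto

lemma unif_nz: "unif \<noteq> 0"
  using indep[of "[:- s0, 1:]" 0] t_nz by (auto simp: unif_def)

lemma hv_unif: "hv unif 0"
  using hv_t hv_pev[of "[:- s0, 1:]"] by (auto simp: unif_def)

lemma split_order:
  assumes "p \<noteq> 0"
  obtains q k where "p = [:- s0, 1:] ^ k * q" "poly q s0 \<noteq> 0" "k = order s0 p"
  using order_decomp[OF assms, of s0] that by (metis poly_eq_0_iff_dvd)

text \<open>A common zero of a and b at s0 is divided out, which lowers the degrees. Otherwise a + b
  t or its conjugate a - b t does not vanish at the point, since the sum and the difference of their
  values are 2 a(s0) and 2 b(s0) t0. If only the conjugate is a unit, then a + b t is the norm, a
  polynomial in s, divided by it.\<close>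

lemma decomposable_noramified:
  assumes t0: "t0 \<noteq> 0"
  shows "a \<noteq> 0 \<or> b \<noteq> 0 \<Longrightarrow> decomposable (pev s a + pev s b * t)"
proof (induction "degree a + degree b" arbitrary: a b rule: less_induct)
  case less
  have u: "unif = pev s [:- s0, 1:]" using t0 by (simp add: unif_def)
  show ?case
  proof (cases "poly a s0 = 0 \<and> poly b s0 = 0")
    case True
    then obtain a' b' where ab: "a = [:- s0, 1:] * a'" "b = [:- s0, 1:] * b'"
      by (meson dvdE poly_eq_0_iff_dvd)
    have deg: "degree ([:- s0, 1:] * p) = (if p = 0 then 0 else Suc (degree p))" for p
    proof (cases "p = 0")
      case False
      then show ?thesis using degree_mult_eq[of "[:- s0, 1:]" p] by (simp del: mult_pCons_left)
    qed simp
    have ab': "a' \<noteq> 0 \<or> b' \<noteq> 0" using less.prems ab by auto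
    have "degree a' + degree b' < degree a + degree b" 
      unfolding ab deg using less.prems ab by auto
    from less.hyps[OF this ab'] obtain n w v 
      where IH: "pev s a' + pev s b' * t = unif powi n * w" "hv w v" "v \<noteq> 0" by blast
    have "pev s a + pev s b * t = unif * (pev s a' + pev s b' * t)"
      unfolding ab u by (simp only: pev_mult) (simp only: distrib_left mult.assoc)
    then have "pev s a + pev s b * t = unif powi (n + 1) * w"
      using IH(1) unif_nz by (simp add: power_int_add)
    then show ?thesis using IH by blast
  next
    case False
    define v where "v = poly a s0 + poly b s0 * t0"
    define w where "w = poly a s0 + poly (- b) s0 * t0"
    have hvv: "hv (pev s a + pev s b * t) v" "hv (pev s a + pev s (- b) * t) w"
      unfolding v_def w_def by (rule hv_cf)+
    have "v + w = 2 * poly a s0" "v - w = 2 * (t0 * poly b s0)" by (simp_all add: v_def w_def)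
    then have "v \<noteq> 0 \<or> w \<noteq> 0" using False two_nz t0
      by (metis add_0 diff_zero mult_eq_0_iff)
    then show ?thesis
    proof
      assume "v \<noteq> 0"
      then show ?thesis using hvv by (intro exI[of _ 0] exI[of _ "pev s a + pev s b * t"] exI[of _ v]) auto
    next
      assume w: "w \<noteq> 0"
      define N where "N = a * a - b * b * \<phi>"
      have prod: "(pev s a + pev s b * t) * (pev s a + pev s (- b) * t) = pev s N"
        using cf_mult[of a b a "- b"] by (simp add: coord_fun_pev N_def)
      have nz: "pev s a + pev s b * t \<noteq> 0" "pev s a + pev s (- b) * t \<noteq> 0"
        using indep[of a b] indep[of a "- b"] less.prems by auto
      then have "N \<noteq> 0" using prod by (metis mult_eq_0_iff pev_0)
      then obtain M k where M: "N = [:- s0, 1:] ^ k * M" "poly M s0 \<noteq> 0" using split_order by blast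
      have "pev s N = unif ^ k * pev s M" unfolding M(1) u by (simp only: pev_mult pev_power)
      then have "pev s a + pev s b * t = unif powi (int k) * (pev s M * inverse (pev s a + pev s (- b) * t))"
        using prod nz by (simp add: field_simps)
      moreover have "hv (pev s M * inverse (pev s a + pev s (- b) * t)) (poly M s0 * inverse w)"
        by (intro hv_mult hv_pev hv_inverse hvv w)
      moreover have "poly M s0 * inverse w \<noteq> 0" using M w by simp
      ultimately show ?thesis by blast
    qed
  qed
qed

text \<open>Smoothness makes s0 a simple root of \<phi>, so s - s0 is t^2 times a unit and every
  polynomial in s has even order.\<close>

lemma ramified_pev:
  assumes t0: "t0 = 0" and p: "p \<noteq> 0"
  obtains k u v where "pev s p = t ^ (2 * k) * u" "hv u v" "v \<noteq> 0"
proof -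
  have "poly \<phi> s0 = 0" using pt_eq t0 by simp
  then obtain \<psi> where \<psi>: "\<phi> = [:- s0, 1:] * \<psi>" by (meson dvdE poly_eq_0_iff_dvd)
  have nz: "poly \<psi> s0 \<noteq> 0"
    using smooth[OF t0] by (simp add: \<psi> pderiv_mult pderiv_pCons pderiv_diff pderiv_smult)
  then have nz': "pev s \<psi> \<noteq> 0" using pev_eq_0_iff[of \<psi>] by auto
  have "t ^ 2 = pev s [:- s0, 1:] * pev s \<psi>"
    by (simp only: power2_eq_square cov_eq \<psi> pev_mult)
  then have X: "pev s [:- s0, 1:] = t ^ 2 * inverse (pev s \<psi>)" using nz' by (simp only:) simp
  obtain q k where q: "p = [:- s0, 1:] ^ k * q" "poly q s0 \<noteq> 0" using split_order p by blast
  have "pev s p = t ^ (2 * k) * (inverse (pev s \<psi>) ^ k * pev s q)"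
    unfolding q(1) pev_mult pev_power X by (simp add: power_mult_distrib power_mult)
  moreover have "hv (inverse (pev s \<psi>) ^ k * pev s q) (inverse (poly \<psi> s0) ^ k * poly q s0)"
    by (intro hv_mult hv_power hv_inverse hv_pev nz)
  moreover have "inverse (poly \<psi> s0) ^ k * poly q s0 \<noteq> 0" using nz q by simp
  ultimately show ?thesis using that by blast
qed

text \<open>The order of a is even and the order of b t is odd, so the two terms cannot cancel and
  the smaller power of t can be taken out.\<close>

lemma decomposable_ramified:
  assumes t0: "t0 = 0" and ab: "a \<noteq> 0 \<or> b \<noteq> 0"
  shows "decomposable (pev s a + pev s b * t)"
proof -
  have u: "unif = t" unfolding unif_def using t0 by simp
  have tp: "hv (t ^ n) 0" if "n > 0" for n
    using hv_power[OF hv_t, of n] t0 that by (simp add: power_0_left)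
  have I: "decomposable h" if "h = t ^ n * w" "hv w v" "v \<noteq> 0" for h n w v
    using that u by (intro exI[of _ "int n"] exI[of _ w] exI[of _ v]) auto
  consider "b = 0" "a \<noteq> 0" | "a = 0" "b \<noteq> 0" | "a \<noteq> 0" "b \<noteq> 0" using ab by blast
  then show ?thesis
  proof cases
    case 1
    then show ?thesis using ramified_pev[OF t0 1(2)] I by (metis add.right_neutral mult_zero_left pev_0)
  next
    case 2
    obtain k w v where k: "pev s b = t ^ (2 * k) * w" "hv w v" "v \<noteq> 0" by (rule ramified_pev[OF t0 2(2)])
    show ?thesis by (rule I[of _ "2 * k + 1" w v]) (use k 2 in auto)
  next
    case 3
    obtain k w v where k: "pev s a = t ^ (2 * k) * w" "hv w v" "v \<noteq> 0" by (rule ramified_pev[OF t0 3(1)])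
    obtain k' w' v' where k': "pev s b = t ^ (2 * k') * w'" "hv w' v'" "v' \<noteq> 0" by (rule ramified_pev[OF t0 3(2)])
    show ?thesis
    proof (cases "2 * k < 2 * k' + 1")
      case True
      then have "t ^ (2 * k' + 1) = t ^ (2 * k) * t ^ (2 * k' + 1 - 2 * k)" by (subst power_add[symmetric]) simp
      then have "pev s a + pev s b * t = t ^ (2 * k) * (w + t ^ (2 * k' + 1 - 2 * k) * w')"
        using k k' by (simp add: algebra_simps)
      moreover have "hv (w + t ^ (2 * k' + 1 - 2 * k) * w') (v + 0 * v')"
        using True by (intro hv_add hv_mult tp k k') auto
      ultimately show ?thesis using I k by simp
    next
      case False
      then have "t ^ (2 * k) = t ^ (2 * k' + 1) * t ^ (2 * k - (2 * k' + 1))" by (subst power_add[symmetric]) simp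
      then have "pev s a + pev s b * t = t ^ (2 * k' + 1) * (w' + t ^ (2 * k - (2 * k' + 1)) * w)"
        using k k' by (simp add: algebra_simps)
      moreover have "hv (w' + t ^ (2 * k - (2 * k' + 1)) * w) (v' + 0 * v)"
        using False by (intro hv_add hv_mult tp k k') presburger
      ultimately show ?thesis using I[of _ "2 * k' + 1"] k' by simp
    qed
  qed
qed

lemma decomposable_cov_quot:
  assumes "h \<in> cov_quot (s, t)" "h \<noteq> 0"
  shows "decomposable h"
proof -
  obtain a b c d where h: "h = coord_fun (s, t) a b / coord_fun (s, t) c d" "coord_fun (s, t) c d \<noteq> 0"
    using assms(1) by (rule cov_quotE)
  have dec: "decomposable (coord_fun (s, t) a b)" if "coord_fun (s, t) a b \<noteq> 0" for a b
    using decomposable_ramified[of a b] decomposable_noramified[of a b] that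
    unfolding coord_fun_pev by fastforce
  obtain n u v where 1: "coord_fun (s, t) a b = unif powi n * u" "hv u v" "v \<noteq> 0" 
    using dec[of a b] assms(2) h by auto
  obtain n' u' v' where 2: "coord_fun (s, t) c d = unif powi n' * u'" "hv u' v'" "v' \<noteq> 0" 
    using dec[of c d] h by auto
  have "h = unif powi (n - n') * (u * inverse u')"
    unfolding h(1) 1(1) 2(1) using unif_nz by (simp add: power_int_diff field_simps)
  moreover have "hv (u * inverse u') (v * inverse v')" by (intro hv_mult hv_inverse 1 2)
  moreover have "v * inverse v' \<noteq> 0" using 1 2 by simp
  ultimately show ?thesis by blast
qed

lemma place: "place (cov_quot (s, t)) hv unif"
proof
  show "h \<in> cov_quot (s, t) \<Longrightarrow> h \<noteq> 0 \<Longrightarrow> decomposable h" for h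
    by (rule decomposable_cov_quot)
qed (rule hv_unique hv_1 hv_uminus hv_add hv_mult hv_inverse hv_unif unif_nz hv_cov_quot; assumption)+

end

section \<open>The hyperelliptic curve and its places\<close>

lemma pev_x_fun: "pev x_fun a = to_ac (to_fract a)"
proof (induction a)
  case (pCons c a)
  have "pCons c a = [:c:] + [:0, 1:] * a" by simp
  then have "to_ac (to_fract (pCons c a)) = const_fun c + x_fun * to_ac (to_fract a)"
    unfolding const_fun_def x_fun_def by (simp only: to_fract_add to_fract_mult to_ac_add to_ac_mult)
  then show ?case using pCons by simp
qed simp

lemma pev_x_fun_eq_0_iff [simp]: "pev x_fun a = 0 \<longleftrightarrow> a = 0"
  by (simp add: pev_x_fun)

lemma x_fun_nz [simp]: "x_fun \<noteq> 0"
  by (simp add: x_fun_def)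

lemma y_fun_square: "y_fun f * y_fun f = pev x_fun (ac_poly f)"
proof -
  have "\<exists>y. y ^ 2 = to_ac (to_fract (ac_poly f))" by (rule nth_root_exists) simp
  then have "y_fun f ^ 2 = to_ac (to_fract (ac_poly f))" unfolding y_fun_def by (rule someI_ex)
  then show ?thesis by (simp add: pev_x_fun power2_eq_square)
qed

text \<open>Reduces each inclusion between the function field and the fraction fields of the two
  charts to a check on generators.\<close>

lemma cov_quot_subset:
  assumes c: "\<And>c. const_fun c \<in> S" and s: "s \<in> S" and t: "t \<in> S"
    and add: "\<And>h k. h \<in> S \<Longrightarrow> k \<in> S \<Longrightarrow> h + k \<in> S"
    and mult: "\<And>h k. h \<in> S \<Longrightarrow> k \<in> S \<Longrightarrow> h * k \<in> S"
    and inv: "\<And>h. h \<in> S \<Longrightarrow> inverse h \<in> S"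
  shows "cov_quot (s, t) \<subseteq> S"
proof -
  have pev: "pev s a \<in> S" for a
  proof (induction a)
    case 0 then show ?case using c[of 0] by simp
  next
    case (pCons x a) then show ?case using c s add mult by simp
  qed
  then have "coord_fun (s, t) a b \<in> S" for a b using add mult t by (simp add: coord_fun_pev)
  then show ?thesis using mult inv unfolding cov_quot_def by (auto simp: divide_inverse)
qed

section \<open>The function field and its two charts\<close>

locale hyperelliptic =
  fixes g :: nat and f :: "'k::{field,finite} poly"
  assumes hyp: "hyperelliptic_curve g f"
begin

abbreviation xF :: "'k fun_field" where "xF \<equiv> x_fun"
abbreviation yF :: "'k fun_field" where "yF \<equiv> y_fun f"
abbreviation fK :: "'k alg_closure poly" where "fK \<equiv> ac_poly f"
abbreviation FF :: "'k fun_field set" where "FF \<equiv> function_field f"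
abbreviation pts :: "'k alg_closure point set" where "pts \<equiv> curve_points f"
abbreviation E :: "'k alg_closure poly \<Rightarrow> 'k fun_field" where "E \<equiv> pev x_fun"

lemma two_nz: "(2 :: 'k alg_closure) \<noteq> 0"
proof
  assume "(2 :: 'k alg_closure) = 0"
  then have "of_nat 2 = (0 :: 'k alg_closure)" by simp
  then have "CHAR('k alg_closure) dvd 2" unfolding of_nat_eq_0_iff_char_dvd .
  then have "CHAR('k) dvd 2" by simp
  moreover have "CHAR('k) \<noteq> 1" by simp
  moreover have "CHAR('k) \<noteq> 2" using hyp by (simp add: hyperelliptic_curve_def)
  ultimately show False using dvd_imp_le[of "CHAR('k)" 2] by (auto simp: le_Suc_eq numeral_2_eq_2)
qed

lemma degree_fK: "degree fK = 2 * g + 1"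
  using hyp by (simp add: hyperelliptic_curve_def ac_poly_def degree_map_poly)

lemma fK_nz: "fK \<noteq> 0" using degree_fK by auto

lemma smooth: 
  assumes "poly fK x = 0" shows "poly (pderiv fK) x \<noteq> 0"
proof -
  have "\<forall>x y. y ^ 2 = poly fK x \<longrightarrow> \<not> (2 * y = 0 \<and> poly (pderiv fK) x = 0)"
    using hyp by (simp add: hyperelliptic_curve_def)
  from this[rule_format, of 0 x] show ?thesis using assms by simp
qed

text \<open>A relation gives a^2 = b^2 f, which is impossible for b nonzero because f has odd
  degree.\<close>

lemma affine_indep:
  assumes "E a + E b * yF = 0" shows "a = 0 \<and> b = 0"
proof -
  have "E a = - (E b * yF)" using assms by (simp add: eq_neg_iff_add_eq_0)
  then have "E a * E a = E b * E b * (yF * yF)" by simp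
  then have "E (a * a - b * b * fK) = 0" unfolding y_fun_square by simp
  then have eq: "a * a = b * b * fK" by (simp only: pev_x_fun_eq_0_iff) simp
  have "b = 0"
  proof (rule ccontr)
    assume b: "b \<noteq> 0"
    then have a: "a \<noteq> 0" using eq fK_nz by auto
    have "2 * degree a = 2 * degree b + (2 * g + 1)"
      using arg_cong[OF eq, of degree] a b fK_nz by (simp add: degree_mult_eq degree_fK)
    then show False by presburger
  qed
  then show ?thesis using eq by simp
qed

lemma dcover_affine: "dcover xF yF fK"
  by unfold_locales (auto simp: y_fun_square two_nz dest: affine_indep)

text \<open>Since f has degree 2g+1, \<open>reflect_poly\<close> yields s^(2g+1) f(1/s); the extra
  \<open>pCons 0\<close> supplies the missing factor s of s^(2g+2) f(1/s). The constant term of the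
  reflected polynomial is the leading coefficient of f, so 0 is a simple root.\<close>

definition fI :: "'k alg_closure poly" where "fI = pCons 0 (reflect_poly fK)"

lemma pev_reflect: "pev (1 / xF) (reflect_poly a) = (1 / xF) ^ degree a * E a"
  using pev_reflect_poly[of "1 / xF" a] by simp

lemma pev_inverse_x:
  assumes "n \<ge> degree a"
  shows "xF ^ n * pev (1 / xF) a = E (reflect_poly a * monom 1 (n - degree a))"
proof -
  have "E (monom 1 k) = xF ^ k" for k
    by (simp add: pev_def map_poly_monom poly_monom)
  then show ?thesis using assms pev_reflect_poly[of xF a] by (simp flip: power_add)
qed

lemma infinity_indep:
  assumes "pev (1 / xF) a + pev (1 / xF) b * (yF / xF ^ (g + 1)) = 0" shows "a = 0 \<and> b = 0"
proof -
  \<comment> \<open>Multiplication by x^(n+g+1) clears all denominators: A is x^(n+g+1) a(1/x) and B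
    is x^n b(1/x), and n bounds both degrees. This leads back to independence in the affine
    chart.\<close>
  define n where "n = degree a + degree b"
  define A where "A = reflect_poly a * monom 1 (n + g + 1 - degree a)"
  define B where "B = reflect_poly b * monom 1 (n - degree b)"
  have "E A + E B * yF = xF ^ (n + g + 1) * pev (1 / xF) a + xF ^ n * pev (1 / xF) b * yF"
    unfolding A_def B_def by (subst (1 2) pev_inverse_x[symmetric]) (auto simp: n_def)
  also have "\<dots> = xF ^ (n + g + 1) * (pev (1 / xF) a + pev (1 / xF) b * (yF / xF ^ (g + 1)))"
    by (simp add: power_add field_simps)
  finally have "E A + E B * yF = 0" using assms by simp
  then show ?thesis using affine_indep[of A B] by (auto simp: A_def B_def)
qed

lemma dcover_infinity: "dcover (1 / xF) (yF / xF ^ (g + 1)) fI"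
proof
  show "pev (1 / xF) a + pev (1 / xF) b * (yF / xF ^ (g + 1)) = 0 \<Longrightarrow> a = 0 \<and> b = 0" for a b 
    by (rule infinity_indep)
  have "pev (1 / xF) fI = 1 / xF * ((1 / xF) ^ (2 * g + 1) * E fK)"
    unfolding fI_def by (simp add: pev_reflect degree_fK)
  also have "\<dots> = E fK / xF ^ (2 * g + 2)"
    by (simp add: field_simps)
  also have "\<dots> = yF / xF ^ (g + 1) * (yF / xF ^ (g + 1))"
    by (simp add: mult_2 flip: y_fun_square power_add)
  finally show "yF / xF ^ (g + 1) * (yF / xF ^ (g + 1)) = pev (1 / xF) fI" by simp
qed (rule two_nz)

sublocale aff: dcover xF yF fK by (rule dcover_affine)
sublocale inf: dcover "1 / xF" "yF / xF ^ (g + 1)" fI by (rule dcover_infinity)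

lemma function_field_eq: "FF = cov_quot (xF, yF)"
proof
  have *: "to_ac a \<in> cov_quot (xF, yF)" for a
  proof (cases a)
    case (Fract p q)
    then have "to_ac a = E p * inverse (E q)"
      by (simp add: Fract_conv_to_fract pev_x_fun divide_inverse)
    moreover have "E p \<in> cov_quot (xF, yF)" "E q \<in> cov_quot (xF, yF)"
      using aff.cov_quot_pev[of _ 0] by auto
    ultimately show ?thesis by (simp add: aff.cov_quot_mult aff.cov_quot_inverse)
  qed
  have yF: "yF \<in> cov_quot (xF, yF)" using aff.cov_quot_pev[of 0 1] by simp
  show "FF \<subseteq> cov_quot (xF, yF)" unfolding function_field_def 
    using aff.cov_quot_add aff.cov_quot_mult * yF by blast
  have mem: "to_ac a + to_ac b * yF \<in> FF" for a b unfolding function_field_def by blast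
  have YY: "yF * yF = to_ac (to_fract fK)" by (simp add: y_fun_square pev_x_fun)
  show "cov_quot (xF, yF) \<subseteq> FF"
  proof (rule cov_quot_subset)
    show "const_fun c \<in> FF" for c using mem[of "to_fract [:c:]" 0] by (simp add: const_fun_def)
    show "xF \<in> FF" using mem[of "to_fract [:0, 1:]" 0] by (simp add: x_fun_def)
    show "yF \<in> FF" using mem[of 0 1] by simp
    show "h + k \<in> FF" if hk: "h \<in> FF" "k \<in> FF" for h k
    proof -
      obtain a b c d where "h = to_ac a + to_ac b * yF" "k = to_ac c + to_ac d * yF" 
        using hk unfolding function_field_def by blast
      then have "h + k = to_ac (a + c) + to_ac (b + d) * yF" by (simp add: algebra_simps)
      then show ?thesis using mem by metis
    qed
    show "h * k \<in> FF" if hk: "h \<in> FF" "k \<in> FF" for h k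
    proof -
      obtain a b c d where "h = to_ac a + to_ac b * yF" "k = to_ac c + to_ac d * yF" 
        using hk unfolding function_field_def by blast
      then have "h * k = to_ac a * to_ac c + to_ac b * to_ac d * (yF * yF) + to_ac (a * d + b * c) * yF" 
        by (simp add: algebra_simps)
      then have "h * k = to_ac (a * c + b * d * to_fract fK) + to_ac (a * d + b * c) * yF" by (simp add: YY)
      then show ?thesis using mem by metis
    qed
    show "inverse h \<in> FF" if h: "h \<in> FF" for h
    proof (cases "h = 0")
      case False
      obtain a b where ab: "h = to_ac a + to_ac b * yF" using h unfolding function_field_def by blast
      define N where "N = a * a - b * b * to_fract fK"
      have prod: "h * (to_ac a - to_ac b * yF) = to_ac a * to_ac a - to_ac b * to_ac b * (yF * yF)"
        unfolding ab by (simp add: algebra_simps)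
      then have prod: "h * (to_ac a - to_ac b * yF) = to_ac N" by (simp add: YY N_def)
      \<comment> \<open>A vanishing norm of a nonzero h would make its conjugate vanish, so a = b y;
        independence then forces a = 0, and h = 2 a = 0.\<close>
      have "N \<noteq> 0"
      proof
        assume "N = 0"
        then have "to_ac a = to_ac b * yF" using prod False by simp
        then have h2: "h = 2 * to_ac a" using ab by simp
        obtain p q where p: "a = Fract p q" "q \<noteq> 0" by (cases a)
        obtain p' q' where p': "b = Fract p' q'" "q' \<noteq> 0" by (cases b)
        have "E p / E q = E p' / E q' * yF" using \<open>to_ac a = to_ac b * yF\<close> p p' 
          by (simp add: Fract_conv_to_fract pev_x_fun)
        then have "E (p * q') + E (- (p' * q)) * yF = 0" using p p' by (simp add: field_simps)
        then have "p = 0" using affine_indep p' by fastforce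
        then show False using h2 p False by (simp add: Fract_conv_to_fract)
      qed
      then have "h * ((to_ac a - to_ac b * yF) / to_ac N) = 1"
        using prod by simp
      then have "inverse h = (to_ac a - to_ac b * yF) / to_ac N" by (rule inverse_unique)
      also have "\<dots> = to_ac (a / N) + to_ac (- b / N) * yF"
        by (simp add: diff_divide_distrib)
      finally have "inverse h = to_ac (a / N) + to_ac (- b / N) * yF" .
      then show ?thesis using mem by metis
    qed (use mem[of 0 0] in simp)
  qed
qed

lemma FF_mult: "h \<in> FF \<Longrightarrow> k \<in> FF \<Longrightarrow> h * k \<in> FF"
  and FF_add: "h \<in> FF \<Longrightarrow> k \<in> FF \<Longrightarrow> h + k \<in> FF"
  and FF_inverse: "h \<in> FF \<Longrightarrow> inverse h \<in> FF"
  unfolding function_field_eq by (fact aff.cov_quot_mult aff.cov_quot_add aff.cov_quot_inverse)+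

lemma FF_pev: "E a + E b * yF \<in> FF" 
  unfolding function_field_eq by (rule aff.cov_quot_pev)

lemma FF_E: "E a \<in> FF" using FF_pev[of a 0] by simp
lemma FF_Y: "yF \<in> FF" using FF_pev[of 0 1] by simp
lemma FF_X: "xF \<in> FF" using FF_E[of "[:0, 1:]"] by simp
lemma FF_const: "const_fun c \<in> FF" using FF_E[of "[:c:]"] by simp
lemma FF_1: "1 \<in> FF" using FF_E[of 1] by simp
lemma FF_divide: "h \<in> FF \<Longrightarrow> k \<in> FF \<Longrightarrow> h / k \<in> FF" by (simp add: divide_inverse FF_mult FF_inverse)
lemma FF_power: "h \<in> FF \<Longrightarrow> h ^ n \<in> FF" by (induction n) (auto intro: FF_1 FF_mult)

lemma function_field_infinity: "FF = cov_quot (1 / xF, yF / xF ^ (g + 1))"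
proof
  show "cov_quot (1 / xF, yF / xF ^ (g + 1)) \<subseteq> FF"
    by (rule cov_quot_subset) (auto intro: FF_const FF_divide FF_1 FF_X FF_Y FF_power FF_add FF_mult FF_inverse simp del: power_Suc)
  let ?C = "cov_quot (1 / xF, yF / xF ^ (g + 1))"
  have c: "pev (1 / xF) a \<in> ?C" for a using inf.cov_quot_pev[of a 0] by simp
  have xF: "xF \<in> ?C" using inf.cov_quot_inverse[OF c[of "[:0, 1:]"]] by simp
  have pow: "xF ^ n \<in> ?C" for n
  proof (induction n)
    case 0
    then show ?case using c[of 1] by (simp del: power_Suc add: pev_1)
  next
    case (Suc n)
    then show ?case unfolding power_Suc[of xF n] by (rule inf.cov_quot_mult[OF xF])
  qed
  have t: "yF / xF ^ (g + 1) \<in> ?C" using inf.cov_quot_pev[of 0 1] by simp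
  have "yF = yF / xF ^ (g + 1) * xF ^ (g + 1)" by (simp del: power_Suc)
  then have yF: "yF \<in> ?C" using inf.cov_quot_mult[OF t pow[of "g + 1"]] by simp
  have cc: "const_fun a \<in> ?C" for a using c[of "[:a:]"] by simp
  show "FF \<subseteq> ?C" unfolding function_field_eq
    by (rule cov_quot_subset) (fact cc xF yF inf.cov_quot_mult inf.cov_quot_add inf.cov_quot_inverse)+
qed

text \<open>This is \<open>unif\<close> in the chart of the point. It is fixed once and for all and
  depends on the coordinates only, so that twists carry the uniformizer at a point to the one at its
  image up to sign, as \<open>tw_punif\<close> shows.\<close>

fun punif :: "'k alg_closure point \<Rightarrow> 'k fun_field" where
  "punif Infinity = yF / xF ^ (g + 1)"
| "punif (Affine x y) = (if y = 0 then yF else xF - const_fun x)"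

lemma has_value_cov: "has_value g f P = cov_val (chart g f P) (chart_coords P)"
  unfolding has_value_def cov_val_def by (intro ext) simp

lemma pts_affine: "Affine x y \<in> pts \<longleftrightarrow> y * y = poly fK x"
  by (auto simp: curve_points_def power2_eq_square)

lemma pts_Infinity: "Infinity \<in> pts" by (simp add: curve_points_def)

lemma dpoint_affine: "Affine x y \<in> pts \<Longrightarrow> dpoint xF yF fK x y"
  by unfold_locales (auto simp: pts_affine smooth)

lemma dpoint_infinity: "dpoint (1 / xF) (yF / xF ^ (g + 1)) fI 0 0"
  by unfold_locales (auto simp: fI_def pderiv_pCons fK_nz)

lemma place_at: "P \<in> pts \<Longrightarrow> place FF (has_value g f P) (punif P)"
proof (cases P)
  case Infinity
  then show ?thesis using dpoint.place[OF dpoint_infinity]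
    unfolding has_value_cov function_field_infinity by (simp only: dpoint.unif_def[OF dpoint_infinity] punif.simps chart.simps chart_coords.simps simp_thms if_True)
next
  case (Affine x y)
  assume "P \<in> pts"
  then have d: "dpoint xF yF fK x y" using dpoint_affine Affine by simp
  show ?thesis using dpoint.place[OF d]
    unfolding has_value_cov function_field_eq using Affine by (simp add: dpoint.unif_def[OF d])
qed

definition ordP :: "'k alg_closure point \<Rightarrow> 'k fun_field \<Rightarrow> int" where
  "ordP P = pord (has_value g f P) (punif P)"

definition lcP :: "'k alg_closure point \<Rightarrow> 'k fun_field \<Rightarrow> 'k alg_closure" where
  "lcP P = plc (has_value g f P) (punif P)"

lemma ord_at_eq: "P \<in> pts \<Longrightarrow> h \<in> FF \<Longrightarrow> h \<noteq> 0 \<Longrightarrow> ord_at g f P h = ordP P h"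
  using place.ord_characterization[OF place_at] 
  unfolding ord_at_def uniformizer_def max_ideal_def local_ring_def ordP_def by blast

lemma fun_val_eq: "P \<in> pts \<Longrightarrow> h \<in> FF \<Longrightarrow> h \<noteq> 0 \<Longrightarrow> ordP P h = 0 \<Longrightarrow> fun_val g f h P = lcP P h"
  using place.the_value[OF place_at] unfolding fun_val_def lcP_def ordP_def by blast

lemma has_value_affine:
  assumes "Affine x y \<in> pts"
  shows "has_value g f (Affine x y) (E a + E b * yF) (poly a x + poly b x * y)"
  using dpoint.hv_cf[OF dpoint_affine[OF assms]] unfolding has_value_cov by simp

lemma has_value_infinity:
  "has_value g f Infinity (pev (1 / xF) a) (poly a 0)"
  using dpoint.hv_pev[OF dpoint_infinity] unfolding has_value_cov by simp

end

context hyperelliptic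
begin

subsection \<open>Orders and leading coefficients\<close>

abbreviation nzf :: "'k fun_field \<Rightarrow> bool" where "nzf h \<equiv> h \<in> FF \<and> h \<noteq> 0"

abbreviation decP :: "'k alg_closure point \<Rightarrow> 'k fun_field \<Rightarrow> int \<Rightarrow> 'k alg_closure \<Rightarrow> bool" where
  "decP P \<equiv> dec (has_value g f P) (punif P)"

lemma decP_eq: "P \<in> pts \<Longrightarrow> decP P h n v \<Longrightarrow> ordP P h = n \<and> lcP P h = v"
  using place.dec_eq[OF place_at] by (simp add: ordP_def lcP_def)

lemma decP_ord: "P \<in> pts \<Longrightarrow> nzf h \<Longrightarrow> decP P h (ordP P h) (lcP P h)"
  using place.dec_ord[OF place_at] by (simp add: ordP_def lcP_def)

lemma lcP_nz: "P \<in> pts \<Longrightarrow> nzf h \<Longrightarrow> lcP P h \<noteq> 0"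
  using place.lc_nz[OF place_at] by (simp add: lcP_def)

lemma nzf_mult: "nzf h \<Longrightarrow> nzf k \<Longrightarrow> nzf (h * k)"
  and nzf_inverse: "nzf h \<Longrightarrow> nzf (inverse h)"
  and nzf_divide: "nzf h \<Longrightarrow> nzf k \<Longrightarrow> nzf (h / k)"
  and nzf_power: "nzf h \<Longrightarrow> nzf (h ^ n)"
  and nzf_1: "nzf 1"
  by (simp_all add: FF_mult FF_inverse FF_divide FF_power FF_1)

lemma nzf_prod: "(\<And>i. i \<in> A \<Longrightarrow> nzf (h i)) \<Longrightarrow> nzf (\<Prod>i\<in>A. h i)"
  by (induction A rule: infinite_finite_induct) (auto intro: FF_1 FF_mult)

lemma nzf_E: "a \<noteq> 0 \<Longrightarrow> nzf (E a)"
  by (simp add: FF_E)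

lemma nzf_pev: "a \<noteq> 0 \<or> b \<noteq> 0 \<Longrightarrow> nzf (E a + E b * yF)"
  using FF_pev affine_indep by blast

lemma nzf_const: "c \<noteq> 0 \<Longrightarrow> nzf (const_fun c)"
  by (simp add: FF_const)

lemma nzf_X: "nzf xF" and nzf_Y: "nzf yF"
  using FF_X nzf_pev[of 0 1] by auto

lemma ordP_mult: "P \<in> pts \<Longrightarrow> nzf h \<Longrightarrow> nzf k \<Longrightarrow> ordP P (h * k) = ordP P h + ordP P k"
  and lcP_mult: "P \<in> pts \<Longrightarrow> nzf h \<Longrightarrow> nzf k \<Longrightarrow> lcP P (h * k) = lcP P h * lcP P k"
  using decP_eq[OF _ place.dec_mult[OF place_at decP_ord decP_ord]] by auto

lemma ordP_inverse: "P \<in> pts \<Longrightarrow> nzf h \<Longrightarrow> ordP P (inverse h) = - ordP P h"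
  using decP_eq[OF _ place.dec_inverse[OF place_at decP_ord]] by blast

lemma ordP_divide: "P \<in> pts \<Longrightarrow> nzf h \<Longrightarrow> nzf k \<Longrightarrow> ordP P (h / k) = ordP P h - ordP P k"
  using ordP_mult[OF _ _ nzf_inverse] by (simp add: divide_inverse ordP_inverse)

lemma ordP_power: "P \<in> pts \<Longrightarrow> nzf h \<Longrightarrow> ordP P (h ^ n) = int n * ordP P h"
  and lcP_power: "P \<in> pts \<Longrightarrow> nzf h \<Longrightarrow> lcP P (h ^ n) = lcP P h ^ n"
  using decP_eq[OF _ place.dec_power[OF place_at decP_ord]] by auto

lemma decP_value: "P \<in> pts \<Longrightarrow> has_value g f P h v \<Longrightarrow> v \<noteq> 0 \<Longrightarrow> decP P h 0 v"
  by (rule place.dec_unit[OF place_at])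

lemma decP_const: "P \<in> pts \<Longrightarrow> c \<noteq> 0 \<Longrightarrow> decP P (const_fun c) 0 c"
proof (rule decP_value)
  assume "P \<in> pts"
  then show "has_value g f P (const_fun c) c"
    using has_value_affine[of _ _ "[:c:]" 0] has_value_infinity[of "[:c:]"] by (cases P) auto
qed

lemma ordP_const: "P \<in> pts \<Longrightarrow> c \<noteq> 0 \<Longrightarrow> ordP P (const_fun c) = 0"
  and lcP_const: "P \<in> pts \<Longrightarrow> c \<noteq> 0 \<Longrightarrow> lcP P (const_fun c) = c"
  using decP_eq[OF _ decP_const] by auto

lemma ordP_1: "P \<in> pts \<Longrightarrow> ordP P 1 = 0"
  using ordP_const[of P 1] by simp

lemma ordP_prod: "P \<in> pts \<Longrightarrow> (\<And>i. i \<in> A \<Longrightarrow> nzf (h i)) \<Longrightarrow> ordP P (\<Prod>i\<in>A. h i) = (\<Sum>i\<in>A. ordP P (h i))"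
proof (induction A rule: infinite_finite_induct)
  case (insert i A)
  then have "ordP P (h i * prod h A) = ordP P (h i) + ordP P (prod h A)" by (intro ordP_mult nzf_prod) auto
  then show ?case using insert by simp
qed (simp_all add: ordP_1)

lemma has_value_ord_nonneg: "P \<in> pts \<Longrightarrow> nzf h \<Longrightarrow> has_value g f P h v \<Longrightarrow> ordP P h \<ge> 0"
  using place.hv_iff[OF place_at] by (simp add: ordP_def)

lemma ord_nonneg_has_value: "P \<in> pts \<Longrightarrow> nzf h \<Longrightarrow> ordP P h \<ge> 0 \<Longrightarrow> \<exists>v. has_value g f P h v"
  using place.hv_iff[OF place_at] by (simp add: ordP_def)

subsection \<open>Functions of $x$\<close>

text \<open>The leading coefficient of p at the point x of the line, with X - x as
  parameter.\<close>

definition lcx :: "'k alg_closure \<Rightarrow> 'k alg_closure poly \<Rightarrow> 'k alg_closure" where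
  "lcx x p = poly (p div [:- x, 1:] ^ order x p) x"

lemma order_lcx:
  assumes "p \<noteq> 0"
  obtains q where "p = [:- x, 1:] ^ order x p * q" "poly q x = lcx x p" "lcx x p \<noteq> 0"
proof -
  obtain q where q: "p = [:- x, 1:] ^ order x p * q" "\<not> [:- x, 1:] dvd q"
    using order_decomp[OF assms] by blast
  have "p div [:- x, 1:] ^ order x p = q"
    by (subst q(1)) (rule nonzero_mult_div_cancel_left, simp)
  then show ?thesis using that[of q] q by (simp add: lcx_def poly_eq_0_iff_dvd)
qed

lemma E_unramified:
  assumes "Affine x y \<in> pts" "y \<noteq> 0" "p \<noteq> 0"
  shows "ordP (Affine x y) (E p) = int (order x p) \<and> lcP (Affine x y) (E p) = lcx x p"
proof -
  obtain q where q: "p = [:- x, 1:] ^ order x p * q" "poly q x = lcx x p" "lcx x p \<noteq> 0" using order_lcx assms(3) by blast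
  let ?P = "Affine x y"
  have u: "punif ?P = E [:- x, 1:]" using assms by simp
  have "decP ?P (punif ?P ^ order x p * E q) (int (order x p) * 1 + 0) (1 ^ order x p * lcx x p)"
    using has_value_affine[OF assms(1), of q 0] q
    by (intro place.dec_mult[OF place_at] place.dec_power[OF place_at] place.dec_t[OF place_at]
        place.dec_unit[OF place_at] assms) auto
  moreover have "punif ?P ^ order x p * E q = E p"
    using arg_cong[OF q(1), of E] by (simp only: pev_mult pev_power u)
  ultimately show ?thesis using decP_eq[OF assms(1)] by simp
qed

text \<open>Near a branch point y^2 is x - x0 times a unit, and y is the uniformizer.\<close>

lemma linear_ramified:
  assumes "Affine x 0 \<in> pts"
  shows "ordP (Affine x 0) (E [:- x, 1:]) = 2"
proof -
  let ?P = "Affine x 0"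
  have f0: "poly fK x = 0" using assms by (simp add: pts_affine)
  then obtain \<psi> where \<psi>: "fK = [:- x, 1:] * \<psi>" by (meson dvdE poly_eq_0_iff_dvd)
  have nz: "poly \<psi> x \<noteq> 0"
    using smooth[OF f0] by (simp add: \<psi> pderiv_mult pderiv_pCons pderiv_diff pderiv_smult)
  then have nz': "nzf (E \<psi>)" by (intro nzf_E) auto
  have "has_value g f ?P (E \<psi>) (poly \<psi> x)" using has_value_affine[OF assms, of \<psi> 0] by simp
  then have 0: "ordP ?P (E \<psi>) = 0" using decP_eq[OF assms decP_value[OF assms]] nz by blast
  have 1: "ordP ?P yF = 1" using decP_eq[OF assms place.dec_t[OF place_at[OF assms]]] by simp
  have "yF * yF = E [:- x, 1:] * E \<psi>" unfolding y_fun_square \<psi> by (simp only: pev_mult)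
  moreover have "ordP ?P (yF * yF) = 1 + 1" using ordP_mult[OF assms nzf_Y nzf_Y] 1 by simp
  moreover have "ordP ?P (E [:- x, 1:] * E \<psi>) = ordP ?P (E [:- x, 1:]) + 0"
    using ordP_mult[OF assms nzf_E[of "[:- x, 1:]"] nz'] 0 by simp
  ultimately show ?thesis by simp
qed

text \<open>The leading coefficient of x - x0 with respect to y is left unevaluated, since it
  cancels in \<open>fiber_at\<close>. The coefficient of x at infinity is treated in the same way
  and cancels in \<open>infinity_linear\<close>.\<close>

lemma E_ramified:
  assumes "Affine x 0 \<in> pts" "p \<noteq> 0"
  shows "ordP (Affine x 0) (E p) = 2 * int (order x p) \<and>
     lcP (Affine x 0) (E p) = lcP (Affine x 0) (E [:- x, 1:]) ^ order x p * lcx x p"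
proof -
  obtain q where q: "p = [:- x, 1:] ^ order x p * q" "poly q x = lcx x p" "lcx x p \<noteq> 0" using order_lcx assms(2) by blast
  let ?P = "Affine x 0"
  have "has_value g f ?P (E q) (lcx x p)" using has_value_affine[OF assms(1), of q 0] q by simp
  then have d: "decP ?P (E q) 0 (lcx x p)" using decP_value[OF assms(1)] q(3) by blast
  have "decP ?P (E [:- x, 1:] ^ order x p * E q) (int (order x p) * 2 + 0) (lcP ?P (E [:- x, 1:]) ^ order x p * lcx x p)"
    using decP_ord[OF assms(1) nzf_E[of "[:- x, 1:]"]] linear_ramified[OF assms(1)]
    by (intro place.dec_mult[OF place_at] place.dec_power[OF place_at] d assms) auto
  moreover have "E [:- x, 1:] ^ order x p * E q = E p"
    using arg_cong[OF q(1), of E] by (simp only: pev_mult pev_power)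
  ultimately show ?thesis using decP_eq[OF assms(1)] by simp
qed

lemma dec_reflect: "a \<noteq> 0 \<Longrightarrow> decP Infinity (pev (1 / xF) (reflect_poly a)) 0 (lead_coeff a)"
  using has_value_infinity[of "reflect_poly a"] by (intro decP_value pts_Infinity) auto

text \<open>The square of the uniformizer t is 1/x times a unit, because the reflected polynomial
  does not vanish at 0.\<close>

lemma ordP_infinity_X: "ordP Infinity xF = - 2"
proof -
  let ?t = "yF / xF ^ (g + 1)" and ?w = "pev (1 / xF) (reflect_poly fK)"
  have eq: "?t * ?t = 1 / xF * ?w"
    using inf.cov_eq unfolding fI_def pev_pCons by simp
  have w: "ordP Infinity ?w = 0" using decP_eq[OF pts_Infinity dec_reflect[OF fK_nz]] by simp
  have nw: "nzf ?w" unfolding pev_reflect by (intro nzf_mult nzf_power nzf_divide nzf_1 nzf_X nzf_E fK_nz)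
  have t: "nzf ?t" by (intro nzf_divide nzf_power nzf_X nzf_Y)
  have "ordP Infinity ?t = 1" using decP_eq[OF pts_Infinity place.dec_t[OF place_at[OF pts_Infinity]]] by simp
  then have "2 = ordP Infinity (?t * ?t)" using ordP_mult[OF pts_Infinity t t] by simp
  also have "\<dots> = ordP Infinity (1 / xF)" unfolding eq
    using ordP_mult[OF pts_Infinity nzf_divide[OF nzf_1 nzf_X] nw] w by simp
  also have "\<dots> = - ordP Infinity xF" using ordP_divide[OF pts_Infinity nzf_1 nzf_X] ordP_1[OF pts_Infinity] by simp
  finally show ?thesis by simp
qed

lemma E_infinity:
  assumes "p \<noteq> 0"
  shows "ordP Infinity (E p) = - 2 * int (degree p) \<and>
     lcP Infinity (E p) = lcP Infinity xF ^ degree p * lead_coeff p"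
proof -
  have "decP Infinity (xF ^ degree p * pev (1 / xF) (reflect_poly p))
     (int (degree p) * (- 2) + 0) (lcP Infinity xF ^ degree p * lead_coeff p)"
    using decP_ord[OF pts_Infinity nzf_X] ordP_infinity_X
    by (intro place.dec_mult[OF place_at] place.dec_power[OF place_at] dec_reflect assms pts_Infinity) auto
  moreover have "xF ^ degree p * pev (1 / xF) (reflect_poly p) = E p" 
    by (simp add: pev_reflect power_one_over)
  ultimately show ?thesis using decP_eq[OF pts_Infinity] by simp
qed

lemma FF_normal:
  assumes "h \<in> FF"
  obtains a b r where "r \<noteq> 0" "h = (E a + E b * yF) / E r"
proof -
  obtain a b where ab: "h = to_ac a + to_ac b * yF" using assms unfolding function_field_def by blast
  obtain p q where p: "a = Fract p q" "q \<noteq> 0" by (cases a)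
  obtain p' q' where p': "b = Fract p' q'" "q' \<noteq> 0" by (cases b)
  have "h = (E (p * q') + E (p' * q) * yF) / E (q * q')"
    unfolding ab using p p' by (simp add: Fract_conv_to_fract flip: pev_x_fun) (simp add: field_simps)
  then show ?thesis using that[of "q * q'" "p * q'" "p' * q"] p p' by auto
qed

lemma norm_nz:
  assumes "a \<noteq> 0 \<or> b \<noteq> 0" shows "a * a - b * b * fK \<noteq> 0"
proof
  assume "a * a - b * b * fK = 0"
  moreover have "E (a * a - b * b * fK) = (E a + E b * yF) * (E a + E (- b) * yF)"
  proof -
    have "(E a + E b * yF) * (E a + E (- b) * yF) = E a * E a - E b * E b * (yF * yF)"
      by (simp add: algebra_simps)
    then show ?thesis by (simp add: y_fun_square)
  qed
  ultimately have "E a + E b * yF = 0 \<or> E a + E (- b) * yF = 0"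
    by (metis mult_eq_0_iff pev_0)
  then have "a = 0 \<and> b = 0"
  proof
    assume "E a + E (- b) * yF = 0"
    then have "a = 0 \<and> - b = 0" by (rule affine_indep)
    then show ?thesis by simp
  qed (rule affine_indep)
  then show False using assms by simp
qed

end

section \<open>Twists of the function field\<close>

text \<open>One framework for two maps: the hyperelliptic involution, with \<tau> the identity and e
  = -1, and the Frobenius map, with \<tau> the q-th power and e = 1. A twist applies \<tau> to the
  coefficients, fixes x and sends y to e y.\<close>

locale twist = hyperelliptic g f for g and f :: "'k::{field,finite} poly" +
  fixes \<tau> :: "'k alg_closure \<Rightarrow> 'k alg_closure" and e :: "'k alg_closure"
  assumes \<tau>_1: "\<tau> 1 = 1" and \<tau>_add: "\<tau> (a + b) = \<tau> a + \<tau> b" and \<tau>_mult: "\<tau> (a * b) = \<tau> a * \<tau> b"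
    and \<tau>_f: "map_poly \<tau> (ac_poly f) = ac_poly f" and e: "e = 1 \<or> e = - 1"
begin

abbreviation mp :: "'k alg_closure poly \<Rightarrow> 'k alg_closure poly" where "mp \<equiv> map_poly \<tau>"

lemma \<tau>_0 [simp]: "\<tau> 0 = 0"
  using \<tau>_add[of 0 0] by (metis add.right_neutral add_left_cancel)

lemma \<tau>_eq_0_iff [simp]: "\<tau> a = 0 \<longleftrightarrow> a = 0"
proof
  assume "\<tau> a = 0"
  then have "\<tau> (a * inverse a) = 0" by (simp add: \<tau>_mult)
  then show "a = 0" using \<tau>_1 by (cases "a = 0") auto
qed simp

lemma \<tau>_uminus: "\<tau> (- a) = - \<tau> a"
  using \<tau>_add[of a "- a"] by (simp add: eq_neg_iff_add_eq_0 add.commute)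

lemma \<tau>_inverse: "\<tau> (inverse a) = inverse (\<tau> a)"
proof (cases "a = 0")
  case False
  then have "\<tau> a * \<tau> (inverse a) = 1" by (simp add: \<tau>_1 flip: \<tau>_mult)
  then show ?thesis by (metis inverse_unique)
qed simp

lemma \<tau>_divide: "\<tau> (a / b) = \<tau> a / \<tau> b"
  by (simp add: divide_inverse \<tau>_mult \<tau>_inverse)

lemma mp_pCons: "mp (pCons c a) = pCons (\<tau> c) (mp a)"
  by (simp add: map_poly_pCons)

lemma mp_add: "mp (a + b) = mp a + mp b"
  by (rule poly_eqI) (simp add: coeff_map_poly \<tau>_add)

lemma mp_smult: "mp (smult c a) = smult (\<tau> c) (mp a)"
  by (rule poly_eqI) (simp add: coeff_map_poly \<tau>_mult)

lemma mp_mult: "mp (a * b) = mp a * mp b"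
  by (induction a) (simp_all add: mp_pCons mp_add mp_smult)

lemma mp_uminus: "mp (- a) = - mp a"
  by (rule poly_eqI) (simp add: coeff_map_poly \<tau>_uminus)

lemma mp_diff: "mp (a - b) = mp a - mp b"
  using mp_add[of a "- b"] by (simp add: mp_uminus)

lemma mp_eq_0_iff: "mp a = 0 \<longleftrightarrow> a = 0"
  by (rule map_poly_eq_0_iff) auto

lemma poly_mp: "poly (mp a) (\<tau> x) = \<tau> (poly a x)"
  by (induction a) (simp_all add: mp_pCons \<tau>_add \<tau>_mult)

lemma e_e: "e * e = 1" using e by auto
lemma e_nz: "e \<noteq> 0" using e by auto

definition yt :: "'k fun_field" where "yt = const_fun e * yF"

lemma yt_yt: "yt * yt = E fK"
proof -
  have "yt * yt = const_fun (e * e) * (yF * yF)" unfolding yt_def by simp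
  then show ?thesis by (simp add: e_e y_fun_square)
qed

text \<open>A relation, because the representation of h by a, b, r is not unique. That it is
  single-valued follows from additivity together with \<open>tw_0\<close>.\<close>

definition tw :: "'k fun_field \<Rightarrow> 'k fun_field \<Rightarrow> bool" where
  "tw h h' \<longleftrightarrow> (\<exists>a b r. r \<noteq> 0 \<and> h = (E a + E b * yF) / E r \<and> h' = (E (mp a) + E (mp b) * yt) / E (mp r))"

lemma twE:
  assumes "tw h h'"
  obtains a b r where "r \<noteq> 0" "mp r \<noteq> 0" "h = (E a + E b * yF) / E r" "h' = (E (mp a) + E (mp b) * yt) / E (mp r)"
  using assms unfolding tw_def by (auto simp: mp_eq_0_iff)

lemma twI: "r \<noteq> 0 \<Longrightarrow> h = (E a + E b * yF) / E r \<Longrightarrow> h' = (E (mp a) + E (mp b) * yt) / E (mp r) \<Longrightarrow> tw h h'"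
  unfolding tw_def by blast

section \<open>Twisting respects the field operations\<close>

lemma frac_add: 
  fixes A :: "'a::field" 
  assumes "R \<noteq> 0" "R' \<noteq> 0" 
  shows "(A + B * z) / R + (A' + B' * z) / R' = ((A * R' + A' * R) + (B * R' + B' * R) * z) / (R * R')"
  using assms by (simp add: add_frac_eq) (simp add: algebra_simps)

lemma frac_mult: 
  fixes A :: "'a::field" 
  assumes "R \<noteq> 0" "R' \<noteq> 0" "z * z = F"
  shows "(A + B * z) / R * ((A' + B' * z) / R') = ((A * A' + B * B' * F) + (A * B' + B * A') * z) / (R * R')"
  unfolding assms(3)[symmetric] by (simp add: algebra_simps)

lemma tw_add: 
  assumes "tw h h'" "tw k k'" shows "tw (h + k) (h' + k')"
proof -
  obtain a b r where 1: "r \<noteq> 0" "mp r \<noteq> 0" "h = (E a + E b * yF) / E r" "h' = (E (mp a) + E (mp b) * yt) / E (mp r)"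
    using assms(1) by (rule twE)
  obtain c d q where 2: "q \<noteq> 0" "mp q \<noteq> 0" "k = (E c + E d * yF) / E q" "k' = (E (mp c) + E (mp d) * yt) / E (mp q)"
    using assms(2) by (rule twE)
  show ?thesis
  proof (rule twI)
    show "r * q \<noteq> 0" using 1 2 by simp
    show "h + k = (E (a * q + c * r) + E (b * q + d * r) * yF) / E (r * q)"
      unfolding 1 2 using 1(1) 2(1) by (simp add: frac_add)
    show "h' + k' = (E (mp (a * q + c * r)) + E (mp (b * q + d * r)) * yt) / E (mp (r * q))"
      unfolding 1 2 using 1(2) 2(2) by (simp add: frac_add mp_add mp_mult)
  qed
qed

lemma tw_mult: 
  assumes "tw h h'" "tw k k'" shows "tw (h * k) (h' * k')"
proof -
  obtain a b r where 1: "r \<noteq> 0" "mp r \<noteq> 0" "h = (E a + E b * yF) / E r" "h' = (E (mp a) + E (mp b) * yt) / E (mp r)"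
    using assms(1) by (rule twE)
  obtain c d q where 2: "q \<noteq> 0" "mp q \<noteq> 0" "k = (E c + E d * yF) / E q" "k' = (E (mp c) + E (mp d) * yt) / E (mp q)"
    using assms(2) by (rule twE)
  have nz: "E r \<noteq> 0" "E q \<noteq> 0" "E (mp r) \<noteq> 0" "E (mp q) \<noteq> 0" using 1 2 by auto
  show ?thesis
  proof (rule twI)
    show "r * q \<noteq> 0" using 1 2 by simp
    show "h * k = (E (a * c + b * d * fK) + E (a * d + b * c) * yF) / E (r * q)"
      unfolding 1 2 frac_mult[OF nz(1,2) y_fun_square] by simp
    show "h' * k' = (E (mp (a * c + b * d * fK)) + E (mp (a * d + b * c)) * yt) / E (mp (r * q))"
      unfolding 1 2 frac_mult[OF nz(3,4) yt_yt] by (simp add: mp_add mp_mult \<tau>_f)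
  qed
qed

lemma frac_inverse:
  fixes A :: "'a::field" 
  assumes "R \<noteq> 0" "z * z = F" "A * A - B * B * F \<noteq> 0"
  shows "inverse ((A + B * z) / R) = (R * A + - (R * B) * z) / (A * A - B * B * F)"
proof (rule inverse_unique)
  have "(A + B * z) * (R * A + - (R * B) * z) = R * (A * A - B * B * F)"
    unfolding assms(2)[symmetric] by (simp add: algebra_simps)
  then show "(A + B * z) / R * ((R * A + - (R * B) * z) / (A * A - B * B * F)) = 1"
    using assms by simp
qed

lemma tw_inverse: 
  assumes "tw h h'" shows "tw (inverse h) (inverse h')"
proof -
  obtain a b r where 1: "r \<noteq> 0" "mp r \<noteq> 0" "h = (E a + E b * yF) / E r" "h' = (E (mp a) + E (mp b) * yt) / E (mp r)"
    using assms(1) by (rule twE)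
  have nz: "E r \<noteq> 0" "E (mp r) \<noteq> 0" using 1 by auto
  show ?thesis
  proof (cases "a = 0 \<and> b = 0")
    case True
    then show ?thesis using 1 twI[of 1 _ 0 0] by simp
  next
    case False
    then have n: "a * a - b * b * fK \<noteq> 0" using norm_nz by blast
    then have n': "E (a * a - b * b * fK) \<noteq> 0" unfolding pev_x_fun_eq_0_iff .
    have m': "E (mp (a * a - b * b * fK)) \<noteq> 0" using n unfolding pev_x_fun_eq_0_iff mp_eq_0_iff .
    show ?thesis
    proof (rule twI)
      show "a * a - b * b * fK \<noteq> 0" by (rule n)
      show "inverse h = (E (r * a) + E (- (r * b)) * yF) / E (a * a - b * b * fK)"
        using frac_inverse[OF nz(1) y_fun_square, of "E a" "E b"] n' unfolding 1 by simp
      show "inverse h' = (E (mp (r * a)) + E (mp (- (r * b))) * yt) / E (mp (a * a - b * b * fK))"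
        using frac_inverse[OF nz(2) yt_yt, of "E (mp a)" "E (mp b)"] m' 
        unfolding 1 by (simp add: mp_mult mp_diff mp_uminus \<tau>_f)
    qed
  qed
qed

lemma tw_E: "tw (E a) (E (mp a))"
  using twI[of 1 "E a" a 0 "E (mp a)"] \<tau>_1 by simp

lemma tw_Y: "tw yF yt"
  using twI[of 1 yF 0 1 yt] \<tau>_1 by simp

lemma tw_const: "tw (const_fun c) (const_fun (\<tau> c))"
  using tw_E[of "[:c:]"] by (simp add: mp_pCons)

lemma tw_X: "tw xF xF"
  using tw_E[of "[:0, 1:]"] by (simp add: mp_pCons \<tau>_1)

lemma tw_divide: "tw h h' \<Longrightarrow> tw k k' \<Longrightarrow> tw (h / k) (h' / k')"
  unfolding divide_inverse by (intro tw_mult tw_inverse)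

lemma tw_1: "tw 1 1"
  using tw_const[of 1] \<tau>_1 by simp

lemma tw_power: "tw h h' \<Longrightarrow> tw (h ^ n) (h' ^ n)"
  by (induction n) (auto intro: tw_1 tw_mult)

lemma tw_powi: "tw h h' \<Longrightarrow> tw (h powi n) (h' powi n)"
  unfolding power_int_def by (auto intro: tw_power tw_inverse)

lemma tw_ex:
  assumes "h \<in> FF" shows "\<exists>h'. tw h h'"
  using FF_normal[OF assms] twI by metis

lemma tw_FF: 
  assumes "tw h h'" shows "h \<in> FF" "h' \<in> FF"
proof -
  have "yt \<in> FF" unfolding yt_def by (intro FF_mult FF_const FF_Y)
  then show "h \<in> FF" "h' \<in> FF" using assms 
    by (auto elim!: twE intro!: FF_divide FF_add FF_mult FF_E FF_Y)
qed

lemma tw_0: 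
  assumes "tw 0 h'" shows "h' = 0"
proof -
  obtain a b r where 1: "r \<noteq> 0" "0 = (E a + E b * yF) / E r" "h' = (E (mp a) + E (mp b) * yt) / E (mp r)"
    using assms(1) by (rule twE)
  then have "a = 0 \<and> b = 0" using affine_indep by simp
  then show ?thesis using 1 by simp
qed

lemma tw_uminus: "tw h h' \<Longrightarrow> tw (- h) (- h')"
  using tw_mult[OF tw_const[of "- 1"]] by (simp add: \<tau>_uminus \<tau>_1)

lemma tw_unique: 
  assumes "tw h h'" "tw h h''" shows "h' = h''"
  using tw_0[of "h' + - h''"] tw_add[OF assms(1) tw_uminus[OF assms(2)]] by simp

lemma tw_nz: 
  assumes "tw h h'" "h \<noteq> 0" shows "h' \<noteq> 0"
proof
  assume "h' = 0"
  then have "tw 1 0" using tw_mult[OF assms(1) tw_inverse[OF assms(1)]] assms(2) by simp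
  then show False using tw_unique[OF tw_1] by force
qed

section \<open>Twists of points, values and leading coefficients\<close>

fun twp :: "'k alg_closure point \<Rightarrow> 'k alg_closure point" where
  "twp Infinity = Infinity"
| "twp (Affine x y) = Affine (\<tau> x) (e * \<tau> y)"

lemma twp_pts: "P \<in> pts \<Longrightarrow> twp P \<in> pts"
proof (cases P)
  case (Affine x y)
  assume "P \<in> pts"
  then have "y * y = poly fK x" using Affine pts_affine by simp
  then have "\<tau> y * \<tau> y = poly fK (\<tau> x)" 
    using poly_mp[of fK x] by (simp add: \<tau>_f flip: \<tau>_mult)
  moreover have "e * \<tau> y * (e * \<tau> y) = e * e * (\<tau> y * \<tau> y)" by (simp only: mult_ac)
  ultimately have "e * \<tau> y * (e * \<tau> y) = poly fK (\<tau> x)" by (simp add: e_e)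
  then show ?thesis using Affine by (simp add: pts_affine)
qed simp

lemma tw_coord_fun:
  assumes "tw s s" "tw t (const_fun e * t)"
  shows "tw (coord_fun (s, t) a b) (coord_fun (s, t) (mp a) (smult e (mp b)))"
proof -
  have pev: "tw (pev s a) (pev s (mp a))" for a
  proof (induction a)
    case 0
    then show ?case using tw_const[of 0] by simp
  next
    case (pCons c a)
    then show ?case unfolding mp_pCons pev_pCons by (intro tw_add tw_const tw_mult assms)
  qed
  have "tw (pev s a + pev s b * t) (pev s (mp a) + pev s (mp b) * (const_fun e * t))"
    by (intro tw_add tw_mult pev assms)
  then show ?thesis by (simp add: coord_fun_pev mult_ac)
qed

lemma coord_val_mp: "coord_val (\<tau> s0, e * \<tau> t0) (mp a) (smult e (mp b)) = \<tau> (coord_val (s0, t0) a b)"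
proof -
  have "e * poly (mp b) (\<tau> s0) * (e * \<tau> t0) = (e * e) * (poly (mp b) (\<tau> s0) * \<tau> t0)"
    by (simp only: mult_ac)
  then show ?thesis by (simp add: coord_val_eq poly_mp \<tau>_add \<tau>_mult e_e)
qed

text \<open>A point and its twist use the same chart, and in both charts the twist fixes s and
  multiplies t by e. Twisting a fraction for h thus gives a fraction at the twisted point, whose
  value is \<tau> of the old one because e^2 = 1.\<close>

lemma has_value_tw_ex:
  assumes "has_value g f P h v"
  shows "\<exists>h'. tw h h' \<and> has_value g f (twp P) h' (\<tau> v)"
proof -
  obtain s t where st: "chart g f P = (s, t)" "chart g f (twp P) = (s, t)" by (cases P) auto
  obtain s0 t0 where st0: "chart_coords P = (s0, t0)" "chart_coords (twp P) = (\<tau> s0, e * \<tau> t0)" by (cases P) auto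
  have tws: "tw s s" "tw t (const_fun e * t)"
  proof -
    have Y: "tw yF (const_fun e * yF)" using tw_Y by (simp add: yt_def)
    have 1: "tw (1 / xF) (1 / xF)" "tw (yF / xF ^ (g + 1)) (const_fun e * yF / xF ^ (g + 1))"
      by (intro tw_divide tw_1 tw_X tw_power Y)+
    have "(s, t) = (1 / xF, yF / xF ^ (g + 1)) \<or> (s, t) = (xF, yF)"
      using st(1) by (cases P) auto
    then show "tw s s" "tw t (const_fun e * t)" 
      using Y tw_X 1 unfolding prod.inject times_divide_eq_right[symmetric] by metis+
  qed
  obtain a b c d where *: "coord_val (s0, t0) c d \<noteq> 0" "h = coord_fun (s, t) a b / coord_fun (s, t) c d"
    "v = coord_val (s0, t0) a b / coord_val (s0, t0) c d"
    using assms unfolding has_value_def st st0 by blast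
  let ?h = "coord_fun (s, t) (mp a) (smult e (mp b)) / coord_fun (s, t) (mp c) (smult e (mp d))"
  have "tw h ?h" unfolding * by (intro tw_divide tw_coord_fun tws)
  moreover have "has_value g f (twp P) ?h (\<tau> v)"
    unfolding has_value_def st st0
    by (rule exI[of _ "mp a"], rule exI[of _ "smult e (mp b)"], rule exI[of _ "mp c"], rule exI[of _ "smult e (mp d)"])
       (simp only: coord_val_mp * \<tau>_divide \<tau>_eq_0_iff simp_thms)
  ultimately show ?thesis by blast
qed

lemma has_value_tw: "has_value g f P h v \<Longrightarrow> tw h h' \<Longrightarrow> has_value g f (twp P) h' (\<tau> v)"
  using has_value_tw_ex tw_unique by blast

text \<open>The sign acquired by the uniformizer: y and y / x^(g+1) pick up e, while x - x0 does
  not.\<close>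

definition sgP :: "'k alg_closure point \<Rightarrow> 'k alg_closure" where
  "sgP P = (case P of Infinity \<Rightarrow> e | Affine x y \<Rightarrow> if y = 0 then e else 1)"

lemma tw_punif: "tw (punif P) (const_fun (sgP P) * punif (twp P))"
proof (cases P)
  case Infinity
  have "tw (yF / xF ^ (g + 1)) (yt / xF ^ (g + 1))" by (intro tw_divide tw_X tw_power tw_Y)
  then show ?thesis using Infinity by (simp add: sgP_def yt_def)
next
  case (Affine x y)
  have "tw (xF + - const_fun x) (xF + - const_fun (\<tau> x))" by (intro tw_add tw_uminus tw_const tw_X)
  then show ?thesis using Affine tw_Y by (simp add: sgP_def yt_def e_nz)
qed

text \<open>Twisting the decomposition of h into a power of the uniformizer and a unit gives such a
  decomposition at the twisted point, with the sign of the uniformizer raised to the order.\<close>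

theorem twist_ord_lc:
  assumes "P \<in> pts" "nzf h" "tw h h'"
  shows "ordP (twp P) h' = ordP P h \<and> lcP (twp P) h' = sgP P powi ordP P h * \<tau> (lcP P h)"
proof -
  let ?n = "ordP P h" and ?v = "lcP P h"
  obtain w where w: "h = punif P powi ?n * w" "has_value g f P w ?v" "?v \<noteq> 0"
    using decP_ord[OF assms(1,2)] unfolding dec_def by blast
  have "w \<in> FF" using place.hv_F[OF place_at[OF assms(1)] w(2)] .
  then obtain w' where w': "tw w w'" using tw_ex by blast
  have "tw h ((const_fun (sgP P) * punif (twp P)) powi ?n * w')"
    by (subst w(1)) (intro tw_mult tw_powi tw_punif w')
  then have h': "h' = (const_fun (sgP P) * punif (twp P)) powi ?n * w'" using assms(3) tw_unique by blast
  have sg: "sgP P = 1 \<or> sgP P = - 1" using e by (auto simp: sgP_def split: point.split)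
  then have c: "const_fun (sgP P) powi ?n = const_fun (sgP P powi ?n)"
    by (auto simp: power_int_minus_left)
  have eq: "h' = punif (twp P) powi ?n * (const_fun (sgP P powi ?n) * w')"
    unfolding h' by (simp add: power_int_mult_distrib c)
  have P': "twp P \<in> pts" using twp_pts assms by blast
  have nz: "sgP P powi ?n \<noteq> 0" using sg by auto
  have v: "decP (twp P) (const_fun (sgP P powi ?n) * w') (0 + 0) (sgP P powi ?n * \<tau> ?v)"
    using has_value_tw[OF w(2) w'] w(3)
    by (intro place.dec_mult[OF place_at[OF P']] decP_const[OF P'] decP_value[OF P'] nz) auto
  obtain u where "const_fun (sgP P powi ?n) * w' = u" "has_value g f (twp P) u (sgP P powi ?n * \<tau> ?v)" "sgP P powi ?n * \<tau> ?v \<noteq> 0"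
    using v unfolding dec_def by auto
  then have "decP (twp P) h' ?n (sgP P powi ?n * \<tau> ?v)"
    unfolding dec_def using eq by blast
  then show ?thesis using decP_eq[OF P'] by simp
qed

text \<open>For the identity these equations would make the simplifier loop.\<close>

declare \<tau>_0 [simp del] \<tau>_eq_0_iff [simp del]

end

section \<open>Weil reciprocity\<close>

lemma order_linear_power:
  fixes x y :: "'a::field"
  shows "order y ([:- x, 1:] ^ k) = (if y = x then k else 0)"
  by (auto simp: order_power_n_n intro!: order_0I)

lemma poly_factorization:
  fixes p :: "'a::alg_closed_field poly"
  assumes "finite Z" "p \<noteq> 0" "{x. poly p x = 0} \<subseteq> Z"
  shows "p = smult (lead_coeff p) (\<Prod>x\<in>Z. [:- x, 1:] ^ order x p)"
  using assms(2,3)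
proof (induction p rule: poly_root_order_induct)
  case (no_roots p)
  then have "degree p = 0" using alg_closed_imp_poly_has_root[of p] by fastforce
  moreover have "order x p = 0" for x using no_roots by (simp add: order_0I)
  ultimately show ?case by (auto elim!: degree_eq_zeroE)
next
  case (root p x n)
  have p: "p \<noteq> 0" using root by auto
  have xZ: "x \<in> Z" using root by (auto simp: poly_power)
  have o: "order y ([:- x, 1:] ^ n * p) = (if y = x then n else 0) + order y p" for y
    using p by (subst order_mult) (auto simp: order_linear_power)
  have "(\<Prod>y\<in>Z. [:- y, 1:] ^ order y ([:- x, 1:] ^ n * p)) = 
     (\<Prod>y\<in>Z. if y = x then [:- x, 1:] ^ n else 1) * (\<Prod>y\<in>Z. [:- y, 1:] ^ order y p)"
    unfolding prod.distrib[symmetric] o by (rule prod.cong) (auto simp: power_add)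
  also have "(\<Prod>y\<in>Z. if y = x then [:- x, 1:] ^ n else 1) = [:- x, 1:] ^ n"
    using xZ assms(1) by (simp add: prod.delta)
  finally have eq: "(\<Prod>y\<in>Z. [:- y, 1:] ^ order y ([:- x, 1:] ^ n * p)) = [:- x, 1:] ^ n * (\<Prod>y\<in>Z. [:- y, 1:] ^ order y p)" .
  have lc: "lead_coeff ([:- x, 1:] ^ n * p) = lead_coeff p"
    by (simp add: lead_coeff_mult lead_coeff_power del: mult_pCons_left)
  have "p = smult (lead_coeff p) (\<Prod>y\<in>Z. [:- y, 1:] ^ order y p)" using root p by auto
  from arg_cong[OF this, of "(*) ([:- x, 1:] ^ n)"] show ?case unfolding eq lc mult_smult_right .
qed simp

lemma sum_order_eq_degree:
  fixes p :: "'a::alg_closed_field poly"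
  assumes "finite Z" "p \<noteq> 0" "{x. poly p x = 0} \<subseteq> Z"
  shows "(\<Sum>x\<in>Z. order x p) = degree p"
proof -
  have "degree p = degree (\<Prod>x\<in>Z. [:- x, 1:] ^ order x p)"
    using assms(2) by (subst poly_factorization[OF assms]) simp
  also have "\<dots> = (\<Sum>x\<in>Z. degree ([:- x, 1:] ^ order x p))"
    by (rule degree_prod_sum_eq) auto
  also have "\<dots> = (\<Sum>x\<in>Z. order x p)" by (simp add: degree_power_eq)
  finally show ?thesis by simp
qed

lemma powi_sum:
  fixes c :: "'a::field"
  assumes "c \<noteq> 0"
  shows "c powi (\<Sum>i\<in>A. n i) = (\<Prod>i\<in>A. c powi n i)"
  using assms by (induction A rule: infinite_finite_induct) (auto simp: power_int_add)

context hyperelliptic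
begin

section \<open>The hyperelliptic involution and norms to K(x)\<close>

sublocale cj: twist g f "\<lambda>x. x" "- 1"
  by unfold_locales auto

lemma cj_twp: "cj.twp P = opposite P"
  by (cases P) auto

lemma opposite_pts: "P \<in> pts \<Longrightarrow> opposite P \<in> pts"
  using cj.twp_pts by (simp add: cj_twp)

lemma cj_tw: "cj.tw (E a + E b * yF) (E a + E (- b) * yF)"
proof -
  have "cj.tw (E a + E b * yF) (E a + E b * cj.yt)"
    using cj.twI[of 1 "E a + E b * yF" a b "E a + E b * cj.yt"] by simp
  then show ?thesis by (simp add: cj.yt_def)
qed

lemma conj_mult: "(E a + E b * yF) * (E a + E (- b) * yF) = E (a * a - b * b * fK)"
proof -
  have "(E a + E b * yF) * (E a + E (- b) * yF) = E a * E a - E b * E b * (yF * yF)"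
    by (simp add: algebra_simps)
  then show ?thesis by (simp add: y_fun_square)
qed

lemma conj_ord_lc:
  assumes "P \<in> pts" "a \<noteq> 0 \<or> b \<noteq> 0"
  shows "ordP (opposite P) (E a + E (- b) * yF) = ordP P (E a + E b * yF)"
    "lcP (opposite P) (E a + E (- b) * yF) = cj.sgP P powi ordP P (E a + E b * yF) * lcP P (E a + E b * yF)"
  using cj.twist_ord_lc[OF assms(1) nzf_pev[OF assms(2)] cj_tw] by (auto simp: cj_twp)

text \<open>The norm is the product of a + b y and a - b y, and the twist reads off the second
  factor at P from the first factor at the opposite point.\<close>

lemma norm_at_point:
  assumes "P \<in> pts" "a \<noteq> 0 \<or> b \<noteq> 0"
  shows "ordP P (E a + E b * yF) + ordP (opposite P) (E a + E b * yF) = ordP P (E (a * a - b * b * fK))"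
    "lcP P (E a + E b * yF) * (cj.sgP (opposite P) powi ordP (opposite P) (E a + E b * yF) * 
        lcP (opposite P) (E a + E b * yF)) = lcP P (E (a * a - b * b * fK))"
proof -
  have o: "opposite (opposite P) = P" by (cases P) auto
  have n: "nzf (E a + E b * yF)" "nzf (E a + E (- b) * yF)" using assms by (intro nzf_pev; simp)+
  note c = conj_ord_lc[OF opposite_pts[OF assms(1)] assms(2), unfolded o]
  show "ordP P (E a + E b * yF) + ordP (opposite P) (E a + E b * yF) = ordP P (E (a * a - b * b * fK))"
    unfolding conj_mult[symmetric] ordP_mult[OF assms(1) n] c ..
  show "lcP P (E a + E b * yF) * (cj.sgP (opposite P) powi ordP (opposite P) (E a + E b * yF) * 
        lcP (opposite P) (E a + E b * yF)) = lcP P (E (a * a - b * b * fK))"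
    unfolding conj_mult[symmetric] lcP_mult[OF assms(1) n] c ..
qed

lemma norm_unramified:
  assumes "Affine x y \<in> pts" "y \<noteq> 0" "a \<noteq> 0 \<or> b \<noteq> 0"
  shows "ordP (Affine x y) (E a + E b * yF) + ordP (Affine x (- y)) (E a + E b * yF) = int (order x (a * a - b * b * fK))"
    "lcP (Affine x y) (E a + E b * yF) * lcP (Affine x (- y)) (E a + E b * yF) = lcx x (a * a - b * b * fK)"
proof -
  have o: "opposite (Affine x y) = Affine x (- y)" "cj.sgP (Affine x (- y)) = 1" 
    using assms(2) by (simp_all add: cj.sgP_def)
  note n = norm_at_point[OF assms(1,3)] E_unramified[OF assms(1,2) norm_nz[OF assms(3)]]
  show "ordP (Affine x y) (E a + E b * yF) + ordP (Affine x (- y)) (E a + E b * yF) = int (order x (a * a - b * b * fK))"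
    using n(1,3) by (simp only: o)
  show "lcP (Affine x y) (E a + E b * yF) * lcP (Affine x (- y)) (E a + E b * yF) = lcx x (a * a - b * b * fK)"
    using n(2,3) by (simp only: o power_int_1_left mult_1)
qed

lemma sign_transfer: "v * ((- 1) ^ k * v) = w \<Longrightarrow> v * v = (- 1) ^ k * (w :: 'a::comm_ring_1)"
  by (cases "even k") auto

text \<open>A branch point is its own opposite, so the norm has twice the order of the function, and
  the change of sign of the uniformizer y gives the factor (-1)^ord. Only the square of the leading
  coefficient is determined; this suffices because x - c has order 2 at the branch point above c.
  The same happens at infinity.\<close>

lemma norm_ramified:
  assumes "Affine x 0 \<in> pts" "a \<noteq> 0 \<or> b \<noteq> 0"
  shows "ordP (Affine x 0) (E a + E b * yF) = int (order x (a * a - b * b * fK))"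
    "lcP (Affine x 0) (E a + E b * yF) * lcP (Affine x 0) (E a + E b * yF) = 
      (- 1) ^ order x (a * a - b * b * fK) * lcP (Affine x 0) (E [:- x, 1:]) ^ order x (a * a - b * b * fK) * lcx x (a * a - b * b * fK)"
proof -
  have o: "opposite (Affine x 0) = Affine x 0" "cj.sgP (Affine x 0) = - 1" 
    by (simp_all add: cj.sgP_def)
  note n = norm_at_point[OF assms, unfolded o] E_ramified[OF assms(1) norm_nz[OF assms(2)]]
  show *: "ordP (Affine x 0) (E a + E b * yF) = int (order x (a * a - b * b * fK))"
    using n(1,3) by linarith
  show "lcP (Affine x 0) (E a + E b * yF) * lcP (Affine x 0) (E a + E b * yF) = 
      (- 1) ^ order x (a * a - b * b * fK) * lcP (Affine x 0) (E [:- x, 1:]) ^ order x (a * a - b * b * fK) * lcx x (a * a - b * b * fK)"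
    using sign_transfer[OF n(2)[unfolded * power_int_of_nat]] n(3) by (simp only: mult.assoc)
qed

lemma norm_infinity:
  assumes "a \<noteq> 0 \<or> b \<noteq> 0"
  shows "ordP Infinity (E a + E b * yF) = - int (degree (a * a - b * b * fK))"
    "lcP Infinity (E a + E b * yF) * lcP Infinity (E a + E b * yF) = 
      (- 1) ^ degree (a * a - b * b * fK) * lcP Infinity xF ^ degree (a * a - b * b * fK) * lead_coeff (a * a - b * b * fK)"
proof -
  have o: "opposite Infinity = Infinity" "cj.sgP Infinity = - 1" 
    by (simp_all add: cj.sgP_def)
  note n = norm_at_point[OF pts_Infinity assms, unfolded o] E_infinity[OF norm_nz[OF assms]]
  show *: "ordP Infinity (E a + E b * yF) = - int (degree (a * a - b * b * fK))"
    using n(1,3) by linarith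
  have s: "(- 1 :: 'k alg_closure) powi (- int k) = (- 1) ^ k" for k
    by (simp add: power_int_minus flip: power_inverse)
  show "lcP Infinity (E a + E b * yF) * lcP Infinity (E a + E b * yF) = 
      (- 1) ^ degree (a * a - b * b * fK) * lcP Infinity xF ^ degree (a * a - b * b * fK) * lead_coeff (a * a - b * b * fK)"
    using sign_transfer[OF n(2)[unfolded * s]] n(3) by (simp only: mult.assoc)
qed

section \<open>Fibres over the x-line and degrees of principal divisors\<close>

definition fib :: "'k alg_closure \<Rightarrow> 'k alg_closure point set" where
  "fib x = {P \<in> pts. \<exists>y. P = Affine x y}"

lemma fib_cases:
  obtains "Affine x 0 \<in> pts" "fib x = {Affine x 0}" 
  | y where "y \<noteq> 0" "Affine x y \<in> pts" "Affine x (- y) \<in> pts" "y \<noteq> - y" "fib x = {Affine x y, Affine x (- y)}"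
proof -
  obtain y where y: "y ^ 2 = poly fK x" using nth_root_exists[of 2 "poly fK x"] by auto
  have "Affine x z \<in> pts \<longleftrightarrow> z = y \<or> z = - y" for z
    unfolding pts_affine using y power2_eq_iff[of z y] by (simp add: power2_eq_square)
  then have fib: "fib x = {Affine x y, Affine x (- y)}" and pts: "Affine x y \<in> pts" "Affine x (- y) \<in> pts" 
    unfolding fib_def by auto
  show ?thesis
  proof (cases "y = 0")
    case False
    have "y \<noteq> - y"
    proof
      assume "y = - y"
      then have "2 * y = 0" unfolding eq_neg_iff_add_eq_0 mult_2 .
      then show False using False two_nz by simp
    qed
    then show ?thesis using that(2)[of y] fib pts False by blast
  qed (use that(1) fib pts in auto)
qed

lemma finite_fib: "finite (fib x)"
  by (rule fib_cases[of x]) auto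

lemma fib_pts: "P \<in> fib x \<Longrightarrow> P \<in> pts" by (simp add: fib_def)

lemma sum_fib:
  assumes "a \<noteq> 0 \<or> b \<noteq> 0"
  shows "(\<Sum>P\<in>fib x. ordP P (E a + E b * yF)) = int (order x (a * a - b * b * fK))"
  by (rule fib_cases[of x]) (use norm_ramified(1) norm_unramified(1) assms in auto)

lemma ordP_poly_nonneg:
  assumes "Affine x y \<in> pts" "a \<noteq> 0 \<or> b \<noteq> 0"
  shows "ordP (Affine x y) (E a + E b * yF) \<ge> 0"
  using has_value_ord_nonneg[OF assms(1) nzf_pev[OF assms(2)] has_value_affine[OF assms(1)]] .

text \<open>The orders along a fibre are nonnegative and add up to the order of the norm, so all of
  them vanish where the norm does not.\<close>

lemma ordP_poly_pos:
  assumes "Affine x y \<in> pts" "a \<noteq> 0 \<or> b \<noteq> 0" "ordP (Affine x y) (E a + E b * yF) \<noteq> 0"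
  shows "poly (a * a - b * b * fK) x = 0"
proof (rule ccontr)
  assume "poly (a * a - b * b * fK) x \<noteq> 0"
  then have "order x (a * a - b * b * fK) = 0" by (rule order_0I)
  then have "(\<Sum>P\<in>fib x. ordP P (E a + E b * yF)) = 0" using sum_fib[OF assms(2)] by simp
  moreover have "ordP P (E a + E b * yF) \<ge> 0" if "P \<in> fib x" for P
    using that ordP_poly_nonneg[OF _ assms(2)] by (auto simp: fib_def)
  ultimately have "\<forall>P\<in>fib x. ordP P (E a + E b * yF) = 0"
    using sum_nonneg_eq_0_iff[OF finite_fib[of x], of "\<lambda>P. ordP P (E a + E b * yF)"] by blast
  then show False using assms by (auto simp: fib_def)
qed

definition supp :: "'k fun_field \<Rightarrow> 'k alg_closure point set" where
  "supp h = {P \<in> pts. ordP P h \<noteq> 0}"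

definition fibs :: "'k alg_closure set \<Rightarrow> 'k alg_closure point set" where
  "fibs Z = insert Infinity (\<Union>x\<in>Z. fib x)"

lemma finite_fibs: "finite Z \<Longrightarrow> finite (fibs Z)"
  unfolding fibs_def using finite_fib by simp

lemma fibs_pts: "fibs Z \<subseteq> pts"
  unfolding fibs_def using fib_pts pts_Infinity by blast

lemma supp_poly:
  assumes "a \<noteq> 0 \<or> b \<noteq> 0" "{x. poly (a * a - b * b * fK) x = 0} \<subseteq> Z"
  shows "supp (E a + E b * yF) \<subseteq> fibs Z"
proof
  fix P assume "P \<in> supp (E a + E b * yF)"
  then have P: "P \<in> pts" "ordP P (E a + E b * yF) \<noteq> 0" by (auto simp: supp_def)
  show "P \<in> fibs Z"
  proof (cases P)
    case (Affine x y)
    then have "x \<in> Z" using ordP_poly_pos[of x y] P assms by auto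
    then show ?thesis using Affine P by (auto simp: fibs_def fib_def)
  qed (simp add: fibs_def)
qed

lemma finite_supp_poly:
  assumes "a \<noteq> 0 \<or> b \<noteq> 0" shows "finite (supp (E a + E b * yF))"
  by (rule finite_subset[OF supp_poly[OF assms order_refl]])
    (intro finite_fibs poly_roots_finite norm_nz assms)

lemma finite_supp: assumes "nzf h" shows "finite (supp h)"
proof -
  obtain a b r where r: "r \<noteq> 0" "h = (E a + E b * yF) / E r" using FF_normal assms by blast
  have ab: "a \<noteq> 0 \<or> b \<noteq> 0" using r assms by auto
  have "supp h \<subseteq> supp (E a + E b * yF) \<union> supp (E r)"
    unfolding supp_def r(2) using ordP_divide[OF _ nzf_pev[OF ab] nzf_E[OF r(1)]] by auto
  moreover have "finite (supp (E r))" using finite_supp_poly[of r 0] r by simp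
  ultimately show ?thesis using finite_supp_poly[OF ab] finite_subset by blast
qed

lemma fib_inj: "P \<in> fib x \<Longrightarrow> P \<in> fib x' \<Longrightarrow> x = x'" and Infinity_notin_fib: "Infinity \<notin> fib x"
  by (auto simp: fib_def)

lemma sum_fibs: "finite Z \<Longrightarrow> (\<Sum>P\<in>fibs Z. \<phi> P) = \<phi> Infinity + (\<Sum>x\<in>Z. \<Sum>P\<in>fib x. (\<phi> P :: int))"
  unfolding fibs_def
  by (subst sum.insert) (auto simp: finite_fib Infinity_notin_fib dest: fib_inj intro!: sum.UNION_disjoint)

lemma prod_fibs: "finite Z \<Longrightarrow> (\<Prod>P\<in>fibs Z. \<phi> P) = \<phi> Infinity * (\<Prod>x\<in>Z. \<Prod>P\<in>fib x. (\<phi> P :: 'k alg_closure))"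
  unfolding fibs_def
  by (subst prod.insert) (auto simp: finite_fib Infinity_notin_fib dest: fib_inj intro!: prod.UNION_disjoint)

text \<open>The norm has as many roots with multiplicity as its degree. Counted fibre by fibre these
  are the affine zeros, and the degree of the norm is also the order of the pole at
  infinity.\<close>

lemma degree_poly_0:
  assumes "a \<noteq> 0 \<or> b \<noteq> 0" shows "(\<Sum>P\<in>supp (E a + E b * yF). ordP P (E a + E b * yF)) = 0"
proof -
  let ?n = "a * a - b * b * fK" and ?h = "E a + E b * yF"
  let ?Z = "{x. poly ?n x = 0}"
  have fin: "finite ?Z" using poly_roots_finite[OF norm_nz[OF assms]] .
  have "(\<Sum>P\<in>supp ?h. ordP P ?h) = (\<Sum>P\<in>fibs ?Z. ordP P ?h)"
    using supp_poly[OF assms order_refl] fibs_pts by (intro sum.mono_neutral_left finite_fibs fin) (auto simp: supp_def)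
  also have "\<dots> = - int (degree ?n) + (\<Sum>x\<in>?Z. int (order x ?n))"
    unfolding sum_fibs[OF fin] sum_fib[OF assms] norm_infinity(1)[OF assms] ..
  also have "(\<Sum>x\<in>?Z. int (order x ?n)) = int (degree ?n)"
    using sum_order_eq_degree[OF fin norm_nz[OF assms] order_refl] by (simp flip: of_nat_sum)
  finally show ?thesis by simp
qed

lemma sum_ordP_superset:
  assumes "finite S" "supp h \<subseteq> S" "S \<subseteq> pts"
  shows "(\<Sum>P\<in>S. ordP P h) = (\<Sum>P\<in>supp h. ordP P h)"
  using assms by (intro sum.mono_neutral_right) (auto simp: supp_def)

theorem degree_principal: 
  assumes "nzf h" shows "(\<Sum>P\<in>supp h. ordP P h) = 0"
proof -
  obtain a b r where r: "r \<noteq> 0" "h = (E a + E b * yF) / E r" using FF_normal assms by blast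
  have ab: "a \<noteq> 0 \<or> b \<noteq> 0" using r assms by auto
  note n = nzf_pev[OF ab] nzf_E[OF r(1)]
  let ?S = "supp (E a + E b * yF) \<union> supp (E r)"
  have S: "finite ?S" "?S \<subseteq> pts" "supp h \<subseteq> ?S"
    using finite_supp n ordP_divide[OF _ n] by (auto simp: supp_def r(2))
  have "(\<Sum>P\<in>supp h. ordP P h) = (\<Sum>P\<in>?S. ordP P h)" by (rule sum_ordP_superset[symmetric, OF S(1,3,2)])
  also have "\<dots> = (\<Sum>P\<in>?S. ordP P (E a + E b * yF) - ordP P (E r))"
    using S unfolding r(2) by (intro sum.cong ordP_divide[OF _ n]) auto
  also have "\<dots> = (\<Sum>P\<in>?S. ordP P (E a + E b * yF)) - (\<Sum>P\<in>?S. ordP P (E r))" by (rule sum_subtractf)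
  also have "(\<Sum>P\<in>?S. ordP P (E a + E b * yF)) = 0" 
    by (subst sum_ordP_superset[OF S(1) _ S(2)]) (rule Un_upper1 degree_poly_0[OF ab])+
  also have "(\<Sum>P\<in>?S. ordP P (E r)) = 0" 
    using degree_poly_0[of r 0] r(1) by (subst sum_ordP_superset[OF S(1) _ S(2)]) simp_all
  finally show ?thesis by simp
qed

section \<open>Products of tame symbols over the curve\<close>

definition tame_at :: "'k alg_closure point \<Rightarrow> 'k fun_field \<Rightarrow> 'k fun_field \<Rightarrow> 'k alg_closure" where
  "tame_at P = tame (has_value g f P) (punif P)"

lemma tame_at_eq: "tame_at P a b = (- 1) powi (ordP P a * ordP P b) * lcP P a powi ordP P b / lcP P b powi ordP P a"
  by (simp add: tame_at_def tame_def ordP_def lcP_def)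

text \<open>Outside both supports the symbol is 1, so this is the product over all points of the
  curve.\<close>

definition tame_prod :: "'k fun_field \<Rightarrow> 'k fun_field \<Rightarrow> 'k alg_closure" where
  "tame_prod a b = (\<Prod>P\<in>supp a \<union> supp b. tame_at P a b)"

lemma tame_prod_superset:
  assumes "finite S" "S \<subseteq> pts" "supp a \<union> supp b \<subseteq> S"
  shows "tame_prod a b = (\<Prod>P\<in>S. tame_at P a b)"
  unfolding tame_prod_def using assms by (intro prod.mono_neutral_left) (auto simp: supp_def tame_at_eq)

lemma tame_prod_mult_left:
  assumes "nzf a" "nzf a'" "nzf b"
  shows "tame_prod (a * a') b = tame_prod a b * tame_prod a' b"
proof -
  let ?S = "supp a \<union> supp a' \<union> supp b"
  have S: "finite ?S" "?S \<subseteq> pts" using assms finite_supp by (auto simp: supp_def)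
  have "supp (a * a') \<subseteq> supp a \<union> supp a'" using ordP_mult[OF _ assms(1,2)] by (auto simp: supp_def)
  then have "tame_prod (a * a') b = (\<Prod>P\<in>?S. tame_at P (a * a') b)" by (intro tame_prod_superset S) auto
  also have "\<dots> = (\<Prod>P\<in>?S. tame_at P a b * tame_at P a' b)"
  proof (rule prod.cong[OF refl])
    fix P assume "P \<in> ?S"
    then show "tame_at P (a * a') b = tame_at P a b * tame_at P a' b"
      unfolding tame_at_def using place.tame_mult_left[OF place_at, of P a a' b] S assms by blast
  qed
  also have "\<dots> = (\<Prod>P\<in>?S. tame_at P a b) * (\<Prod>P\<in>?S. tame_at P a' b)" by (rule prod.distrib)
  also have "(\<Prod>P\<in>?S. tame_at P a b) = tame_prod a b" by (rule tame_prod_superset[symmetric, OF S]) auto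
  also have "(\<Prod>P\<in>?S. tame_at P a' b) = tame_prod a' b" by (rule tame_prod_superset[symmetric, OF S]) auto
  finally show ?thesis .
qed

lemma tame_prod_swap:
  assumes "nzf a" "nzf b" shows "tame_prod a b * tame_prod b a = 1"
proof -
  have "tame_at P a b * tame_at P b a = 1" if "P \<in> supp a \<union> supp b" for P
    unfolding tame_at_def using place.tame_swap[OF place_at, of P a b] that assms by (auto simp: supp_def)
  then have "(\<Prod>P\<in>supp a \<union> supp b. tame_at P a b * tame_at P b a) = 1" by simp
  then show ?thesis unfolding tame_prod_def by (simp add: prod.distrib Un_commute)
qed

lemma tame_prod_nz: "nzf a \<Longrightarrow> nzf b \<Longrightarrow> tame_prod a b \<noteq> 0"
  using tame_prod_swap by force

lemma tame_prod_mult_right: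
  assumes "nzf a" "nzf b" "nzf b'" shows "tame_prod a (b * b') = tame_prod a b * tame_prod a b'"
proof -
  have "tame_prod a (b * b') * (tame_prod b a * tame_prod b' a) = tame_prod a b * tame_prod b a * (tame_prod a b' * tame_prod b' a)"
    using tame_prod_swap[OF assms(1) nzf_mult[OF assms(2,3)]] tame_prod_mult_left[OF assms(2,3,1)]
      tame_prod_swap[OF assms(1,2)] tame_prod_swap[OF assms(1,3)] by simp
  then show ?thesis using tame_prod_nz[OF assms(2,1)] tame_prod_nz[OF assms(3,1)] by simp
qed

lemma tame_prod_1: "nzf b \<Longrightarrow> tame_prod 1 b = 1"
  using tame_prod_mult_left[OF nzf_1 nzf_1, of b] tame_prod_nz[OF nzf_1, of b] by simp

lemma tame_prod_eq_1_left: "nzf a \<Longrightarrow> nzf b \<Longrightarrow> tame_prod b a = 1 \<Longrightarrow> tame_prod a b = 1"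
  using tame_prod_swap[of a b] by simp

lemma tame_prod_inverse:
  assumes "nzf a" "nzf b" shows "tame_prod (inverse a) b = inverse (tame_prod a b)"
proof -
  have "tame_prod a b * tame_prod (inverse a) b = 1"
    using tame_prod_mult_left[OF assms(1) nzf_inverse[OF assms(1)] assms(2)] tame_prod_1[OF assms(2)] assms by simp
  then show ?thesis by (metis inverse_unique)
qed

lemma tame_prod_steinberg:
  assumes "nzf a" "nzf b" "a + b = 1" shows "tame_prod a b = 1"
  unfolding tame_prod_def tame_at_def using place.tame_steinberg[OF place_at, of _ a b] assms 
  by (intro prod.neutral) (auto simp: supp_def)

lemma tame_prod_self:
  assumes "nzf a" shows "tame_prod a a = 1"
proof -
  have "tame_prod a a = (\<Prod>P\<in>supp a. (- 1) powi ordP P a)"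
    unfolding tame_prod_def tame_at_def using place.tame_self[OF place_at, of _ a] assms 
    by (intro prod.cong) (auto simp: supp_def ordP_def)
  also have "\<dots> = (- 1) powi (\<Sum>P\<in>supp a. ordP P a)" by (simp add: powi_sum)
  finally show ?thesis using degree_principal[OF assms] by simp
qed

lemma tame_prod_const:
  assumes "c \<noteq> 0" "nzf b" shows "tame_prod (const_fun c) b = 1"
proof -
  have "supp (const_fun c) = {}" using ordP_const assms by (auto simp: supp_def)
  then have "tame_prod (const_fun c) b = (\<Prod>P\<in>supp b. c powi ordP P b)"
    unfolding tame_prod_def using ordP_const[OF _ assms(1)] lcP_const[OF _ assms(1)] 
    by (intro prod.cong) (auto simp: supp_def tame_at_eq)
  also have "\<dots> = c powi (\<Sum>P\<in>supp b. ordP P b)" using assms by (simp add: powi_sum)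
  finally show ?thesis using degree_principal[OF assms(2)] by simp
qed

section \<open>The product formula for the symbols of x - c\<close>

lemma linear_at:
  assumes "Affine x y \<in> pts" "x \<noteq> c"
  shows "ordP (Affine x y) (E [:- c, 1:]) = 0 \<and> lcP (Affine x y) (E [:- c, 1:]) = x - c"
proof (rule decP_eq[OF assms(1)], rule decP_value[OF assms(1)])
  show "has_value g f (Affine x y) (E [:- c, 1:]) (x - c)"
    using has_value_affine[OF assms(1), of "[:- c, 1:]" 0] by simp
qed (use assms in simp)

text \<open>On this fibre x - c is a unit with the constant value x - c, so each symbol is a power
  of it, and the exponents add up to the order of the norm.\<close>

lemma fiber_away:
  assumes "a \<noteq> 0 \<or> b \<noteq> 0" "x \<noteq> c"
  shows "(\<Prod>P\<in>fib x. tame_at P (E [:- c, 1:]) (E a + E b * yF)) = (x - c) ^ order x (a * a - b * b * fK)"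
proof -
  have "(\<Prod>P\<in>fib x. tame_at P (E [:- c, 1:]) (E a + E b * yF)) = (\<Prod>P\<in>fib x. (x - c) powi ordP P (E a + E b * yF))"
    using linear_at[OF _ assms(2)] by (intro prod.cong) (auto simp: fib_def tame_at_eq simp del: pev_pCons)
  also have "\<dots> = (x - c) powi (\<Sum>P\<in>fib x. ordP P (E a + E b * yF))"
    using assms by (simp add: powi_sum)
  finally show ?thesis by (simp add: sum_fib[OF assms(1)])
qed

lemma order_linear: "order c [:- c, 1:] = 1" and lcx_linear: "lcx c [:- c, 1:] = 1"
proof -
  show o: "order c [:- c, 1:] = 1" using order_power_n_n[of c 1] by simp
  show "lcx c [:- c, 1:] = 1" unfolding lcx_def o by simp
qed

text \<open>The right-hand side is the tame symbol of X - c and the norm at the point c of the line.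
  Over a branch point the unevaluated leading coefficient of x - c occurs in the numerator and,
  through \<open>norm_ramified\<close>, in the denominator.\<close>

lemma fiber_at:
  assumes "a \<noteq> 0 \<or> b \<noteq> 0"
  shows "(\<Prod>P\<in>fib c. tame_at P (E [:- c, 1:]) (E a + E b * yF)) = 
    (- 1) ^ order c (a * a - b * b * fK) / lcx c (a * a - b * b * fK)"
proof (rule fib_cases[of c])
  let ?n = "a * a - b * b * fK" and ?h = "E a + E b * yF"
  assume fib: "Affine c 0 \<in> pts" "fib c = {Affine c 0}"
  let ?P = "Affine c 0" let ?l = "lcP ?P (E [:- c, 1:])"
  have l: "?l \<noteq> 0" using lcP_nz[OF fib(1) nzf_E[of "[:- c, 1:]"]] by (simp del: pev_pCons)
  have "tame_at ?P (E [:- c, 1:]) ?h = (- 1) powi (2 * int (order c ?n)) * ?l ^ order c ?n / (lcP ?P ?h * lcP ?P ?h)"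
    unfolding tame_at_eq linear_ramified[OF fib(1)] norm_ramified(1)[OF fib(1) assms] 
    by (simp add: power2_eq_square)
  also have "\<dots> = (- 1) ^ order c ?n / lcx c ?n"
    unfolding norm_ramified(2)[OF fib(1) assms] using l 
    by (cases "even (order c ?n)") (simp_all add: power_int_mult del: pev_pCons)
  finally show ?thesis unfolding fib by simp
next
  let ?n = "a * a - b * b * fK" and ?h = "E a + E b * yF"
  fix y assume y: "y \<noteq> 0" "Affine c y \<in> pts" "Affine c (- y) \<in> pts" "y \<noteq> - y" "fib c = {Affine c y, Affine c (- y)}"
  let ?P = "Affine c y" and ?Q = "Affine c (- y)"
  have lin: "ordP ?P (E [:- c, 1:]) = 1" "lcP ?P (E [:- c, 1:]) = 1" "ordP ?Q (E [:- c, 1:]) = 1" "lcP ?Q (E [:- c, 1:]) = 1"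
    using E_unramified[OF y(2,1), of "[:- c, 1:]"] E_unramified[OF y(3), of "[:- c, 1:]"] y(1) 
    by (simp_all add: order_linear lcx_linear del: pev_pCons)
  have "(\<Prod>P\<in>fib c. tame_at P (E [:- c, 1:]) ?h) = tame_at ?P (E [:- c, 1:]) ?h * tame_at ?Q (E [:- c, 1:]) ?h"
    unfolding y(5) using y(4) by simp
  also have "\<dots> = (- 1) powi (ordP ?P ?h + ordP ?Q ?h) / (lcP ?P ?h * lcP ?Q ?h)"
    unfolding tame_at_eq lin by (simp add: power_int_add)
  finally show "(\<Prod>P\<in>fib c. tame_at P (E [:- c, 1:]) ?h) = (- 1) ^ order c ?n / lcx c ?n"
    unfolding norm_unramified[OF y(2,1) assms] by simp
qed

text \<open>The right-hand side is the tame symbol of X - c and the norm at infinity on the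
  projective line, with parameter 1/X.\<close>

lemma infinity_linear:
  assumes "a \<noteq> 0 \<or> b \<noteq> 0"
  shows "tame_at Infinity (E [:- c, 1:]) (E a + E b * yF) = 
    (- 1) ^ degree (a * a - b * b * fK) * lead_coeff (a * a - b * b * fK)"
proof -
  let ?n = "a * a - b * b * fK" and ?h = "E a + E b * yF"
  let ?d = "degree ?n" and ?l = "lcP Infinity xF"
  have l: "?l \<noteq> 0" using lcP_nz[OF pts_Infinity nzf_X] .
  have A: "ordP Infinity (E [:- c, 1:]) = - 2" "lcP Infinity (E [:- c, 1:]) = ?l"
    using E_infinity[of "[:- c, 1:]"] by (simp_all del: pev_pCons)
  have "tame_at Infinity (E [:- c, 1:]) ?h = ?l powi (- int ?d) * (lcP Infinity ?h * lcP Infinity ?h)"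
    unfolding tame_at_eq A norm_infinity(1)[OF assms] 
    by (simp add: power_int_minus power2_eq_square field_simps power_int_mult)
  also have "\<dots> = (- 1) ^ ?d * lead_coeff ?n"
    unfolding norm_infinity(2)[OF assms] using l by (simp add: power_int_minus)
  finally show ?thesis .
qed

lemma lcx_factorization:
  assumes "finite Z" "p \<noteq> 0" "{x. poly p x = 0} \<subseteq> Z" "c \<in> Z"
  shows "lcx c p = lead_coeff p * (\<Prod>x\<in>Z - {c}. (c - x) ^ order x p)"
proof -
  let ?q = "smult (lead_coeff p) (\<Prod>x\<in>Z - {c}. [:- x, 1:] ^ order x p)"
  have eq: "[:- c, 1:] ^ order c p * ?q = p"
    using poly_factorization[OF assms(1-3)] prod.remove[OF assms(1,4), of "\<lambda>x. [:- x, 1:] ^ order x p"] by simp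
  have "p div [:- c, 1:] ^ order c p = ?q"
    by (subst (1) eq[symmetric]) (rule nonzero_mult_div_cancel_left, simp)
  then show ?thesis unfolding lcx_def by (simp add: poly_prod poly_power)
qed

text \<open>The fibrewise products are tame symbols on the projective line, so what remains is the
  product formula there for X - c and the norm. Factoring the norm over its roots shows that its
  leading coefficient at c cancels the other factors, and every sign occurs twice.\<close>

lemma tame_prod_linear:
  assumes "a \<noteq> 0 \<or> b \<noteq> 0"
  shows "tame_prod (E [:- c, 1:]) (E a + E b * yF) = 1"
proof -
  let ?n = "a * a - b * b * fK" and ?h = "E a + E b * yF" and ?A = "E [:- c, 1:]"
  let ?Z = "insert c {x. poly ?n x = 0}"
  let ?d = "degree ?n" and ?k = "order c ?n"
  have nn: "?n \<noteq> 0" using norm_nz[OF assms] .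
  have fin: "finite ?Z" using poly_roots_finite[OF nn] by simp
  have "poly ([:- c, 1:] * [:- c, 1:] - 0 * 0 * fK) x = (x - c) * (x - c)" for x by (simp add: algebra_simps)
  then have "{x. poly ([:- c, 1:] * [:- c, 1:] - 0 * 0 * fK) x = 0} \<subseteq> ?Z" by simp
  then have "supp ?A \<subseteq> fibs ?Z"
    using supp_poly[of "[:- c, 1:]" 0 ?Z] by (simp del: pev_pCons mult_pCons_left)
  moreover have "supp ?h \<subseteq> fibs ?Z" by (rule supp_poly[OF assms]) auto
  ultimately have "tame_prod ?A ?h = (\<Prod>P\<in>fibs ?Z. tame_at P ?A ?h)"
    by (intro tame_prod_superset finite_fibs fin fibs_pts Un_least)
  also have "\<dots> = tame_at Infinity ?A ?h * (\<Prod>x\<in>?Z. \<Prod>P\<in>fib x. tame_at P ?A ?h)"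
    by (rule prod_fibs[OF fin])
  also have "(\<Prod>x\<in>?Z. \<Prod>P\<in>fib x. tame_at P ?A ?h) = (\<Prod>P\<in>fib c. tame_at P ?A ?h) * (\<Prod>x\<in>?Z - {c}. \<Prod>P\<in>fib x. tame_at P ?A ?h)"
    by (rule prod.remove[OF fin]) simp
  also have "(\<Prod>x\<in>?Z - {c}. \<Prod>P\<in>fib x. tame_at P ?A ?h) = (\<Prod>x\<in>?Z - {c}. (x - c) ^ order x ?n)"
    by (intro prod.cong fiber_away assms) auto
  \<comment> \<open>The signs turn x - c into c - x, the form in which
    \<open>lcx_factorization\<close> expresses the leading coefficient of the norm at c.\<close>
  also have "\<dots> = (\<Prod>x\<in>?Z - {c}. (- 1) ^ order x ?n * (c - x) ^ order x ?n)"
    by (intro prod.cong) (auto simp flip: power_mult_distrib)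
  also have "\<dots> = (- 1) ^ (\<Sum>x\<in>?Z - {c}. order x ?n) * (\<Prod>x\<in>?Z - {c}. (c - x) ^ order x ?n)"
    unfolding power_sum by (rule prod.distrib)
  finally have eq: "tame_prod ?A ?h = ((- 1) ^ ?d * lead_coeff ?n) * ((- 1) ^ ?k / lcx c ?n * 
     ((- 1) ^ (\<Sum>x\<in>?Z - {c}. order x ?n) * (\<Prod>x\<in>?Z - {c}. (c - x) ^ order x ?n)))"
    unfolding infinity_linear[OF assms] fiber_at[OF assms] .
  have lcx: "lcx c ?n = lead_coeff ?n * (\<Prod>x\<in>?Z - {c}. (c - x) ^ order x ?n)"
    by (rule lcx_factorization[OF fin nn]) auto
  have "(\<Sum>x\<in>?Z. order x ?n) = ?d" by (rule sum_order_eq_degree[OF fin nn]) auto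
  then have d: "?d = ?k + (\<Sum>x\<in>?Z - {c}. order x ?n)" using sum.remove[OF fin, of c "\<lambda>x. order x ?n"] by simp
  have nz: "lcx c ?n \<noteq> 0" using order_lcx[OF nn] by metis
  have "tame_prod ?A ?h = ((- 1) ^ ?d * (- 1) ^ (?k + (\<Sum>x\<in>?Z - {c}. order x ?n))) * 
     (lead_coeff ?n * (\<Prod>x\<in>?Z - {c}. (c - x) ^ order x ?n) / lcx c ?n)"
    unfolding eq by (simp add: power_add)
  also have "\<dots> = ((- 1) ^ ?d * (- 1) ^ ?d) * 1"
    unfolding d[symmetric] lcx[symmetric] using nz by simp
  finally show ?thesis by (simp flip: power_mult_distrib)
qed

lemma tame_prod_linear_FF:
  assumes "nzf h" shows "tame_prod (E [:- c, 1:]) h = 1"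
proof -
  obtain a b r where r: "r \<noteq> 0" "h = (E a + E b * yF) / E r" using FF_normal assms by blast
  have ab: "a \<noteq> 0 \<or> b \<noteq> 0" using r assms by auto
  have A: "nzf (E [:- c, 1:])" by (rule nzf_E) simp
  have "tame_prod (E [:- c, 1:]) (h * E r) = tame_prod (E [:- c, 1:]) h * tame_prod (E [:- c, 1:]) (E r)"
    by (rule tame_prod_mult_right[OF A assms nzf_E[OF r(1)]])
  moreover have "h * E r = E a + E b * yF" using r by simp
  moreover have "tame_prod (E [:- c, 1:]) (E r) = 1" using tame_prod_linear[of r 0 c] r by (simp del: pev_pCons)
  ultimately show ?thesis using tame_prod_linear[OF ab, of c] by simp
qed

lemma tame_prod_poly:
  assumes "p \<noteq> 0" "nzf h" shows "tame_prod (E p) h = 1"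
  using assms(1)
proof (induction "degree p" arbitrary: p rule: less_induct)
  case less
  show ?case
  proof (cases "degree p = 0")
    case True
    then obtain c where "p = [:c:]" by (auto elim: degree_eq_zeroE)
    then show ?thesis using tame_prod_const[of c h] assms less.prems by simp
  next
    case False
    then obtain x where "poly p x = 0" using alg_closed_imp_poly_has_root by blast
    then obtain q where q: "p = [:- x, 1:] * q" by (meson dvdE poly_eq_0_iff_dvd)
    have q0: "q \<noteq> 0" using less.prems q by auto
    then have "degree q < degree p" unfolding q using degree_mult_eq[of "[:- x, 1:]" q] by (simp del: mult_pCons_left)
    then have IH: "tame_prod (E q) h = 1" using less.hyps q0 by blast
    have "tame_prod (E p) h = tame_prod (E [:- x, 1:]) h * tame_prod (E q) h"
      unfolding q pev_mult by (intro tame_prod_mult_left nzf_E q0 assms) simp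
    then show ?thesis using IH tame_prod_linear_FF[OF assms(2)] by simp
  qed
qed

lemma tame_prod_rational:
  assumes "p \<noteq> 0" "q \<noteq> 0" "nzf h" shows "tame_prod (E p / E q) h = 1"
  using tame_prod_mult_left[OF nzf_E[OF assms(1)] nzf_inverse[OF nzf_E[OF assms(2)]] assms(3)]
    tame_prod_inverse[OF nzf_E[OF assms(2)] assms(3)] tame_prod_poly[OF _ assms(3)] assms
  by (simp add: divide_inverse)

text \<open>
  The functions \<open>1\<close>, \<open>h\<close>, \<open>k\<close> are linearly dependent over $K(x)$, so the symbol of \<open>h\<close> and \<open>k\<close>
  reduces through a Steinberg relation to symbols with one entry in $K(x)$.
\<close>

theorem weil_reciprocity:
  assumes "nzf h" "nzf k" shows "tame_prod h k = 1"
proof -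
  obtain a b r where r: "r \<noteq> 0" "h = (E a + E b * yF) / E r" using FF_normal assms by blast
  have ab: "a \<noteq> 0 \<or> b \<noteq> 0" using r assms by auto
  obtain c d q where q: "q \<noteq> 0" "k = (E c + E d * yF) / E q" using FF_normal assms by blast
  have cd: "c \<noteq> 0 \<or> d \<noteq> 0" using q assms by auto
  consider "b = 0" | "d = 0" | "b \<noteq> 0" "d \<noteq> 0" by blast
  then show ?thesis
  proof cases
    case 1
    then show ?thesis using tame_prod_rational[of a r k] r ab assms by simp
  next
    case 2
    then show ?thesis using tame_prod_eq_1_left[OF assms] tame_prod_rational[of c q h] q cd assms by simp
  next
    case 3
    \<comment> \<open>The coefficients eliminate y: the combination is d (a + b y) - b (c + d y) = a
      d - b c.\<close>
    define \<alpha> where "\<alpha> = E (d * r)"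
    define \<beta> where "\<beta> = E (- (b * q))"
    define t where "t = a * d - b * c"
    have nz: "nzf \<alpha>" "nzf \<beta>" unfolding \<alpha>_def \<beta>_def using 3 r(1) q(1) by (intro nzf_E; simp)+
    have "h * E r = E a + E b * yF" "k * E q = E c + E d * yF" using r q by auto
    then have eq: "\<alpha> * h + \<beta> * k = E t" 
    proof -
      have "\<alpha> * h + \<beta> * k = E d * (h * E r) - E b * (k * E q)"
        by (simp add: \<alpha>_def \<beta>_def algebra_simps)
      also have "\<dots> = E t" unfolding \<open>h * E r = _\<close> \<open>k * E q = _\<close> by (simp add: t_def algebra_simps)
      finally show ?thesis .
    qed
    have tame_prod\<alpha>: "tame_prod \<alpha> x = 1" "tame_prod x \<alpha> = 1" if "nzf x" for x
      unfolding \<alpha>_def using tame_prod_poly[of "d * r" x] tame_prod_eq_1_left[OF that nzf_E[of "d * r"]] 3 r that by auto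
    have tame_prod\<beta>: "tame_prod \<beta> x = 1" "tame_prod x \<beta> = 1" if "nzf x" for x
      unfolding \<beta>_def using tame_prod_poly[of "- (b * q)" x] tame_prod_eq_1_left[OF that nzf_E[of "- (b * q)"]] 3 q that by auto
    show ?thesis
    proof (cases "t = 0")
      case False
      define \<gamma> where "\<gamma> = inverse (E t)"
      have \<gamma>: "nzf \<gamma>" unfolding \<gamma>_def by (intro nzf_inverse nzf_E False)
      have tame_prod\<gamma>: "tame_prod \<gamma> x = 1" "tame_prod x \<gamma> = 1" if "nzf x" for x
      proof -
        show "tame_prod \<gamma> x = 1" unfolding \<gamma>_def using tame_prod_inverse[OF nzf_E[OF False] that] tame_prod_poly[OF False that] by simp
        then show "tame_prod x \<gamma> = 1" using tame_prod_eq_1_left[OF that \<gamma>] by blast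
      qed
      have "\<gamma> * (\<alpha> * h) + \<gamma> * (\<beta> * k) = \<gamma> * E t" unfolding eq[symmetric] by (simp add: distrib_left)
      also have "\<dots> = 1" using False by (simp add: \<gamma>_def)
      finally have "tame_prod (\<gamma> * (\<alpha> * h)) (\<gamma> * (\<beta> * k)) = 1"
        by (intro tame_prod_steinberg nzf_mult nz \<gamma> assms)
      moreover have "tame_prod (\<gamma> * (\<alpha> * h)) (\<gamma> * (\<beta> * k)) = tame_prod h k"
        using nz \<gamma> assms by (simp add: tame_prod_mult_left tame_prod_mult_right nzf_mult tame_prod\<alpha> tame_prod\<beta> tame_prod\<gamma>)
      ultimately show ?thesis by simp
    next
      case True
      \<comment> \<open>Here h and k are proportional over K(x), and there is no Steinberg relation
        to use. The symbol reduces instead to those of (-1, k) and (k, k), which are trivial because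
        k has degree zero.\<close>
      then have "\<alpha> * h = - (\<beta> * k)" using eq by (simp add: eq_neg_iff_add_eq_0)
      then have eq': "\<alpha> * h = const_fun (- 1) * (\<beta> * k)" by simp
      have m: "nzf (const_fun (- 1))" by (rule nzf_const) simp
      have "tame_prod (\<alpha> * h) k = tame_prod h k" using nz assms by (simp add: tame_prod_mult_left tame_prod\<alpha>)
      moreover have "tame_prod (const_fun (- 1) * (\<beta> * k)) k = tame_prod (const_fun (- 1)) k * (tame_prod \<beta> k * tame_prod k k)"
        using tame_prod_mult_left[OF m nzf_mult[OF nz(2) assms(2)] assms(2)] tame_prod_mult_left[OF nz(2) assms(2,2)] by (simp only:)
      ultimately show ?thesis unfolding eq' 
        using tame_prod\<beta>(1)[OF assms(2)] tame_prod_self[OF assms(2)] tame_prod_const[OF _ assms(2), of "- 1"] by (simp del: const_fun_simps)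
    qed
  qed
qed

end

section \<open>Regular functions and reduced divisors\<close>

lemma dvd_if_order_le:
  fixes p q :: "'a::alg_closed_field poly"
  assumes "p \<noteq> 0" "q \<noteq> 0" "\<And>x. order x q \<le> order x p"
  shows "q dvd p"
proof -
  let ?Z = "{x. poly p x = 0} \<union> {x. poly q x = 0}"
  have Z: "finite ?Z" using poly_roots_finite assms by blast
  have "q dvd (\<Prod>x\<in>?Z. [:- x, 1:] ^ order x q)"
    by (subst (1) poly_factorization[OF Z assms(2)]) (use assms in \<open>auto simp: smult_dvd_iff\<close>)
  also have "\<dots> dvd (\<Prod>x\<in>?Z. [:- x, 1:] ^ order x p)"
    by (intro prod_dvd_prod le_imp_power_dvd assms)
  also have "\<dots> dvd smult (lead_coeff p) (\<Prod>x\<in>?Z. [:- x, 1:] ^ order x p)"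
    by (intro dvd_smult dvd_refl)
  also have "\<dots> = p" by (rule poly_factorization[OF Z assms(1), symmetric]) auto
  finally show ?thesis .
qed

context hyperelliptic
begin

section \<open>Functions without affine poles\<close>

definition regular :: "'k fun_field \<Rightarrow> bool" where
  "regular h \<longleftrightarrow> (\<forall>x y. Affine x y \<in> pts \<longrightarrow> (\<exists>v. has_value g f (Affine x y) h v))"

lemma regular_add: "regular h \<Longrightarrow> regular k \<Longrightarrow> regular (h + k)"
  unfolding regular_def using place.hv_add[OF place_at] by blast

lemma regular_mult: "regular h \<Longrightarrow> regular k \<Longrightarrow> regular (h * k)"
  unfolding regular_def using place.hv_mult[OF place_at] by blast

lemma regular_poly: "regular (E a + E b * yF)"
  unfolding regular_def using has_value_affine by blast

lemma regular_ord:
  assumes "nzf h" shows "regular h \<longleftrightarrow> (\<forall>x y. Affine x y \<in> pts \<longrightarrow> ordP (Affine x y) h \<ge> 0)"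
  unfolding regular_def using has_value_ord_nonneg[OF _ assms] ord_nonneg_has_value[OF _ assms] by metis

lemma regular_conj:
  assumes "cj.tw h h'" "regular h" shows "regular h'"
  unfolding regular_def
proof (intro allI impI)
  fix x y assume P: "Affine x y \<in> pts"
  then have "Affine x (- y) \<in> pts" using opposite_pts by force
  then obtain v where "has_value g f (Affine x (- y)) h v" using assms(2) unfolding regular_def by blast
  then have "has_value g f (cj.twp (Affine x (- y))) h' v" using cj.has_value_tw assms(1) by blast
  then show "\<exists>v. has_value g f (Affine x y) h' v" by auto
qed

lemma affine_above: obtains y where "Affine x y \<in> pts"
  by (rule fib_cases[of x]) auto

text \<open>At a point above x the orders of p and q are their orders at x, both multiplied by the
  same factor 1 or 2.\<close>

lemma regular_rational:
  assumes "q \<noteq> 0" "regular (E p / E q)" shows "q dvd p"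
proof (cases "p = 0")
  case False
  show ?thesis
  proof (rule dvd_if_order_le[OF False assms(1)])
    fix x
    obtain y where P: "Affine x y \<in> pts" by (rule affine_above)
    have n: "nzf (E p)" "nzf (E q)" using False assms nzf_E by auto
    have "ordP (Affine x y) (E p / E q) \<ge> 0"
      using assms(2) P unfolding regular_ord[OF nzf_divide[OF n]] by blast
    then have "ordP (Affine x y) (E p) \<ge> ordP (Affine x y) (E q)" using ordP_divide[OF P n] by simp
    then show "order x q \<le> order x p"
      using E_unramified[OF P _ False] E_unramified[OF P _ assms(1)] E_ramified[OF _ False, of x] E_ramified[OF _ assms(1), of x] P
      by (cases "y = 0") auto
  qed
qed simp

lemma order_fK: "order x fK \<le> 1"
proof (rule ccontr)
  assume "\<not> order x fK \<le> 1"
  then have "[:- x, 1:] ^ 2 dvd fK" using order_divides[of x 2 fK] by auto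
  then obtain \<psi> where "fK = [:- x, 1:] ^ 2 * \<psi>" by (rule dvdE)
  then have \<psi>: "fK = [:- x, 1:] * ([:- x, 1:] * \<psi>)" unfolding power2_eq_square mult.assoc .
  have "poly fK x = 0" unfolding \<psi> by simp
  moreover have "poly (pderiv fK) x = 0" unfolding \<psi> pderiv_mult by simp
  ultimately show False using smooth by blast
qed

text \<open>Since f is squarefree, 2 ord r <= 2 ord b + 1 at every point, and parity gives ord r <=
  ord b.\<close>

lemma square_dvd:
  assumes "r \<noteq> 0" "r * r dvd b * b * fK" shows "r dvd b"
proof (cases "b = 0")
  case False
  show ?thesis
  proof (rule dvd_if_order_le[OF False assms(1)])
    fix x
    have nz: "b * b * fK \<noteq> 0" "b * b \<noteq> 0" "r * r \<noteq> 0" using False fK_nz assms(1) by auto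
    have "order x (r * r) \<le> order x (b * b * fK)" by (rule dvd_imp_order_le[OF nz(1) assms(2)])
    then have "order x r + order x r \<le> order x b + order x b + order x fK"
      unfolding order_mult[OF nz(1)] order_mult[OF nz(2)] order_mult[OF nz(3)] .
    then show "order x r \<le> order x b" using order_fK[of x] by linarith
  qed
qed simp

text \<open>The coordinate ring is integrally closed. The trace 2a/r of h is regular and lies in
  K(x), so r divides a. Then b y / r is regular too, its square b^2 f / r^2 is a polynomial, and r
  divides b because f is squarefree.\<close>

theorem regular_imp_poly:
  assumes "h \<in> FF" "regular h"
  obtains a b where "h = E a + E b * yF"
proof -
  obtain a b r where r: "r \<noteq> 0" and h: "h = (E a + E b * yF) / E r" using FF_normal assms by blast
  have tw: "cj.tw h ((E a + E (- b) * yF) / E r)"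
    using cj.tw_divide[OF cj_tw[of a b] cj.tw_E[of r]] h by simp
  have "regular (h + (E a + E (- b) * yF) / E r)"
    by (intro regular_add assms regular_conj[OF tw])
  moreover have "h + (E a + E (- b) * yF) / E r = E (smult 2 a) / E r"
    unfolding h by (simp add: add_divide_distrib[symmetric] mult_2[symmetric])
      (metis const_fun_simps(2,3) one_add_one)
  ultimately have "r dvd smult 2 a" using regular_rational[OF r, of "smult 2 a"] by metis
  then have "r dvd a" using two_nz by (simp add: dvd_smult_iff)
  then obtain a' where a': "a = r * a'" by (auto elim: dvdE)
  have h': "h = E a' + E b * yF / E r" unfolding h a' using r by (simp add: add_divide_distrib)
  have "regular (h + (E (- a') + E 0 * yF))" by (intro regular_add regular_poly assms)
  moreover have "h + (E (- a') + E 0 * yF) = E b * yF / E r"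
    unfolding h' by simp
  ultimately have reg: "regular (E b * yF / E r)" by metis
  have "E b * yF / E r * (E b * yF / E r) = E (b * b * fK) / E (r * r)"
    by (simp add: y_fun_square[symmetric] mult_ac)
  then have "regular (E (b * b * fK) / E (r * r))" using regular_mult[OF reg reg] by (simp only:)
  then have "r * r dvd b * b * fK" by (rule regular_rational[rotated]) (use r in simp)
  then obtain b' where b': "b = r * b'" using square_dvd[OF r] by (auto elim: dvdE)
  have "h = E a' + E b' * yF" unfolding h' b' using r by simp
  then show ?thesis using that by blast
qed

text \<open>The degree of a^2 is even and that of b^2 f is odd, so the leading terms cannot
  cancel.\<close>

lemma degree_norm:
  assumes "b \<noteq> 0" shows "degree (a * a - b * b * fK) \<ge> 2 * g + 1"
proof -
  have d: "degree (b * b * fK) = 2 * degree b + 2 * g + 1"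
    using assms fK_nz by (simp add: degree_mult_eq degree_fK)
  have "even (degree (a * a))" by (cases "a = 0") (simp_all add: degree_mult_eq)
  moreover have "odd (degree (b * b * fK))" unfolding d by simp
  ultimately have ne: "degree (a * a) \<noteq> degree (b * b * fK)" by metis
  have "degree (b * b * fK) \<le> degree (a * a - b * b * fK)"
  proof (cases "degree (a * a) < degree (b * b * fK)")
    case True
    then show ?thesis using degree_add_eq_right[of "a * a" "- (b * b * fK)"] by simp
  next
    case False
    then have "degree (- (b * b * fK)) < degree (a * a)" using ne by simp
    from degree_add_eq_left[OF this] show ?thesis using False ne by simp
  qed
  then show ?thesis using d by simp
qed

text \<open>Such a function is a polynomial in x and y whose norm has degree 0, by its order at
  infinity. The degree bound 2g+1 excludes y, and then the polynomial in x has degree 0.\<close>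

theorem no_zeros_poles_const:
  assumes "nzf h" "\<And>P. P \<in> pts \<Longrightarrow> ordP P h = 0"
  obtains c where "c \<noteq> 0" "h = const_fun c"
proof -
  have "regular h" using regular_ord[OF assms(1)] assms(2) by simp
  then obtain a b where h: "h = E a + E b * yF" using regular_imp_poly assms(1) by blast
  have ab: "a \<noteq> 0 \<or> b \<noteq> 0" using h assms(1) by auto
  have "degree (a * a - b * b * fK) = 0"
    using norm_infinity(1)[OF ab] assms(2)[OF pts_Infinity] h by simp
  then have b: "b = 0" using degree_norm[of b a] by force
  then have "degree a = 0" 
    using \<open>degree (a * a - b * b * fK) = 0\<close> ab by (simp add: degree_mult_eq)
  then obtain c where "a = [:c:]" by (auto elim: degree_eq_zeroE)
  then show ?thesis using that[of c] h b ab by simp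
qed

text \<open>The vertical line through P, with divisor P + P' - 2 P_infinity. For P at infinity this
  divisor is zero, so the value 1 keeps the formula uniform.\<close>

definition lin :: "'k alg_closure point \<Rightarrow> 'k fun_field" where
  "lin P = (case P of Infinity \<Rightarrow> 1 | Affine x y \<Rightarrow> E [:- x, 1:])"

lemma nzf_lin: "nzf (lin P)"
  unfolding lin_def using nzf_E[of "[:- x, 1:]" for x] nzf_1 by (cases P) (auto simp del: pev_pCons)

lemma ordP_lin:
  assumes "P \<in> pts" "R \<in> pts"
  shows "ordP R (lin P) = of_bool (R = P) + of_bool (R = opposite P) - 2 * of_bool (R = Infinity)"
proof (cases P)
  case Infinity
  then show ?thesis using ordP_1[OF assms(2)] by (simp add: lin_def)
next
  case P: (Affine x y)
  show ?thesis
  proof (cases R)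
    case Infinity
    then show ?thesis using E_infinity[of "[:- x, 1:]"] P by (simp add: lin_def del: pev_pCons)
  next
    case R: (Affine x' y')
    show ?thesis
    proof (cases "x' = x")
      case False
      then show ?thesis using linear_at[of x' y' x] assms P R by (simp add: lin_def del: pev_pCons)
    next
      case True
      have "y ^ 2 = y' ^ 2" using assms P R True by (simp add: pts_affine power2_eq_square)
      then have y: "y' = y \<or> y' = - y" by (auto simp: power2_eq_iff)
      show ?thesis
      proof (cases "y' = 0")
        case True
        then show ?thesis using linear_ramified[of x] y assms P R \<open>x' = x\<close> 
          by (auto simp: lin_def simp del: pev_pCons)
      next
        case False
        have "y \<noteq> - y" 
        proof
          assume "y = - y"
          then have "2 * y = 0" unfolding eq_neg_iff_add_eq_0 mult_2 .
          then show False using False y two_nz by auto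
        qed
        moreover have "ordP R (lin P) = 1"
          using E_unramified[of x' y' "[:- x, 1:]"] assms P R False \<open>x' = x\<close> order_linear[of x] 
          by (simp add: lin_def del: pev_pCons)
        ultimately show ?thesis using P R y \<open>x' = x\<close> by auto
      qed
    qed
  qed
qed

section \<open>Uniqueness of semi-reduced representatives\<close>

definition mult_at :: "(nat \<Rightarrow> 'k alg_closure point) \<Rightarrow> 'k alg_closure point \<Rightarrow> int" where
  "mult_at A R = (\<Sum>i=1..g. of_bool (R = A i))"

lemma lookup_sum_frag: "Poly_Mapping.lookup (\<Sum>i\<in>I. frag_of (A i)) R = (\<Sum>i\<in>I. of_bool (R = A i))"
  by (induction I rule: infinite_finite_induct) (auto simp: lookup_add)

lemma lookup_rep_divisor: "Poly_Mapping.lookup (rep_divisor g A) R = mult_at A R - int g * of_bool (R = Infinity)"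
  unfolding rep_divisor_def mult_at_def by (simp add: lookup_minus lookup_sum_frag)

lemma opposite_opposite: "opposite (opposite R) = (R :: 'k alg_closure point)"
  by (cases R) auto

lemma mult_at_opposite: "(\<Sum>i=1..g. of_bool (R = opposite (A i))) = mult_at A (opposite R)"
proof -
  have "R = opposite Z \<longleftrightarrow> opposite R = Z" for Z :: "'k alg_closure point"
    using opposite_opposite[of R] opposite_opposite[of Z] by auto
  then show ?thesis unfolding mult_at_def by simp
qed

lemma mult_at_nonneg: "mult_at A R \<ge> 0"
  unfolding mult_at_def by (intro sum_nonneg) auto

lemma mult_at_pos: "mult_at A R \<noteq> 0 \<Longrightarrow> \<exists>i\<in>{1..g}. A i = R"
  unfolding mult_at_def using sum.neutral[of "{1..g}" "\<lambda>i. of_bool (R = A i) :: int"] by force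

lemma semi_reduced_opposite:
  assumes "semi_reduced g A" "R \<noteq> Infinity" "R \<noteq> opposite R"
  shows "mult_at A R = 0 \<or> mult_at A (opposite R) = 0"
proof (rule ccontr)
  assume "\<not> ?thesis"
  then obtain i j where "i \<in> {1..g}" "A i = R" "j \<in> {1..g}" "A j = opposite R" using mult_at_pos by meson
  then show False using assms unfolding semi_reduced_def by metis
qed

text \<open>A second occurrence of a branch point would be an occurrence of its opposite at another
  index.\<close>

lemma semi_reduced_self_opposite:
  assumes "semi_reduced g A" "R \<noteq> Infinity" "R = opposite R"
  shows "mult_at A R \<le> 1"
proof (cases "\<exists>i\<in>{1..g}. A i = R")
  case True
  then obtain i where i: "i \<in> {1..g}" "A i = R" by blast
  then have "A j \<noteq> R" if "j \<in> {1..g} - {i}" for j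
    using that assms unfolding semi_reduced_def by (metis DiffD1 DiffD2 singletonI)
  then have "(\<Sum>j\<in>{1..g} - {i}. of_bool (R = A j) :: int) = 0" by (intro sum.neutral) force
  then show ?thesis unfolding mult_at_def using sum.remove[of "{1..g}" i "\<lambda>i. of_bool (R = A i) :: int"] i by simp
next
  case False
  then have "mult_at A R = 0" using mult_at_pos by blast
  then show ?thesis by simp
qed

text \<open>
  Adding the vertical lines through the second family turns $A - B$ into $A + B' - 2 g P_\infty$.
  A function with this divisor has a pole of order at most $2g$ at infinity only, so it is a
  polynomial in $x$.
\<close>

theorem reduced_unique:
  assumes A: "\<And>i. i \<in> {1..g} \<Longrightarrow> A i \<in> pts" "semi_reduced g A"
    and B: "\<And>i. i \<in> {1..g} \<Longrightarrow> B i \<in> pts" "semi_reduced g B"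
    and w: "nzf w" "\<And>R. R \<in> pts \<Longrightarrow> ordP R w = Poly_Mapping.lookup (rep_divisor g A) R - Poly_Mapping.lookup (rep_divisor g B) R"
    and R: "R \<in> pts"
  shows "ordP R w = 0"
proof -
  have w': "ordP R w = mult_at A R - mult_at B R" if "R \<in> pts" for R
    using w(2)[OF that] by (simp add: lookup_rep_divisor)
  define v where "v = w * (\<Prod>i\<in>{1..g}. lin (B i))"
  have np: "nzf (\<Prod>i\<in>{1..g}. lin (B i))" by (intro nzf_prod nzf_lin)
  have nv: "nzf v" unfolding v_def by (intro nzf_mult np w)
  have ov: "ordP R v = mult_at A R + mult_at B (opposite R) - 2 * int g * of_bool (R = Infinity)" if R: "R \<in> pts" for R
  proof -
    have "ordP R (\<Prod>i\<in>{1..g}. lin (B i)) = (\<Sum>i\<in>{1..g}. ordP R (lin (B i)))"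
      by (intro ordP_prod R nzf_lin)
    also have "\<dots> = (\<Sum>i\<in>{1..g}. of_bool (R = B i) + of_bool (R = opposite (B i)) - 2 * of_bool (R = Infinity))"
      using ordP_lin[OF B(1) R] by (intro sum.cong) auto
    also have "\<dots> = mult_at B R + mult_at B (opposite R) - 2 * int g * of_bool (R = Infinity)"
      unfolding mult_at_opposite[symmetric] by (simp add: sum.distrib sum_subtractf mult_at_def)
    finally show ?thesis unfolding v_def ordP_mult[OF R w(1) np] w'[OF R] by simp
  qed
  have "regular v" unfolding regular_ord[OF nv] using ov mult_at_nonneg by simp
  then obtain a b where ab: "v = E a + E b * yF" using regular_imp_poly nv by blast
  have nz: "a \<noteq> 0 \<or> b \<noteq> 0" using ab nv by auto
  have "ordP Infinity v \<ge> - 2 * int g"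
    using ov[OF pts_Infinity] mult_at_nonneg[of A Infinity] mult_at_nonneg[of B Infinity] by simp
  then have "degree (a * a - b * b * fK) \<le> 2 * g" using norm_infinity(1)[OF nz] unfolding ab by simp
  then have b: "b = 0" using degree_norm[of b a] by force
  then have va: "v = E a" "a \<noteq> 0" using ab nz by auto
  have 0: "ordP R w = 0" if R: "R \<in> pts" "R \<noteq> Infinity" for R
  proof -
    obtain x y where xy: "R = Affine x y" using R by (cases R) auto
    note o = ov[OF R(1)] ov[OF opposite_pts[OF R(1)]]
    show ?thesis
    proof (cases "R = opposite R")
      case False
      then have y: "y \<noteq> 0" using xy by auto
      \<comment> \<open>A function of x has equal orders at opposite points. Each family contains at
        most one of the two points, so the resulting equation between nonnegative multiplicities
        leaves no difference at R.\<close>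
      have "ordP R v = ordP (opposite R) v"
        using E_unramified[of x y a] E_unramified[of x "- y" a] opposite_pts[OF R(1)] R(1) xy y va by simp
      then have eq: "mult_at A R + mult_at B (opposite R) = mult_at A (opposite R) + mult_at B R"
        using o xy by (simp add: opposite_opposite)
      show ?thesis 
        using w'[OF R(1)] eq semi_reduced_opposite[OF A(2) R(2) False] semi_reduced_opposite[OF B(2) R(2) False]
          mult_at_nonneg[of A R] mult_at_nonneg[of A "opposite R"] mult_at_nonneg[of B R] mult_at_nonneg[of B "opposite R"] by linarith
    next
      case True
      then have "y = - y" using xy by simp
      then have "2 * y = 0" unfolding eq_neg_iff_add_eq_0 mult_2 .
      then have "y = 0" using two_nz by simp
      \<comment> \<open>At a branch point a function of x has even order, and two multiplicities in
        {0, 1} with even sum agree.\<close>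
      then have "even (ordP R v)" using E_ramified[of x a] R xy va by simp
      then have "even (mult_at A R + mult_at B R)" using o(1) True R(2) by simp
      moreover have "mult_at A R \<le> 1" "mult_at B R \<le> 1" 
        using semi_reduced_self_opposite A(2) B(2) R(2) True by blast+
      ultimately show ?thesis using w'[OF R(1)] mult_at_nonneg[of A R] mult_at_nonneg[of B R] by presburger
    qed
  qed
  \<comment> \<open>The remaining order, at infinity, vanishes because the divisor has degree
    zero.\<close>
  have "supp w \<subseteq> {Infinity}" using 0 by (auto simp: supp_def)
  then have "(\<Sum>P\<in>{Infinity}. ordP P w) = (\<Sum>P\<in>supp w. ordP P w)"
    using sum_ordP_superset[of "{Infinity}" w] pts_Infinity by simp
  then have "ordP Infinity w = 0" using degree_principal[OF w(1)] by simp
  then show ?thesis using 0 R by (cases "R = Infinity") auto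
qed

end

section \<open>The Frobenius twist\<close>

lemma power_card_minus_1:
  fixes x :: "'k::{field,finite}"
  assumes "x \<noteq> 0" shows "x ^ (CARD('k) - 1) = 1"
proof -
  have "(\<Prod>y\<in>UNIV - {0}. x * y) = (\<Prod>y\<in>UNIV - {0}. y)"
    using assms by (intro prod.reindex_bij_witness[of _ "\<lambda>y. y / x" "\<lambda>y. x * y"]) auto
  then have "x ^ card (UNIV - {0 :: 'k}) * \<Prod>(UNIV - {0}) = 1 * \<Prod>(UNIV - {0})"
    by (simp add: prod.distrib)
  moreover have "\<Prod>(UNIV - {0 :: 'k}) \<noteq> 0" by simp
  ultimately show ?thesis by (simp add: card_Diff_singleton)
qed

lemma card_gt_1: "CARD('k::{field,finite}) > 1"
  using card_mono[of UNIV "{0, 1 :: 'k}"] by simp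

lemma power_card:
  fixes x :: "'k::{field,finite}"
  shows "x ^ CARD('k) = x"
  using power_card_minus_1[of x] card_gt_1[where 'k = 'k] 
  by (cases "x = 0") (auto simp: power_eq_if)

text \<open>
  The polynomial $(X + 1)^q - X^q - 1$ has degree less than $q$ and vanishes on the $q$ elements of
  the base field.
\<close>

lemma frobenius_add_1:
  fixes x :: "'k::{field,finite} alg_closure"
  shows "(x + 1) ^ CARD('k) = x ^ CARD('k) + 1"
proof -
  let ?q = "CARD('k)"
  define p :: "'k alg_closure poly" where "p = [:1, 1:] ^ ?q - monom 1 ?q - 1"
  have q: "?q > 1" by (rule card_gt_1)
  have "p = 0"
  proof (rule ccontr)
    assume p: "p \<noteq> 0"
    have d: "degree ([:1, 1 :: 'k alg_closure:] ^ ?q) = ?q" by (simp add: degree_power_eq)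
    have "coeff ([:1, 1 :: 'k alg_closure:] ^ ?q) ?q = 1"
      using lead_coeff_power[of "[:1, 1 :: 'k alg_closure:]" ?q] d by simp
    then have c: "coeff p ?q = 0" using q by (simp add: p_def)
    have "degree p \<le> ?q" unfolding p_def using q d
      by (intro degree_diff_le) (auto simp: degree_monom_eq)
    moreover have "degree p \<noteq> ?q" using c p by (metis leading_coeff_0_iff)
    ultimately have "degree p < ?q" by simp
    moreover have "range to_ac \<subseteq> {x. poly p x = 0}"
    proof
      fix y :: "'k alg_closure" assume "y \<in> range to_ac"
      then obtain c :: 'k where y: "y = to_ac c" by auto
      have "poly p y = to_ac ((c + 1) ^ ?q - c ^ ?q - 1)"
        unfolding p_def y by (simp add: poly_monom add.commute)
      then show "y \<in> {x. poly p x = 0}" by (simp add: power_card)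
    qed
    then have "card (range (to_ac :: 'k \<Rightarrow> _)) \<le> card {x. poly p x = 0}"
      by (intro card_mono poly_roots_finite p)
    ultimately show False using card_poly_roots_bound[OF p] card_image[OF inj_to_ac[where 'a = 'k]] by simp
  qed
  then have "poly p x = 0" by simp
  then show ?thesis unfolding p_def by (simp add: poly_monom add.commute algebra_simps)
qed

text \<open>Dividing by y reduces the claim to the sum of x / y and 1.\<close>

lemma frobenius_add:
  fixes x y :: "'k::{field,finite} alg_closure"
  shows "(x + y) ^ CARD('k) = x ^ CARD('k) + y ^ CARD('k)"
proof (cases "y = 0")
  case False
  then have "x + y = y * (x / y + 1)" by (simp add: field_simps)
  then have "(x + y) ^ CARD('k) = y ^ CARD('k) * ((x / y) ^ CARD('k) + 1)"
    by (simp only: power_mult_distrib frobenius_add_1)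
  then show ?thesis using False by (simp add: power_divide distrib_left)
qed (use card_gt_1[where 'k = 'k] in \<open>simp add: power_0_left\<close>)

context hyperelliptic
begin

section \<open>Frobenius on functions, points and divisors\<close>

lemma map_poly_frobenius_ac: "map_poly (\<lambda>x. x ^ CARD('k)) (ac_poly p) = ac_poly (p :: 'k poly)"
  using card_gt_1[where 'k = 'k] unfolding ac_poly_def 
  by (subst map_poly_map_poly) (auto simp: power_0_left o_def power_card simp flip: to_ac_power)

sublocale fr: twist g f "\<lambda>x. x ^ CARD('k)" 1
  by unfold_locales (auto simp: frobenius_add power_mult_distrib map_poly_frobenius_ac)

lemma fr_twp: "fr.twp P = frobenius P"
  by (cases P) auto

lemma frobenius_pts: "P \<in> pts \<Longrightarrow> frobenius P \<in> pts"
  using fr.twp_pts by (simp add: fr_twp)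

lemma inj_frobenius_field:
  fixes x y :: "'k alg_closure"
  assumes "x ^ CARD('k) = y ^ CARD('k)" shows "x = y"
proof -
  have "(x + - y) ^ CARD('k) = 0"
    using fr.\<tau>_uminus[of y] assms unfolding frobenius_add by simp
  then show ?thesis by simp
qed

lemma inj_frobenius: "inj (frobenius :: 'k alg_closure point \<Rightarrow> _)"
proof (rule injI)
  fix P Q :: "'k alg_closure point"
  assume "frobenius P = frobenius Q"
  then show "P = Q" using inj_frobenius_field by (cases P; cases Q) auto
qed

lemma surj_frobenius: "\<exists>P. Q = frobenius (P :: 'k alg_closure point)"
proof (cases Q)
  case Infinity
  then show ?thesis by (intro exI[of _ Infinity]) simp
next
  case (Affine x y)
  obtain x' where "x' ^ CARD('k) = x" using nth_root_exists[of "CARD('k)" x] card_gt_1[where 'k = 'k] by auto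
  moreover obtain y' where "y' ^ CARD('k) = y" using nth_root_exists[of "CARD('k)" y] card_gt_1[where 'k = 'k] by auto
  ultimately show ?thesis using Affine by (intro exI[of _ "Affine x' y'"]) simp
qed

lemma frobenius_pts_iff: "frobenius P \<in> pts \<longleftrightarrow> P \<in> pts"
proof
  assume "frobenius P \<in> pts"
  then show "P \<in> pts"
  proof (cases P)
    case (Affine x y)
    assume "frobenius P \<in> pts"
    then have "(y * y) ^ CARD('k) = poly fK (x ^ CARD('k))" 
      using Affine by (simp add: pts_affine power_mult_distrib)
    also have "\<dots> = poly fK x ^ CARD('k)" using fr.poly_mp[of fK x] by (simp add: fr.\<tau>_f)
    finally show ?thesis using inj_frobenius_field Affine by (simp add: pts_affine)
  qed (simp add: pts_Infinity)
qed (rule frobenius_pts)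

lemma frobenius_opposite: "frobenius (opposite P) = opposite (frobenius (P :: 'k alg_closure point))"
  using fr.\<tau>_uminus by (cases P) auto

abbreviation lk :: "'k divisor \<Rightarrow> 'k alg_closure point \<Rightarrow> int" where "lk \<equiv> Poly_Mapping.lookup"

lemma lookup_frobenius_divisor: "lk (frobenius_divisor e) (frobenius R) = lk e R"
proof -
  have s: "lk (\<Sum>i\<in>I. frag_cmul (n i) (frag_of (p i))) Q = (\<Sum>i\<in>I. n i * of_bool (Q = p i))" for I n Q and p :: "_ \<Rightarrow> 'k alg_closure point"
    by (induction I rule: infinite_finite_induct) (auto simp: lookup_add)
  have "lk (frobenius_divisor e) (frobenius R) = (\<Sum>i\<in>Poly_Mapping.keys e. lk e i * of_bool (frobenius R = frobenius i))"
    unfolding frobenius_divisor_def frag_extend_def by (rule s)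
  also have "\<dots> = (\<Sum>i\<in>Poly_Mapping.keys e. if i = R then lk e R else 0)"
    by (intro sum.cong refl) (auto dest: injD[OF inj_frobenius])
  also have "\<dots> = lk e R" by (simp add: sum.delta in_keys_iff)
  finally show ?thesis .
qed

lemma frobenius_divisor_fixed_iff: "frobenius_divisor e = e \<longleftrightarrow> (\<forall>R. lk e (frobenius R) = lk e R)"
proof
  assume "frobenius_divisor e = e"
  then show "\<forall>R. lk e (frobenius R) = lk e R" using lookup_frobenius_divisor[of e] by simp
next
  assume *: "\<forall>R. lk e (frobenius R) = lk e R"
  show "frobenius_divisor e = e"
  proof (rule poly_mapping_eqI)
    fix Q :: "'k alg_closure point"
    obtain R where "Q = frobenius R" using surj_frobenius by blast
    then show "lk (frobenius_divisor e) Q = lk e Q" using * lookup_frobenius_divisor by simp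
  qed
qed

lemma frobenius_rep_divisor: "frobenius_divisor (rep_divisor g A) = rep_divisor g (\<lambda>i. frobenius (A i))"
  unfolding rep_divisor_def frobenius_divisor_def frag_extend_diff frag_extend_cmul
  by (simp add: frag_extend_sum o_def)

section \<open>Products of leading coefficients along a divisor\<close>

text \<open>
  For a function without zeros or poles on the support of the divisor, the following is its value
  at the divisor. Otherwise it depends on the uniformizers, but it stays bilinear.
\<close>

definition lc_prod :: "'k fun_field \<Rightarrow> 'k divisor \<Rightarrow> 'k alg_closure" where
  "lc_prod h e = (\<Prod>R\<in>Poly_Mapping.keys e. lcP R h powi lk e R)"

definition on_curve :: "'k divisor \<Rightarrow> bool" where
  "on_curve e \<longleftrightarrow> Poly_Mapping.keys e \<subseteq> pts"

lemma lc_prod_superset: "finite S \<Longrightarrow> Poly_Mapping.keys e \<subseteq> S \<Longrightarrow> lc_prod h e = (\<Prod>R\<in>S. lcP R h powi lk e R)"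
  unfolding lc_prod_def by (intro prod.mono_neutral_left) (auto simp: in_keys_iff)

lemma divisor_degree_superset: 
  "finite S \<Longrightarrow> Poly_Mapping.keys e \<subseteq> S \<Longrightarrow> divisor_degree e = (\<Sum>R\<in>S. lk e R)"
  unfolding divisor_degree_def by (intro sum.mono_neutral_left) (auto simp: in_keys_iff)

lemma divisor_degree_add: "divisor_degree (e + e' :: 'k divisor) = divisor_degree e + divisor_degree e'"
proof -
  let ?S = "Poly_Mapping.keys e \<union> Poly_Mapping.keys e'"
  have "divisor_degree (e + e') = (\<Sum>R\<in>?S. lk (e + e') R)"
    using keys_add[of e e'] by (intro divisor_degree_superset) auto
  also have "\<dots> = (\<Sum>R\<in>?S. lk e R) + (\<Sum>R\<in>?S. lk e' R)" by (simp add: lookup_add sum.distrib)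
  also have "\<dots> = divisor_degree e + divisor_degree e'" by (simp add: divisor_degree_superset[of ?S])
  finally show ?thesis .
qed

lemma lc_prod_nz: "on_curve e \<Longrightarrow> nzf h \<Longrightarrow> lc_prod h e \<noteq> 0"
  unfolding lc_prod_def on_curve_def using lcP_nz by auto

lemma lc_prod_add:
  assumes "on_curve e" "on_curve e'" "nzf h" shows "lc_prod h (e + e') = lc_prod h e * lc_prod h e'"
proof -
  let ?S = "Poly_Mapping.keys e \<union> Poly_Mapping.keys e'"
  have "lc_prod h (e + e') = (\<Prod>R\<in>?S. lcP R h powi lk (e + e') R)"
    using keys_add[of e e'] by (intro lc_prod_superset) auto
  also have "\<dots> = (\<Prod>R\<in>?S. lcP R h powi lk e R * lcP R h powi lk e' R)"
    using assms lcP_nz by (intro prod.cong) (auto simp: lookup_add on_curve_def power_int_add)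
  also have "\<dots> = lc_prod h e * lc_prod h e'" by (simp add: prod.distrib lc_prod_superset[of ?S])
  finally show ?thesis .
qed

lemma lc_prod_mult: "on_curve e \<Longrightarrow> nzf h \<Longrightarrow> nzf k \<Longrightarrow> lc_prod (h * k) e = lc_prod h e * lc_prod k e"
  unfolding lc_prod_def on_curve_def prod.distrib[symmetric]
  by (intro prod.cong) (auto simp: lcP_mult power_int_mult_distrib)

lemma lc_prod_power: "on_curve e \<Longrightarrow> nzf h \<Longrightarrow> lc_prod (h ^ n) e = lc_prod h e ^ n"
  unfolding lc_prod_def on_curve_def prod_power_distrib
  by (intro prod.cong) (auto simp: lcP_power power_int_power power_int_power' mult.commute)

lemma lc_prod_const: "on_curve e \<Longrightarrow> c \<noteq> 0 \<Longrightarrow> divisor_degree e = 0 \<Longrightarrow> lc_prod (const_fun c) e = 1"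
proof -
  assume e: "on_curve e" "c \<noteq> 0" "divisor_degree e = 0"
  have "lc_prod (const_fun c) e = (\<Prod>R\<in>Poly_Mapping.keys e. c powi lk e R)"
    unfolding lc_prod_def using e by (intro prod.cong) (auto simp: lcP_const on_curve_def)
  also have "\<dots> = c powi divisor_degree e" unfolding divisor_degree_def using e by (simp add: powi_sum)
  finally show ?thesis using e by simp
qed

lemma eval_divisor_eq_T:
  assumes "on_curve e" "nzf h" "\<And>R. R \<in> Poly_Mapping.keys e \<Longrightarrow> ordP R h = 0"
  shows "eval_divisor g f h e = lc_prod h e"
  unfolding eval_divisor_def lc_prod_def using assms fun_val_eq 
  by (intro prod.cong) (auto simp: on_curve_def)

section \<open>Principal divisors and reciprocity for leading coefficients\<close>

definition is_div :: "'k fun_field \<Rightarrow> 'k divisor \<Rightarrow> bool" where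
  "is_div h d \<longleftrightarrow> nzf h \<and> on_curve d \<and> (\<forall>R\<in>pts. ordP R h = lk d R)"

lemma has_divisor_iff: "has_divisor g f h d \<longleftrightarrow> is_div h d"
  unfolding has_divisor_def is_div_def on_curve_def using ord_at_eq by auto

lemma is_div_supp: "is_div h d \<Longrightarrow> supp h = Poly_Mapping.keys d"
  unfolding is_div_def on_curve_def supp_def by (auto simp: in_keys_iff)

lemma is_div_degree:
  assumes "is_div h d" shows "divisor_degree d = 0"
proof -
  have "divisor_degree d = (\<Sum>P\<in>supp h. ordP P h)"
    unfolding divisor_degree_def is_div_supp[OF assms] using assms 
    by (intro sum.cong) (auto simp: is_div_def on_curve_def)
  then show ?thesis using degree_principal assms by (simp add: is_div_def)
qed

lemma is_div_ex:
  assumes "nzf h" obtains d where "is_div h d"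
proof -
  let ?F = "\<lambda>R. if R \<in> pts then ordP R h else 0"
  have fin: "finite {R. ?F R \<noteq> 0}" using finite_supp[OF assms] unfolding supp_def by (rule rev_finite_subset) auto
  have lk: "lk (Abs_poly_mapping ?F) R = ?F R" for R by (simp only: lookup_Abs_poly_mapping[OF fin])
  then have "on_curve (Abs_poly_mapping ?F)" unfolding on_curve_def
    by (metis (no_types, lifting) in_keys_iff subsetI)
  then show ?thesis using that[of "Abs_poly_mapping ?F"] assms lk by (simp only: is_div_def) simp
qed

lemma is_div_mult: "is_div h d \<Longrightarrow> is_div k e \<Longrightarrow> is_div (h * k) (d + e)"
  unfolding is_div_def on_curve_def using keys_add[of d e] nzf_mult
  by (auto simp: lookup_add ordP_mult)

lemma is_div_inverse: "is_div h d \<Longrightarrow> is_div (inverse h) (- d)"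
  unfolding is_div_def on_curve_def using nzf_inverse by (auto simp: ordP_inverse)

lemma is_div_divide: "is_div h d \<Longrightarrow> is_div k e \<Longrightarrow> is_div (h / k) (d - e)"
  using is_div_mult[OF _ is_div_inverse, of h d k e] by (simp add: divide_inverse)

lemma is_div_power: 
  assumes "is_div h d" shows "is_div (h ^ n) (frag_cmul (int n) d)"
  using assms nzf_power[of h n] keys_cmul[of "int n" d] unfolding is_div_def on_curve_def by (auto simp: ordP_power)

lemma is_div_unique:
  assumes "is_div h d" "is_div h' d" obtains c where "c \<noteq> 0" "h' = const_fun c * h"
proof -
  have n: "nzf h" "nzf h'" using assms by (auto simp: is_div_def)
  have "ordP P (h' / h) = 0" if "P \<in> pts" for P
    using ordP_divide[OF that n(2,1)] assms that by (simp add: is_div_def)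
  then obtain c where "c \<noteq> 0" "h' / h = const_fun c" using no_zeros_poles_const[OF nzf_divide[OF n(2,1)]] by metis
  then show ?thesis using that[of c] n by (simp add: field_simps)
qed

text \<open>
  The Frobenius twist of \<open>w\<close> has the same divisor as \<open>w\<close>, hence is a constant multiple of it, and
  the constant disappears on divisors of degree zero.
\<close>

lemma lc_prod_rational:
  assumes w: "is_div w dw" "frobenius_divisor dw = dw"
    and e: "on_curve e" "frobenius_divisor e = e" "divisor_degree e = 0"
  shows "lc_prod w e ^ (CARD('k) - 1) = 1"
proof -
  have n: "nzf w" using w by (simp add: is_div_def)
  obtain w' where w': "fr.tw w w'" using fr.tw_ex n by blast
  have n': "nzf w'" using fr.tw_FF[OF w'] fr.tw_nz[OF w'] n by blast
  have tw: "ordP (frobenius P) w' = ordP P w \<and> lcP (frobenius P) w' = lcP P w ^ CARD('k)" if "P \<in> pts" for P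
  proof -
    have "fr.sgP P = 1" by (simp add: fr.sgP_def split: point.split)
    then show ?thesis using fr.twist_ord_lc[OF that n w'] by (simp add: fr_twp)
  qed
  have "is_div w' dw" unfolding is_div_def
  proof (intro conjI ballI)
    fix Q assume Q: "Q \<in> pts"
    obtain P where P: "Q = frobenius P" using surj_frobenius by blast
    then have "P \<in> pts" using Q frobenius_pts_iff by simp
    then show "ordP Q w' = lk dw Q" using tw w P frobenius_divisor_fixed_iff[of dw] by (simp add: is_div_def)
  qed (use n' w in \<open>auto simp: is_div_def\<close>)
  then obtain c where c: "c \<noteq> 0" "w' = const_fun c * w" using is_div_unique w(1) by blast
  have fe: "lk e (frobenius R) = lk e R" for R using e(2) frobenius_divisor_fixed_iff by blast
  then have sub: "frobenius ` Poly_Mapping.keys e \<subseteq> Poly_Mapping.keys e" by (auto simp: in_keys_iff)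
  then have bij: "frobenius ` Poly_Mapping.keys e = Poly_Mapping.keys e"
    by (intro card_subset_eq) (auto simp: card_image inj_on_subset[OF inj_frobenius])
  have "lc_prod w e ^ CARD('k) = (\<Prod>R\<in>Poly_Mapping.keys e. lcP (frobenius R) w' powi lk e (frobenius R))"
    unfolding lc_prod_def prod_power_distrib using e(1) tw 
    by (intro prod.cong) (auto simp: on_curve_def fe power_int_power power_int_power' mult.commute)
  also have "\<dots> = (\<Prod>R\<in>frobenius ` Poly_Mapping.keys e. lcP R w' powi lk e R)"
    by (rule prod.reindex[symmetric, unfolded o_def]) (rule inj_on_subset[OF inj_frobenius], simp)
  also have "\<dots> = lc_prod w' e" unfolding bij lc_prod_def ..
  also have "\<dots> = lc_prod w e" unfolding c(2) using lc_prod_mult[OF e(1) nzf_const[OF c(1)] n] lc_prod_const[OF e(1) c(1) e(3)] by simp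
  finally have "lc_prod w e * lc_prod w e ^ (CARD('k) - 1) = lc_prod w e * 1" 
    using card_gt_1[where 'k = 'k] by (simp flip: power_Suc)
  then show ?thesis using lc_prod_nz[OF e(1) n] by simp
qed

text \<open>Weil reciprocity with the symbols multiplied out. Nothing is assumed about the supports;
  points common to both account for the sign.\<close>

lemma lc_prod_reciprocity:
  assumes h: "is_div h dh" and w: "is_div w dw"
  shows "lc_prod h dw = (- 1) powi (\<Sum>R\<in>supp h \<union> supp w. ordP R h * ordP R w) * lc_prod w dh"
proof -
  have n: "nzf h" "nzf w" using h w by (auto simp: is_div_def)
  let ?S = "supp h \<union> supp w"
  have S: "finite ?S" "?S \<subseteq> pts" using finite_supp n by (auto simp: supp_def)
  have "1 = (\<Prod>R\<in>?S. (- 1) powi (ordP R h * ordP R w) * lcP R h powi ordP R w / lcP R w powi ordP R h)"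
    using weil_reciprocity[OF n] by (simp add: tame_prod_def tame_at_eq)
  also have "\<dots> = (\<Prod>R\<in>?S. (- 1) powi (ordP R h * ordP R w)) * (\<Prod>R\<in>?S. lcP R h powi lk dw R) / (\<Prod>R\<in>?S. lcP R w powi lk dh R)"
    unfolding prod.distrib[symmetric] prod_dividef[symmetric] using S h w 
    by (intro prod.cong) (auto simp: is_div_def)
  also have "(\<Prod>R\<in>?S. lcP R h powi lk dw R) = lc_prod h dw"
    using is_div_supp[OF w] S by (intro lc_prod_superset[symmetric]) auto
  also have "(\<Prod>R\<in>?S. lcP R w powi lk dh R) = lc_prod w dh"
    using is_div_supp[OF h] S by (intro lc_prod_superset[symmetric]) auto
  also have "(\<Prod>R\<in>?S. (- 1) powi (ordP R h * ordP R w)) = (- 1 :: 'k alg_closure) powi (\<Sum>R\<in>?S. ordP R h * ordP R w)"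
    by (simp add: powi_sum)
  finally have eq: "1 = (- 1) powi (\<Sum>R\<in>?S. ordP R h * ordP R w) * lc_prod h dw / lc_prod w dh" .
  have nz: "lc_prod w dh \<noteq> 0" using lc_prod_nz n h by (auto simp: is_div_def)
  have sq: "(- 1 :: 'k alg_closure) powi k * (- 1) powi k = 1" for k
    by (simp add: power_int_minus_left)
  have "(- 1) powi (\<Sum>R\<in>?S. ordP R h * ordP R w) * lc_prod w dh = 
     (- 1) powi (\<Sum>R\<in>?S. ordP R h * ordP R w) * ((- 1) powi (\<Sum>R\<in>?S. ordP R h * ordP R w) * lc_prod h dw)"
    using eq nz by (simp add: field_simps)
  then show ?thesis using sq by (simp flip: mult.assoc)
qed

lemma minus_one_power_card: "(- 1 :: 'k alg_closure) ^ (CARD('k) - 1) = 1"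
proof -
  have "(- 1 :: 'k alg_closure) ^ (CARD('k) - 1) = to_ac ((- 1) ^ (CARD('k) - 1))" by simp
  also have "\<dots> = to_ac 1" by (subst power_card_minus_1) auto
  finally show ?thesis by simp
qed

text \<open>Reciprocity replaces h at the divisor of w by w at m d, which is the m-th power of
  \<open>lc_prod w d\<close>. The exponent k completes it to a (q-1)-th power, to which
  \<open>lc_prod_rational\<close> applies. The exponent of the sign contains the factor m as well,
  because the orders of h are m times the coefficients of d, so the sign becomes a power of
  (-1)^(q-1) = 1.\<close>

lemma lc_prod_principal_eq_1:
  assumes m: "m * k = CARD('k) - 1"
    and h: "is_div h (frag_cmul (int m) d)" 
    and d: "on_curve d" "frobenius_divisor d = d" "divisor_degree d = 0"
    and w: "is_div w dw" "frobenius_divisor dw = dw"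
  shows "lc_prod h dw ^ k = 1"
proof -
  have n: "nzf w" using w by (simp add: is_div_def)
  let ?S = "supp h \<union> supp w"
  have dm: "lc_prod w (frag_cmul (int m) d) = lc_prod w d ^ m"
  proof -
    have "lc_prod w (frag_cmul (int m) d) = (\<Prod>R\<in>Poly_Mapping.keys d. lcP R w powi lk (frag_cmul (int m) d) R)"
      using keys_cmul by (intro lc_prod_superset) auto
    then show ?thesis unfolding lc_prod_def prod_power_distrib 
      by (simp add: power_int_power' mult.commute)
  qed
  have "(\<Sum>R\<in>?S. ordP R h * ordP R w) = int m * (\<Sum>R\<in>?S. lk d R * ordP R w)"
    unfolding sum_distrib_left using h by (intro sum.cong) (auto simp: is_div_def supp_def)
  then have "lc_prod h dw ^ k = ((- 1) powi (int m * (\<Sum>R\<in>?S. lk d R * ordP R w))) ^ k * lc_prod w d ^ (m * k)"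
    unfolding lc_prod_reciprocity[OF h w(1)] dm by (simp add: power_mult_distrib power_mult)
  also have "((- 1 :: 'k alg_closure) powi (int m * (\<Sum>R\<in>?S. lk d R * ordP R w))) ^ k = 
      ((- 1) ^ (m * k)) powi (\<Sum>R\<in>?S. lk d R * ordP R w)"
    unfolding power_int_power power_int_power' by (simp add: mult_ac)
  also have "\<dots> = 1" unfolding m minus_one_power_card by simp
  also have "lc_prod w d ^ (m * k) = 1" unfolding m by (rule lc_prod_rational[OF w d])
  finally show ?thesis by simp
qed

text \<open>Replacing d by d' multiplies h by a constant and by the m-th power of w. The constant
  has no effect on divisors of degree zero, and the m-th power becomes a (q-1)-th power at a
  rational divisor. Replacing e by e' changes the value by h at a rational principal divisor, which
  is the preceding lemma.\<close>

lemma lc_prod_independent: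
  assumes m: "m * k = CARD('k) - 1"
    and h: "is_div h (frag_cmul (int m) d)" and h': "is_div h' (frag_cmul (int m) d')"
    and d: "on_curve d" "frobenius_divisor d = d" "divisor_degree d = 0"
    and d': "frobenius_divisor d' = d'" 
    and e: "on_curve e" "frobenius_divisor e = e" "divisor_degree e = 0"
    and e': "frobenius_divisor e' = e'" 
    and w: "is_div w (d' - d)" and u: "is_div u (e' - e)"
  shows "lc_prod h' e' ^ k = lc_prod h e ^ k"
proof -
  have n: "nzf h" "nzf h'" "nzf w" "nzf u" using h h' w u by (auto simp: is_div_def)
  have fw: "frobenius_divisor (d' - d) = d' - d" and fu: "frobenius_divisor (e' - e) = e' - e"
    using d d' e e' unfolding frobenius_divisor_def frag_extend_diff by simp_all
  have "frag_cmul (int m) d + frag_cmul (int m) (d' - d) = frag_cmul (int m) d'"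
    by (rule poly_mapping_eqI) (simp add: lookup_add lookup_minus algebra_simps)
  then have "is_div (h * w ^ m) (frag_cmul (int m) d')"
    using is_div_mult[OF h is_div_power[OF w, of m]] by simp
  then obtain c where c: "c \<noteq> 0" "h' = const_fun c * (h * w ^ m)" using is_div_unique h' by blast
  have ee: "e' = e + (e' - e)" by simp
  have oe: "on_curve (e' - e)" using u by (simp add: is_div_def)
  have oe': "on_curve e'" using keys_add[of e "e' - e"] e(1) oe by (auto simp: on_curve_def)
  have de': "divisor_degree e' = 0" using divisor_degree_add[of e "e' - e"] is_div_degree[OF u] e(3) by simp
  have "lc_prod h' e' = lc_prod h e' * lc_prod w e' ^ m"
    unfolding c(2) using n oe' c(1) de' 
    by (simp add: lc_prod_mult lc_prod_const lc_prod_power nzf_mult nzf_power nzf_const)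
  then have "lc_prod h' e' ^ k = lc_prod h e' ^ k * lc_prod w e' ^ (m * k)"
    by (simp add: power_mult_distrib power_mult)
  also have "lc_prod w e' ^ (m * k) = 1" unfolding m by (rule lc_prod_rational[OF w fw oe' e' de'])
  also have "lc_prod h e' = lc_prod h e * lc_prod h (e' - e)"
    by (subst (1) ee) (rule lc_prod_add[OF e(1) oe n(1)])
  also have "(lc_prod h e * lc_prod h (e' - e)) ^ k * 1 = lc_prod h e ^ k"
    using lc_prod_principal_eq_1[OF m h d u fu] by (simp add: power_mult_distrib)
  finally show ?thesis .
qed

end

section \<open>Divisor classes and the pairing\<close>

text \<open>The order of z divides q - 1, so the exponent (q-1)/m is an exact quotient.\<close>

lemma primitive_root_dvd:
  fixes z :: "'k::{field,finite}"
  assumes "m > 0" "primitive_root_of_unity m z"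
  shows "m dvd CARD('k) - 1"
proof -
  have z: "z ^ m = 1" "\<And>k. 0 < k \<Longrightarrow> k < m \<Longrightarrow> z ^ k \<noteq> 1"
    using assms(2) unfolding primitive_root_of_unity_def by auto
  have "z \<noteq> 0" using z(1) assms(1) by (auto simp: power_0_left)
  let ?n = "CARD('k) - 1"
  have "z ^ ?n = z ^ (m * (?n div m) + ?n mod m)" by simp
  also have "\<dots> = z ^ (?n mod m)" unfolding power_add power_mult z(1) by simp
  finally have "z ^ (?n mod m) = 1" using power_card_minus_1[OF \<open>z \<noteq> 0\<close>] by simp
  then have "?n mod m = 0" using z(2)[of "?n mod m"] assms(1) by fastforce
  then show ?thesis by (simp add: dvd_eq_mod_eq_0)
qed

lemma ac_poly_mult: "ac_poly (p * q) = ac_poly p * ac_poly q"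
  by (rule poly_eqI) (simp add: ac_poly_def coeff_map_poly coeff_mult to_ac_sum)

lemma degree_ac_poly: "degree (ac_poly p) = degree p"
  unfolding ac_poly_def by (rule degree_map_poly) simp

text \<open>Each element is algebraic over the base field, and annihilating polynomials can be
  multiplied. Coefficients in the base field are what makes the moving function invariant under
  Frobenius.\<close>

lemma common_base_polynomial:
  fixes S :: "'k::field alg_closure set"
  assumes "finite S"
  shows "\<exists>a :: 'k poly. degree a > 0 \<and> (\<forall>x\<in>S. poly (ac_poly a) x = 0)"
  using assms
proof induction
  case empty
  \<comment> \<open>Starting from X keeps the degree positive even when there are no points.\<close>
  show ?case by (intro exI[of _ "[:0, 1:]"]) simp
next
  case (insert x S)
  then obtain a :: "'k poly" where a: "degree a > 0" "\<forall>x\<in>S. poly (ac_poly a) x = 0" by blast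
  obtain p :: "'k poly" where p: "p \<noteq> 0" "poly (ac_poly p) x = 0"
    using alg_closure_algebraic[of x] unfolding ac_poly_def by blast
  have "degree (p * a) = degree p + degree a" using p a by (intro degree_mult_eq) auto
  then show ?case using a p by (intro exI[of _ "p * a"]) (auto simp: ac_poly_mult)
qed

context hyperelliptic
begin

text \<open>
  If \<open>a\<close> vanishes at the abscissas of the points and has degree \<open>n > 0\<close>, then $1 + a y$
  and $1 + a$, $1 + x a$ have value 1 there, and their orders at infinity are $-(2n + 2g + 1)$,
  $-2n$, $-2n - 2$.
\<close>

lemma moving_function:
  assumes "finite S" "S \<subseteq> pts - {Infinity}"
  obtains u du where "is_div u du" "frobenius_divisor du = du" "ordP Infinity u = int g"
    "\<And>R. R \<in> S \<Longrightarrow> ordP R u = 0"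
proof -
  let ?abs = "\<lambda>P. case P of Affine x y \<Rightarrow> x | Infinity \<Rightarrow> 0"
  obtain a :: "'k poly" where a: "degree a > 0" "\<forall>x\<in>?abs ` S. poly (ac_poly a) x = 0"
    using common_base_polynomial[of "?abs ` S"] assms(1) by auto
  define A where "A = ac_poly a"
  define n where "n = degree A"
  have n: "n > 0" using a by (simp add: n_def A_def degree_ac_poly)
  then have A0: "A \<noteq> 0" unfolding n_def by auto
  define u1 where "u1 = E 1 + E A * yF"
  define b where "b = E (1 + A)"
  define b' where "b' = E (1 + [:0, 1:] * A)"
  have dA: "degree (1 + A) = n" "degree (1 + [:0, 1:] * A) = n + 1"
  proof -
    show "degree (1 + A) = n" unfolding n_def using n by (intro degree_add_eq_right) (simp add: n_def)
    have d: "degree ([:0, 1:] * A) = n + 1" using A0 by (simp add: n_def)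
    then show "degree (1 + [:0, 1:] * A) = n + 1" by (subst degree_add_eq_right) simp_all
  qed
  have "degree (A * A * fK) = 2 * n + 2 * g + 1"
    using A0 fK_nz by (simp add: degree_mult_eq degree_fK n_def)
  then have d1: "degree (1 * 1 - A * A * fK) = 2 * n + 2 * g + 1"
    using degree_add_eq_right[of 1 "- (A * A * fK)"] by simp
  have nz: "nzf u1" "nzf b" "nzf b'"
    unfolding u1_def b_def b'_def using dA n by (intro nzf_pev nzf_E; force)+
  \<comment> \<open>At infinity u1 has a pole of order 2n+2g+1 and b / b' has a zero of order 2, so
    the exponent n+g+1 leaves a simple zero; the outer power raises its order to g.\<close>
  define u where "u = (u1 * (b / b') ^ (n + g + 1)) ^ g"
  have nbb: "nzf (b / b')" "nzf ((b / b') ^ (n + g + 1))" by (intro nzf_divide nzf_power nz)+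
  have nu1: "nzf (u1 * (b / b') ^ (n + g + 1))" by (intro nzf_mult nbb nz)
  have nu: "nzf u" unfolding u_def by (intro nzf_power nu1)
  have ordu: "ordP P u = int g * (ordP P u1 + int (n + g + 1) * (ordP P b - ordP P b'))" if "P \<in> pts" for P
    unfolding u_def ordP_power[OF that nu1] ordP_mult[OF that nz(1) nbb(2)] ordP_power[OF that nbb(1)]
      ordP_divide[OF that nz(2,3)] ..
  have o1: "ordP Infinity u1 = - int (2 * n + 2 * g + 1)"
    unfolding u1_def using norm_infinity(1)[of 1 A] unfolding d1 by simp
  have o2: "ordP Infinity b = - 2 * int n" "ordP Infinity b' = - 2 * int (n + 1)"
    unfolding b_def b'_def using E_infinity[of "1 + A"] E_infinity[of "1 + [:0, 1:] * A"] dA n by fastforce+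
  have "ordP Infinity u1 + int (n + g + 1) * (ordP Infinity b - ordP Infinity b') = 1"
    unfolding o1 o2 by (simp add: algebra_simps)
  then have inf: "ordP Infinity u = int g"
    unfolding ordu[OF pts_Infinity] by simp
  have S: "ordP R u = 0" if R: "R \<in> S" for R
  proof -
    obtain x y where xy: "R = Affine x y" using R assms by (cases R) auto
    have P: "Affine x y \<in> pts" using R assms xy by auto
    have "poly A x = 0" using a(2) R xy unfolding A_def by force
    then have "has_value g f (Affine x y) u1 1" "has_value g f (Affine x y) b 1" "has_value g f (Affine x y) b' 1"
      using has_value_affine[OF P, of 1 A] has_value_affine[OF P, of "1 + A" 0] has_value_affine[OF P, of "1 + [:0, 1:] * A" 0]
      unfolding u1_def b_def b'_def by simp_all
    then have "ordP R u1 = 0" "ordP R b = 0" "ordP R b' = 0"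
      using decP_eq[OF P decP_value[OF P]] xy by simp_all
    then show ?thesis using ordu P xy by simp
  qed
  have mpA: "fr.mp A = A" unfolding A_def by (rule map_poly_frobenius_ac)
  have mp1: "fr.mp 1 = 1" "fr.mp [:0, 1:] = [:0, 1:]" 
    by (simp_all add: fr.mp_pCons one_pCons fr.\<tau>_0)
  have yt: "fr.yt = yF" by (simp add: fr.yt_def)
  have "fr.tw u1 u1" unfolding u1_def using fr.tw_E[of 1] fr.tw_E[of A] fr.tw_Y 
    by (intro fr.tw_add fr.tw_mult) (simp_all add: mpA mp1 yt del: pev_1)
  moreover have "fr.tw b b" unfolding b_def using fr.tw_E[of "1 + A"] unfolding fr.mp_add mpA mp1 .
  moreover have "fr.tw b' b'" unfolding b'_def using fr.tw_E[of "1 + [:0, 1:] * A"] unfolding fr.mp_add fr.mp_mult mpA mp1 .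
  ultimately have tw: "fr.tw u u" unfolding u_def by (intro fr.tw_power fr.tw_mult fr.tw_divide)
  obtain du where du: "is_div u du" using is_div_ex nu by blast
  have "lk du (frobenius R) = lk du R" for R
  proof (cases "R \<in> pts")
    case True
    then have "ordP (frobenius R) u = ordP R u" using fr.twist_ord_lc[OF True nu tw] by (simp add: fr_twp)
    then show ?thesis using du True frobenius_pts by (simp add: is_div_def)
  next
    case False
    then have "R \<notin> Poly_Mapping.keys du" "frobenius R \<notin> Poly_Mapping.keys du" 
      using du frobenius_pts_iff unfolding is_div_def on_curve_def by auto
    then show ?thesis by (simp add: in_keys_iff)
  qed
  then have "frobenius_divisor du = du" using frobenius_divisor_fixed_iff by blast
  then show ?thesis using that du inf S by blast
qed

section \<open>Divisors in a fixed class\<close>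

lemma jacobian_class:
  assumes "D \<in> carrier (jacobian g f)"
  obtains a where "on_curve a" "divisor_degree a = 0" "D = {p + a | p. \<exists>h. is_div h p}"
proof -
  have "\<exists>a. on_curve a \<and> divisor_degree a = 0 \<and> D = {p + a | p. \<exists>h. is_div h p}"
    using assms unfolding jacobian_def FactGroup_def RCOSETS_def r_coset_def divisors0_def
      principal_divisors_def has_divisor_iff on_curve_def by auto
  then show ?thesis using that by blast
qed

lemma class_on_curve:
  assumes "D \<in> carrier (jacobian g f)" "d \<in> D"
  shows "on_curve d" "divisor_degree d = 0"
proof -
  obtain a where a: "on_curve a" "divisor_degree a = 0" "D = {p + a | p. \<exists>h. is_div h p}"
    using assms(1) by (rule jacobian_class)
  obtain p h where p: "d = p + a" "is_div h p" using assms(2) a by blast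
  show "on_curve d" using keys_add[of p a] a p by (auto simp: on_curve_def is_div_def)
  show "divisor_degree d = 0" using divisor_degree_add[of p a] a p is_div_degree by simp
qed

lemma class_diff:
  assumes "D \<in> carrier (jacobian g f)" "d \<in> D" "d' \<in> D"
  obtains w where "is_div w (d' - d)"
proof -
  obtain a where a: "on_curve a" "divisor_degree a = 0" "D = {p + a | p. \<exists>h. is_div h p}"
    using assms(1) by (rule jacobian_class)
  obtain p h p' h' where p: "d = p + a" "is_div h p" "d' = p' + a" "is_div h' p'" using assms(2,3) a by blast
  then show ?thesis using that is_div_divide[OF p(4,2)] by simp
qed

lemma class_add:
  assumes "D \<in> carrier (jacobian g f)" "d \<in> D" "is_div u du"
  shows "d + du \<in> D"
proof -
  obtain a where a: "on_curve a" "divisor_degree a = 0" "D = {p + a | p. \<exists>h. is_div h p}"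
    using assms(1) by (rule jacobian_class)
  obtain p h where p: "d = p + a" "is_div h p" using assms(2) a by blast
  have "d + du = (p + du) + a" unfolding p(1) by (simp add: ac_simps)
  moreover have "is_div (h * u) (p + du)" by (rule is_div_mult[OF p(2) assms(3)])
  ultimately show ?thesis unfolding a(3) by blast
qed

lemma divisor_eqI:
  assumes "on_curve d" "on_curve d'" "\<And>R. R \<in> pts \<Longrightarrow> lk d R = lk d' R"
  shows "d = d'"
proof (rule poly_mapping_eqI)
  fix R show "lk d R = lk d' R"
  proof (cases "R \<in> pts")
    case False
    then have "R \<notin> Poly_Mapping.keys d" "R \<notin> Poly_Mapping.keys d'" using assms by (auto simp: on_curve_def)
    then show ?thesis by (simp add: in_keys_iff)
  qed (rule assms(3))
qed

lemma reduced_rational: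
  assumes D: "D \<in> rational_jacobian g f" "rep_divisor g A \<in> D"
    and A: "\<And>i. i \<in> {1..g} \<Longrightarrow> A i \<in> pts" "semi_reduced g A"
  shows "frobenius_divisor (rep_divisor g A) = rep_divisor g A"
proof -
  have c: "D \<in> carrier (jacobian g f)" and F: "frobenius_divisor ` D = D" 
    using D unfolding rational_jacobian_def by auto
  let ?B = "\<lambda>i. frobenius (A i)"
  have B: "rep_divisor g ?B \<in> D" using F D(2) unfolding frobenius_rep_divisor[symmetric] by blast
  have B1: "?B i \<in> pts" if "i \<in> {1..g}" for i using A(1)[OF that] by (rule frobenius_pts)
  have B2: "semi_reduced g ?B" unfolding semi_reduced_def
  proof (intro ballI impI)
    fix i j assume ij: "i \<in> {1..g}" "j \<in> {1..g}" "i \<noteq> j" "frobenius (A i) \<noteq> Infinity"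
    then have "A i \<noteq> Infinity" by auto
    then have "A j \<noteq> opposite (A i)" using A(2) ij unfolding semi_reduced_def by blast
    then show "frobenius (A j) \<noteq> opposite (frobenius (A i))"
      unfolding frobenius_opposite[symmetric] using injD[OF inj_frobenius] by blast
  qed
  obtain w where w: "is_div w (rep_divisor g A - rep_divisor g ?B)" using class_diff[OF c B D(2)] by blast
  have "rep_divisor g A = rep_divisor g ?B"
  proof (rule divisor_eqI)
    fix R assume R: "R \<in> pts"
    have "ordP R w = 0" 
      by (rule reduced_unique[OF A(1) A(2) B1 B2 _ _ R]) (use w in \<open>auto simp: is_div_def lookup_minus\<close>)
    then show "lk (rep_divisor g A) R = lk (rep_divisor g ?B) R" using w R by (simp add: is_div_def lookup_minus)
  qed (use class_on_curve[OF c] B D in auto)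
  then show ?thesis unfolding frobenius_rep_divisor by (rule sym)
qed

section \<open>Comparison of the two pairings\<close>

theorem v_pairing_eq_tate_pairing_square:
  fixes m :: nat and D D' :: "'k divisor set" and P Q :: "nat \<Rightarrow> 'k alg_closure point" and h :: "'k fun_field"
  assumes m: "m > 0" "\<exists>z::'k. primitive_root_of_unity m z"
    and D: "D \<in> rational_jacobian g f" and D': "D' \<in> rational_jacobian g f"
    and P: "\<And>i. i \<in> {1..g} \<Longrightarrow> P i \<in> pts"
    and Q: "\<And>j. j \<in> {1..g} \<Longrightarrow> Q j \<in> pts - {Infinity}"
    and red: "semi_reduced g P" "semi_reduced g Q"
    and rep: "rep_divisor g P \<in> D" "rep_divisor g Q \<in> D'"
    and dist: "\<And>i j. i \<in> {1..g} \<Longrightarrow> j \<in> {1..g} \<Longrightarrow> P i \<noteq> Q j \<and> P i \<noteq> opposite (Q j)"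
    and h: "has_divisor g f h (frag_cmul (int m) (rep_divisor g P))"
  shows "v_pairing g f m h Q = tate_pairing g f m D D' ^ 2"
proof -
  define k where "k = (CARD('k) - 1) div m"
  have mk: "m * k = CARD('k) - 1" unfolding k_def using primitive_root_dvd[OF m(1)] m(2) by fastforce
  define d where "d = rep_divisor g P"
  have cD: "D \<in> carrier (jacobian g f)" "D' \<in> carrier (jacobian g f)" 
    using D D' unfolding rational_jacobian_def by auto
  have Q': "Q j \<in> pts" if "j \<in> {1..g}" for j using Q that by blast
  have h: "is_div h (frag_cmul (int m) d)" using h unfolding has_divisor_iff d_def .
  then have nh: "nzf h" by (simp add: is_div_def)
  have d: "d \<in> D" "on_curve d" "divisor_degree d = 0" "frobenius_divisor d = d"
    unfolding d_def using rep class_on_curve[OF cD(1)] reduced_rational[OF D rep(1) P red(1)] by auto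
  have lkd: "lk d R = mult_at P R - int g * of_bool (R = Infinity)" for R
    unfolding d_def by (rule lookup_rep_divisor)
  \<comment> \<open>The zero of order g at infinity cancels the term -g P_infinity in the
    representative of E, and u is a unit at the affine P_i. Adding the divisor of u therefore makes
    the support disjoint from that of d.\<close>
  obtain u du where u: "is_div u du" "frobenius_divisor du = du" "ordP Infinity u = int g"
    "\<And>R. R \<in> P ` {1..g} - {Infinity} \<Longrightarrow> ordP R u = 0"
    using moving_function[of "P ` {1..g} - {Infinity}"] P by blast
  have nu: "nzf u" using u by (simp add: is_div_def)
  have rQ: "frobenius_divisor (rep_divisor g Q) = rep_divisor g Q" 
    by (rule reduced_rational[OF D' rep(2) Q' red(2)])
  define e where "e = rep_divisor g Q + du"
  have e: "e \<in> D'" "on_curve e" "divisor_degree e = 0" 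
    unfolding e_def using class_add[OF cD(2) rep(2) u(1)] class_on_curve[OF cD(2)] by blast+
  have fe: "frobenius_divisor e = e"
    using u(2) rQ unfolding e_def frobenius_divisor_def frag_extend_add by simp
  have lke: "lk e R = mult_at Q R - int g * of_bool (R = Infinity) + ordP R u" if "R \<in> pts" for R
    unfolding e_def using u(1) that by (simp add: lookup_add lookup_rep_divisor is_div_def)
  have Qinf: "mult_at Q Infinity = 0" using mult_at_pos[of Q Infinity] Q by blast
  have disj: "lk e R = 0" if R: "R \<in> Poly_Mapping.keys d" for R
  proof -
    have Rp: "R \<in> pts" using R d(2) by (auto simp: on_curve_def)
    show ?thesis
    proof (cases "R = Infinity")
      case True
      then show ?thesis using lke[OF Rp] u(3) Qinf by simp
    next
      case False
      then have "mult_at P R \<noteq> 0" using R lkd by (simp add: in_keys_iff)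
      then obtain i where i: "i \<in> {1..g}" "P i = R" using mult_at_pos by blast
      then have "mult_at Q R = 0" using mult_at_pos[of Q R] dist by metis
      moreover have "ordP R u = 0" using u(4) i False by blast
      ultimately show ?thesis using lke[OF Rp] False by simp
    qed
  qed
  have eval: "eval_divisor g f h' e' = lc_prod h' e'" 
    if "is_div h' (frag_cmul (int m) d')" "on_curve e'" 
      "Poly_Mapping.keys e' \<inter> Poly_Mapping.keys (frag_cmul (int m) d') = {}" for h' d' e'
  proof (rule eval_divisor_eq_T)
    fix R assume R: "R \<in> Poly_Mapping.keys e'"
    then have "R \<notin> Poly_Mapping.keys (frag_cmul (int m) d')" "R \<in> pts" using that by (auto simp: on_curve_def)
    then show "ordP R h' = 0" using that(1) by (simp add: is_div_def in_keys_iff)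
  qed (use that in \<open>auto simp: is_div_def\<close>)
  have dis: "Poly_Mapping.keys e \<inter> Poly_Mapping.keys (frag_cmul (int m) d) = {}"
    using disj by (auto simp: in_keys_iff)
  \<comment> \<open>The definite description needs one admissible triple, namely d, e, h, and the
    agreement of all others with it, which is \<open>lc_prod_independent\<close>.\<close>
  have tate: "tate_pairing g f m D D' = lc_prod h e ^ k"
    unfolding tate_pairing_def k_def[symmetric] has_divisor_iff
  proof (rule the_equality)
    show "\<exists>d1\<in>D. \<exists>e1\<in>D'. \<exists>h1. frobenius_divisor d1 = d1 \<and> frobenius_divisor e1 = e1 \<and> is_div h1 (frag_cmul (int m) d1) \<and>
      Poly_Mapping.keys e1 \<inter> Poly_Mapping.keys (frag_cmul (int m) d1) = {} \<and> lc_prod h e ^ k = eval_divisor g f h1 e1 ^ k"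
      using d e(1) fe h dis eval[OF h e(2) dis] by metis
  next
    fix z assume "\<exists>d\<in>D. \<exists>e\<in>D'. \<exists>h'. frobenius_divisor d = d \<and> frobenius_divisor e = e \<and> is_div h' (frag_cmul (int m) d) \<and>
      Poly_Mapping.keys e \<inter> Poly_Mapping.keys (frag_cmul (int m) d) = {} \<and> z = eval_divisor g f h' e ^ k"
    then obtain d' e' h' where z: "d' \<in> D" "e' \<in> D'" "frobenius_divisor d' = d'" "frobenius_divisor e' = e'"
      "is_div h' (frag_cmul (int m) d')" "Poly_Mapping.keys e' \<inter> Poly_Mapping.keys (frag_cmul (int m) d') = {}"
      "z = eval_divisor g f h' e' ^ k" by blast
    obtain w where w: "is_div w (d' - d)" using class_diff[OF cD(1) d(1) z(1)] by blast
    obtain v where v: "is_div v (e' - e)" using class_diff[OF cD(2) e(1) z(2)] by blast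
    have "z = lc_prod h' e' ^ k" using z(7) eval[OF z(5) class_on_curve(1)[OF cD(2) z(2)] z(6)] by simp
    also have "\<dots> = lc_prod h e ^ k" by (rule lc_prod_independent[OF mk h z(5) d(2,4,3) z(3) e(2) fe e(3) z(4) w v])
    finally show "z = lc_prod h e ^ k" .
  qed
  define c where "c = (\<Sum>j=1..g. frag_of (Q j) - frag_of (opposite (Q j)))"
  have lkc: "lk c R = mult_at Q R - mult_at Q (opposite R)" for R
    unfolding c_def sum_subtractf lookup_minus lookup_sum_frag mult_at_opposite by (simp add: mult_at_def)
  have keys_c: "\<exists>j\<in>{1..g}. R = Q j \<or> R = opposite (Q j)" if "R \<in> Poly_Mapping.keys c" for R
  proof -
    have "mult_at Q R \<noteq> 0 \<or> mult_at Q (opposite R) \<noteq> 0" using that lkc by (auto simp: in_keys_iff)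
    then show ?thesis using mult_at_pos opposite_opposite by metis
  qed
  have oc: "on_curve c" unfolding on_curve_def using keys_c Q' opposite_pts by blast
  have "lc_prod h c = eval_divisor g f h c"
  proof (rule eval_divisor_eq_T[symmetric, OF oc nh])
    fix R assume R: "R \<in> Poly_Mapping.keys c"
    then have Rp: "R \<in> pts" using oc by (auto simp: on_curve_def)
    obtain j where j: "j \<in> {1..g}" "R = Q j \<or> R = opposite (Q j)" using keys_c R by blast
    \<comment> \<open>Opposites of affine points are affine, so c avoids infinity, the only possible
      pole of h. The zeros of h are avoided by the two inequalities in \<open>dist\<close>.\<close>
    have "R \<noteq> Infinity" using j Q[OF j(1)] by (cases "Q j") auto
    moreover have "mult_at P R = 0" using mult_at_pos[of P R] dist j by metis
    ultimately show "ordP R h = 0" using h Rp lkd by (simp add: is_div_def)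
  qed
  then have v: "v_pairing g f m h Q = lc_prod h c ^ k" unfolding v_pairing_def c_def k_def by simp
  define dw where "dw = e + e - c"
  \<comment> \<open>Subtracting Q_j - Q_j' from 2 Q_j leaves Q_j + Q_j', so 2 e - c is twice the
    divisor of u plus the divisors of the vertical lines through the Q_j.\<close>
  define w where "w = u * u * (\<Prod>j\<in>{1..g}. lin (Q j))"
  have np: "nzf (\<Prod>j\<in>{1..g}. lin (Q j))" by (intro nzf_prod nzf_lin)
  have w: "is_div w dw" unfolding is_div_def
  proof (intro conjI ballI)
    show "w \<in> FF" "w \<noteq> 0" unfolding w_def using nzf_mult[OF nzf_mult[OF nu nu] np] by auto
    show "on_curve dw" unfolding dw_def using keys_add[of e e] keys_diff[of "e + e" c] e(2) oc 
      by (auto simp: on_curve_def)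
    fix R assume R: "R \<in> pts"
    have "ordP R (\<Prod>j\<in>{1..g}. lin (Q j)) = (\<Sum>j\<in>{1..g}. ordP R (lin (Q j)))"
      by (intro ordP_prod R nzf_lin)
    also have "\<dots> = (\<Sum>j\<in>{1..g}. of_bool (R = Q j) + of_bool (R = opposite (Q j)) - 2 * of_bool (R = Infinity))"
      using ordP_lin[OF Q' R] by (intro sum.cong) auto
    also have "\<dots> = mult_at Q R + mult_at Q (opposite R) - 2 * int g * of_bool (R = Infinity)"
      unfolding mult_at_opposite[symmetric] by (simp add: sum.distrib sum_subtractf mult_at_def)
    finally have "ordP R w = 2 * ordP R u + (mult_at Q R + mult_at Q (opposite R) - 2 * int g * of_bool (R = Infinity))"
      unfolding w_def ordP_mult[OF R nzf_mult[OF nu nu] np] ordP_mult[OF R nu nu] by simp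
    then show "ordP R w = lk dw R" 
      unfolding dw_def lookup_minus lookup_add lke[OF R] lkc by simp
  qed
  \<comment> \<open>The individual Q_j need not be rational, but Frobenius permutes them with
    multiplicities and commutes with opposites; this makes c rational.\<close>
  have "mult_at Q (frobenius R) = mult_at Q R" for R
  proof -
    have "lk (rep_divisor g Q) (frobenius R) = lk (rep_divisor g Q) R"
      using rQ frobenius_divisor_fixed_iff by blast
    moreover have "frobenius R = Infinity \<longleftrightarrow> R = Infinity" by (cases R) auto
    ultimately show ?thesis unfolding lookup_rep_divisor by simp
  qed
  then have "lk c (frobenius R) = lk c R" for R
    unfolding lkc frobenius_opposite[symmetric] by simp
  then have "frobenius_divisor c = c" using frobenius_divisor_fixed_iff by blast
  then have fdw: "frobenius_divisor dw = dw"
    using fe unfolding dw_def frobenius_divisor_def frag_extend_add frag_extend_diff by simp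
  have "lc_prod h e * lc_prod h e = lc_prod h (e + e)" by (rule lc_prod_add[symmetric, OF e(2) e(2) nh])
  also have "e + e = c + dw" by (simp add: dw_def)
  also have "lc_prod h (c + dw) = lc_prod h c * lc_prod h dw" using lc_prod_add[OF oc _ nh] w by (simp add: is_div_def)
  finally have "(lc_prod h e * lc_prod h e) ^ k = (lc_prod h c * lc_prod h dw) ^ k" by simp
  then have "lc_prod h e ^ k * lc_prod h e ^ k = lc_prod h c ^ k * lc_prod h dw ^ k" by (simp add: power_mult_distrib)
  then show ?thesis unfolding v tate using lc_prod_principal_eq_1[OF mk h d(2,4,3) w fdw] by (simp add: power2_eq_square)
qed

end

theorem theorem3:
  fixes f :: "'k::{field,finite} poly" and g m :: nat
    and D E :: "'k divisor set"
    and P Q :: "nat \<Rightarrow> 'k alg_closure point"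
    and h :: "'k fun_field"
  assumes "hyperelliptic_curve g f"
    and "m > 0" and "\<exists>z::'k. primitive_root_of_unity m z"
    and "D \<in> rational_torsion g f m"
    and "E \<in> rational_jacobian g f"
    and "\<And>i. i \<in> {1..g} \<Longrightarrow> P i \<in> curve_points f"
    and "\<And>j. j \<in> {1..g} \<Longrightarrow> Q j \<in> curve_points f - {Infinity}"
    and "semi_reduced g P" and "semi_reduced g Q"
    and "rep_divisor g P \<in> D" and "rep_divisor g Q \<in> E"
    and "\<And>i j. i \<in> {1..g} \<Longrightarrow> j \<in> {1..g} \<Longrightarrow> P i \<noteq> Q j \<and> P i \<noteq> opposite (Q j)"
    and "has_divisor g f h
           (frag_cmul (int m) (\<Sum>i=1..g. frag_of (P i)) - frag_cmul (int (g * m)) (frag_of Infinity))"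
  shows "v_pairing g f m h Q = tate_pairing g f m D E ^ 2 \<or>
         v_pairing g f m h Q = - (tate_pairing g f m D E ^ 2)"
proof -
  interpret hyperelliptic g f by unfold_locales (fact assms(1))
  have "frag_cmul (int m) (rep_divisor g P) = 
    frag_cmul (int m) (\<Sum>i=1..g. frag_of (P i)) - frag_cmul (int (g * m)) (frag_of Infinity)"
    unfolding rep_divisor_def by (rule poly_mapping_eqI) (simp add: lookup_minus algebra_simps)
  then have "has_divisor g f h (frag_cmul (int m) (rep_divisor g P))" using assms(13) by (simp only:)
  moreover have "D \<in> rational_jacobian g f" using assms(4) by (simp add: rational_torsion_def)
  ultimately have "v_pairing g f m h Q = tate_pairing g f m D E ^ 2"
    by (intro v_pairing_eq_tate_pairing_square[OF assms(2,3) _ assms(5-12)])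
  then show ?thesis by blast
qed

end
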